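(* For a sufficiently small constant $\epsilon\in(0,1)$, there is a deterministic dynamic algorithm that, on an $n$-node graph undergoing edge insertions and deletions starting from the empty graph, maintains a $(4 + O(\epsilon))$-approximation to the value of the densest subgraph. The algorithm requires $\tilde O(m+n)$ space (where $m$ is the current number of edges), has an amortized update time of $\tilde O(1)$ and a query time of $O(1)$.
   Context: $G=(V,E)$ is an unweighted undirected graph with fixed node set $V$, $|V|=n$, initially $E=\emptyset$; each update inserts a new edge or deletes an existing one. For nonempty $S\subseteq V$, $\rho(S)=|E(S)|/|S|$ with $E(S)$ the edges having both endpoints in $S$; the value of the densest subgraph is $\rho^*(G)=\max_{S\subseteq V}\rho(S)$. A query returns an estimate $\eta$; it is a $\gamma$-approximation if $\rho^*(G)/\gamma\le\eta\le\rho^*(G)$. $\tilde O(\cdot)$ hides $\mathrm{poly}(\log n,1/\epsilon)$ factors. *)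

theory Defs
  imports Complex_Main
begin

section \<open>Densest subgraph\<close>

text \<open>A graph on a node set \<open>V\<close> is given by its set of edges, each edge being a
  two-element subset of \<open>V\<close>.\<close>

definition induced_edges :: "'a set set \<Rightarrow> 'a set \<Rightarrow> 'a set set" where
  "induced_edges E S = {e \<in> E. e \<subseteq> S}"

definition density :: "'a set set \<Rightarrow> 'a set \<Rightarrow> real" where
  "density E S = real (card (induced_edges E S)) / real (card S)"

definition max_density :: "'a set \<Rightarrow> 'a set set \<Rightarrow> real" where
  "max_density V E = Max (density E ` {S. S \<subseteq> V \<and> S \<noteq> {}})"

definition approximates :: "real \<Rightarrow> real \<Rightarrow> real \<Rightarrow> bool" where
  "approximates \<gamma> opt \<eta> \<longleftrightarrow> opt / \<gamma> \<le> \<eta> \<and> \<eta> \<le> opt"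


section \<open>A word RAM\<close>

text \<open>The memory is an array of words. There are no separate registers: a program variable is a
  memory cell with a literal address, so every word a program uses counts towards its space.
  The machine has two parameters: the word length \<open>w\<close> in bits, and a limit \<open>S\<close> on the addresses
  that may be read or written. Producing a value that does not fit into a word, or accessing an
  address outside \<open>{..<S}\<close>, is a fault: then \<open>eval\<close> yields \<open>None\<close> and \<open>exec\<close> does not relate the
  initial state to any result.\<close>

type_synonym memory = "nat \<Rightarrow> nat"

datatype binop = Plus | Minus | Times | Divide | Less_Than | Equal

text \<open>Subtraction is truncated at 0, division rounds down (division by 0 gives 0), and
  the comparisons return 1 or 0.\<close>

fun apply_binop :: "binop \<Rightarrow> nat \<Rightarrow> nat \<Rightarrow> nat" where
  "apply_binop Plus x y = x + y"
| "apply_binop Minus x y = x - y"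
| "apply_binop Times x y = x * y"
| "apply_binop Divide x y = x div y"
| "apply_binop Less_Than x y = (if x < y then 1 else 0)"
| "apply_binop Equal x y = (if x = y then 1 else 0)"

datatype expr =
    Lit nat
  | Mem expr
  | Bin binop expr expr

fun eval :: "nat \<Rightarrow> nat \<Rightarrow> memory \<Rightarrow> expr \<Rightarrow> nat option" where
  "eval w S s (Lit k) = (if k < 2 ^ w then Some k else None)"
| "eval w S s (Mem a) =
     (case eval w S s a of
        None \<Rightarrow> None
      | Some i \<Rightarrow> if i < S then Some (s i) else None)"
| "eval w S s (Bin f a b) =
     (case (eval w S s a, eval w S s b) of
        (Some x, Some y) \<Rightarrow> if apply_binop f x y < 2 ^ w then Some (apply_binop f x y) else None
      | _ \<Rightarrow> None)"

fun expr_cost :: "expr \<Rightarrow> nat" where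
  "expr_cost (Lit k) = 1"
| "expr_cost (Mem a) = expr_cost a + 1"
| "expr_cost (Bin f a b) = expr_cost a + expr_cost b + 1"

text \<open>\<open>Store a b\<close> writes the value of \<open>b\<close> to the cell whose address is the value of \<open>a\<close>.
  A condition counts as true if its value is nonzero.\<close>

datatype com =
    Skip
  | Store expr expr
  | Seq com com
  | Cond expr com com
  | Loop expr com

text \<open>\<open>exec w S c s t s'\<close>: started in memory \<open>s\<close>, the command \<open>c\<close> terminates without a fault
  after \<open>t\<close> unit-cost steps in memory \<open>s'\<close>.\<close>

inductive exec :: "nat \<Rightarrow> nat \<Rightarrow> com \<Rightarrow> memory \<Rightarrow> nat \<Rightarrow> memory \<Rightarrow> bool"
  for w S :: nat where
  Skip: "exec w S Skip s 1 s"
| Store: "\<lbrakk>eval w S s a = Some i; i < S; eval w S s b = Some x\<rbrakk>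
    \<Longrightarrow> exec w S (Store a b) s (expr_cost a + expr_cost b + 1) (s(i := x))"
| Seq: "\<lbrakk>exec w S c s t s'; exec w S d s' t' s''\<rbrakk>
    \<Longrightarrow> exec w S (Seq c d) s (t + t') s''"
| CondTrue: "\<lbrakk>eval w S s b = Some x; x \<noteq> 0; exec w S c s t s'\<rbrakk>
    \<Longrightarrow> exec w S (Cond b c d) s (expr_cost b + 1 + t) s'"
| CondFalse: "\<lbrakk>eval w S s b = Some 0; exec w S d s t s'\<rbrakk>
    \<Longrightarrow> exec w S (Cond b c d) s (expr_cost b + 1 + t) s'"
| LoopTrue: "\<lbrakk>eval w S s b = Some x; x \<noteq> 0; exec w S c s t s'; exec w S (Loop b c) s' t' s''\<rbrakk>
    \<Longrightarrow> exec w S (Loop b c) s (expr_cost b + 1 + t + t') s''"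
| LoopFalse: "eval w S s b = Some 0
    \<Longrightarrow> exec w S (Loop b c) s (expr_cost b + 1) s"

inductive_cases exec_SkipE: "exec w S Skip s t s'"
inductive_cases exec_StoreE: "exec w S (Store a b) s t s'"
inductive_cases exec_SeqE: "exec w S (Seq c d) s t s'"
inductive_cases exec_CondE: "exec w S (Cond b c d) s t s'"
inductive_cases exec_LoopE: "exec w S (Loop b c) s t s'"

lemma exec_deterministic:
  "exec w S c s t s' \<Longrightarrow> exec w S c s t2 s2 \<Longrightarrow> t2 = t \<and> s2 = s'"
proof (induction arbitrary: t2 s2 rule: exec.induct)
  case (Skip s)
  then show ?case by (rule exec_SkipE) simp
next
  case (Store s a i b x)
  from Store.prems show ?case by (rule exec_StoreE) (use Store.hyps in simp)
next
  case (Seq c s t s' d t' s'')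
  from Seq.prems obtain u r u' where *: "exec w S c s u r" "exec w S d r u' s2" "t2 = u + u'"
    by (rule exec_SeqE)
  then show ?case using Seq.IH(1)[OF *(1)] Seq.IH(2)[of u' s2] by simp
next
  case (CondTrue s b x c t s' d)
  from CondTrue.prems obtain u where *: "exec w S c s u s2" "t2 = expr_cost b + 1 + u"
    by (rule exec_CondE) (use CondTrue.hyps in simp_all)
  then show ?case using CondTrue.IH[OF *(1)] by simp
next
  case (CondFalse s b d t s' c)
  from CondFalse.prems obtain u where *: "exec w S d s u s2" "t2 = expr_cost b + 1 + u"
    by (rule exec_CondE) (use CondFalse.hyps in simp_all)
  then show ?case using CondFalse.IH[OF *(1)] by simp
next
  case (LoopTrue s b x c t s' t' s'')
  from LoopTrue.prems obtain u r u' where *: "exec w S c s u r" "exec w S (Loop b c) r u' s2"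
      "t2 = expr_cost b + 1 + u + u'"
    by (rule exec_LoopE) (use LoopTrue.hyps in simp_all)
  then show ?case using LoopTrue.IH(1)[OF *(1)] LoopTrue.IH(2)[of u' s2] by simp
next
  case (LoopFalse s b c)
  from LoopFalse.prems show ?case by (rule exec_LoopE) (use LoopFalse.hyps in simp_all)
qed


section \<open>Dynamic graph algorithms\<close>

text \<open>A (deterministic) dynamic algorithm consists of four programs. The node set is \<open>{..<n}\<close>.
  Preprocessing starts with \<open>n\<close> in cell 0 and all other cells 0. An update of the edge \<open>{u, v}\<close>
  starts with \<open>u\<close> and \<open>v\<close> placed into cells 0 and 1. A query leaves its answer, a
  nonnegative rational number, as numerator and denominator in cells 0 and 1.\<close>

datatype dyn_alg =
  Dyn_Alg (preprocess: com) (insert_edge: com) (delete_edge: com) (query: com)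

definition initial_memory :: "nat \<Rightarrow> memory" where
  "initial_memory n = (\<lambda>_. 0)(0 := n)"

definition with_operands :: "memory \<Rightarrow> nat \<Rightarrow> nat \<Rightarrow> memory" where
  "with_operands s u v = s(0 := u, 1 := v)"

definition can_insert :: "nat \<Rightarrow> nat set set \<Rightarrow> nat \<Rightarrow> nat \<Rightarrow> bool" where
  "can_insert n E u v \<longleftrightarrow> u < n \<and> v < n \<and> u \<noteq> v \<and> {u, v} \<notin> E"

definition can_delete :: "nat set set \<Rightarrow> nat \<Rightarrow> nat \<Rightarrow> bool" where
  "can_delete E u v \<longleftrightarrow> {u, v} \<in> E"

text \<open>\<open>reachable A w space n E k T s\<close>: after preprocessing and some sequence of updates and
  interleaved queries, of which \<open>k\<close> are updates, the graph has edge set \<open>E\<close>, the memory is \<open>s\<close>,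
  and the updates have taken \<open>T\<close> steps in total. Each operation is executed with
  the address limit \<open>space m\<close>, where \<open>m\<close> is the number of edges after the operation.\<close>

inductive reachable ::
    "dyn_alg \<Rightarrow> nat \<Rightarrow> (nat \<Rightarrow> nat) \<Rightarrow> nat \<Rightarrow> nat set set \<Rightarrow> nat \<Rightarrow> nat \<Rightarrow> memory \<Rightarrow> bool"
  for A :: dyn_alg and w :: nat and space :: "nat \<Rightarrow> nat" and n :: nat where
  start: "exec w (space 0) (preprocess A) (initial_memory n) t s
    \<Longrightarrow> reachable A w space n {} 0 0 s"
| insertion: "\<lbrakk>reachable A w space n E k T s; can_insert n E u v;
      exec w (space (card (E \<union> {{u, v}}))) (insert_edge A) (with_operands s u v) t s'\<rbrakk>
    \<Longrightarrow> reachable A w space n (E \<union> {{u, v}}) (k + 1) (T + t) s'"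
| deletion: "\<lbrakk>reachable A w space n E k T s; can_delete E u v;
      exec w (space (card (E - {{u, v}}))) (delete_edge A) (with_operands s u v) t s'\<rbrakk>
    \<Longrightarrow> reachable A w space n (E - {{u, v}}) (k + 1) (T + t) s'"
| answer: "\<lbrakk>reachable A w space n E k T s; exec w (space (card E)) (query A) s t s'\<rbrakk>
    \<Longrightarrow> reachable A w space n E k T s'"

text \<open>The algorithm never faults and always terminates; preprocessing takes at most \<open>prep_time\<close>
  steps; any \<open>k\<close> updates, starting from the empty graph, take at most
  \<open>k * update_time\<close> steps in total; every single query takes at most \<open>query_time\<close> steps and
  returns a \<open>\<gamma>\<close>-approximation. Between operations, all cells beyond the space bound for
  the current number of edges are 0, so that no information survives there when the
  graph has shrunk.\<close>

definition maintains_densest_subgraph_value ::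
    "dyn_alg \<Rightarrow> nat \<Rightarrow> real \<Rightarrow> nat \<Rightarrow> (nat \<Rightarrow> nat) \<Rightarrow> real \<Rightarrow> real \<Rightarrow> real \<Rightarrow> bool" where
  "maintains_densest_subgraph_value A n \<gamma> w space prep_time update_time query_time \<longleftrightarrow>
     (\<exists>t s. exec w (space 0) (preprocess A) (initial_memory n) t s \<and> real t \<le> prep_time) \<and>
     (\<forall>E k T s. reachable A w space n E k T s \<longrightarrow>
        real T \<le> real k * update_time \<and>
        (\<forall>i \<ge> space (card E). s i = 0) \<and>
        (\<forall>u v. can_insert n E u v \<longrightarrow>
           (\<exists>t s'. exec w (space (card (E \<union> {{u, v}}))) (insert_edge A)
                     (with_operands s u v) t s')) \<and>
        (\<forall>u v. can_delete E u v \<longrightarrow>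
           (\<exists>t s'. exec w (space (card (E - {{u, v}}))) (delete_edge A)
                     (with_operands s u v) t s')) \<and>
        (\<exists>t s'. exec w (space (card E)) (query A) s t s' \<and> real t \<le> query_time \<and>
           s' 1 \<noteq> 0 \<and>
           approximates \<gamma> (max_density {..<n} E) (real (s' 0) / real (s' 1))))"

text \<open>A factor \<open>poly(log n, 1/\<epsilon>)\<close>; the shift by 1 keeps the logarithm from vanishing at
  \<open>n = 1\<close>.\<close>

definition soft_factor :: "real \<Rightarrow> nat \<Rightarrow> nat \<Rightarrow> real \<Rightarrow> real" where
  "soft_factor c q n \<epsilon> = c * (log 2 (real n + 1) / \<epsilon>) ^ q"

end

theory Submission
  imports Defs
begin

text \<open>Every vertex has a level, and level \<open>i\<close> has a degree threshold \<open>d\<^sub>i\<close> that grows by a factor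
  \<open>1 + \<epsilon>\<^sup>2 / log n\<close> per level. A vertex on level \<open>i\<close> rises if it has more than \<open>(2 + O(\<epsilon>)) d\<^sub>i\<close> neighbours
  on levels \<open>\<ge> i\<close> and falls if it has fewer than \<open>d\<^bsub>i-1\<^esub>\<close> on levels \<open>\<ge> i - 1\<close>. When no
  vertex wants to move and \<open>i\<close> is the highest nonempty level, charging every edge to its lower
  endpoint gives \<open>\<rho>\<^sup>* \<le> (2 + O(\<epsilon>)) d\<^sub>i\<close>. Conversely, among \<open>O(log n / \<epsilon>)\<close> consecutive levels below \<open>i\<close>, two
  successive upper level sets have almost the same size; the larger one has average degree close to \<open>d\<^sub>i\<close>,
  so \<open>\<rho>\<^sup>* \<ge> (1 - O(\<epsilon>)) d\<^sub>i / 2\<close>. The slack between the two thresholds pays for all moves by a potential argument.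

  On the word RAM each edge is stored twice, in rows indexed by a vertex and the minimum of the levels
  of its endpoints, so that a move touches only edges paid for by the potential. The rows are binary
  tries sharing one gap-free pool of nodes, which keeps the space proportional to the current graph.\<close>

section \<open>Program logic\<close>

text \<open>The factor 4 is a product of two factors 2. One separates density from average degree.
  The other separates the rising from the falling threshold and is forced by the potential: a fall
  of \<open>u\<close> past \<open>x\<close> neighbours raises the potential of each of them by about
  \<open>M * B\<close>, while the credit saved by \<open>u\<close> has itself been reduced by
  \<open>M * B * x\<close>. As \<open>M * x\<close> may come close to \<open>thr M i\<close>, the
  rising threshold has to be about \<open>2 * B * thr M i\<close> in the units of
  \<open>up_ok\<close>. A second obstacle is that the space bound follows the current number of
  edges. The machine is therefore a locale with its capacity \<open>P\<close> as a parameter. It is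
  instantiated anew for every operation, and the invariant that survives between operations does not
  mention \<open>P\<close>. The roots of the rows take \<open>O(n T)\<close> nodes and a scan over
  all levels takes \<open>O(T)\<close> steps. Both are affordable because \<open>T\<close> is
  polynomial in \<open>log n\<close> and \<open>1 / \<epsilon>\<close>.\<close>

fun val :: "memory \<Rightarrow> expr \<Rightarrow> nat" where
  "val s (Lit k) = k"
| "val s (Mem a) = s (val s a)"
| "val s (Bin f a b) = apply_binop f (val s a) (val s b)"

text \<open>\<open>eval\<close> interleaves values with fault checks. A total value
  \<open>val\<close> and a separate predicate \<open>safe\<close> let the simplifier compute values
  and discharge side conditions independently. Only sums and products carry an overflow condition,
  since the other operations never exceed their first operand or 1. The parameter \<open>W\<close>
  is the word bound itself, not the word length.\<close>

fun safe :: "nat \<Rightarrow> nat \<Rightarrow> memory \<Rightarrow> expr \<Rightarrow> bool" where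
  "safe W S s (Lit k) \<longleftrightarrow> k < W"
| "safe W S s (Mem a) \<longleftrightarrow> safe W S s a \<and> val s a < S"
| "safe W S s (Bin f a b) \<longleftrightarrow> safe W S s a \<and> safe W S s b \<and>
     (f \<in> {Plus, Times} \<longrightarrow> apply_binop f (val s a) (val s b) < W)"

lemma eval_val:
  assumes "\<And>a. s a < 2 ^ w" "1 < (2::nat) ^ w" "safe (2 ^ w) S s e"
  shows "eval w S s e = Some (val s e) \<and> val s e < 2 ^ w"
  using assms(3)
proof (induction e)
  case (Bin f a b)
  then have *: "eval w S s a = Some (val s a)" "val s a < 2 ^ w"
    "eval w S s b = Some (val s b)" "val s b < 2 ^ w" by auto
  have "apply_binop f (val s a) (val s b) < 2 ^ w"
    using Bin.prems * assms(2) le_less_trans[OF div_le_dividend *(2)]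
    by (cases f) auto
  then show ?case using * by simp
qed (use assms in auto)

text \<open>Operations are verified with the address limit that belongs to the node capacity. This
  transfers their runs to the larger space bound of the theorem.\<close>

lemma exec_mono: "exec w S c s t s' \<Longrightarrow> S \<le> S' \<Longrightarrow> exec w S' c s t s'"
proof -
  have ev: "eval w S s e = Some x \<Longrightarrow> S \<le> S' \<Longrightarrow> eval w S' s e = Some x" for s e x
    by (induction e arbitrary: x) (auto split: option.splits if_splits)
  show "exec w S c s t s' \<Longrightarrow> S \<le> S' \<Longrightarrow> exec w S' c s t s'"
  proof (induction rule: exec.induct)
    case (Skip s)
    show ?case by (rule exec.Skip)
  next
    case (Store s a i b x)
    then show ?case by (intro exec.Store ev[OF Store(1)] ev[OF Store(3)]) simp_all
  next
    case (Seq c s t s' d t' s'')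
    then show ?case by (blast intro: exec.Seq)
  next
    case (CondTrue s b x c t s' d)
    then show ?case by (blast intro: exec.CondTrue ev)
  next
    case (CondFalse s b d t s' c)
    then show ?case by (blast intro: exec.CondFalse ev)
  next
    case (LoopTrue s b x c t s' t' s'')
    then show ?case by (blast intro: exec.LoopTrue ev)
  next
    case (LoopFalse s b c)
    then show ?case by (blast intro: exec.LoopFalse ev)
  qed
qed

section \<open>Memory layout and timed weakest preconditions\<close>

definition cell :: "nat \<Rightarrow> nat \<Rightarrow> nat" where
  "cell f i = 64 + f + 8 * i"

lemma cell_inject: "f < 8 \<Longrightarrow> g < 8 \<Longrightarrow> cell f i = cell g j \<longleftrightarrow> f = g \<and> i = j"
proof
  assume *: "f < 8" "g < 8" "cell f i = cell g j"
  then have "(f + 8 * i) div 8 = (g + 8 * j) div 8" by (simp add: cell_def)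
  then show "f = g \<and> i = j" using * by (simp add: cell_def)
qed simp

lemma cell_header [simp]: "k < 64 \<Longrightarrow> cell f i \<noteq> k" "k < 64 \<Longrightarrow> k \<noteq> cell f i"
  unfolding cell_def by auto

text \<open>The array \<open>f\<close> has its entry \<open>i\<close> in \<open>cell f i\<close>: eight arrays are interleaved behind 64
  scalar variables, so that all array addresses are formed with literals.\<close>

abbreviation Var :: "nat \<Rightarrow> expr" where "Var k \<equiv> Mem (Lit k)"

definition Addr :: "nat \<Rightarrow> expr \<Rightarrow> expr" where
  "Addr f e = Bin Plus (Lit (64 + f)) (Bin Times (Lit 8) e)"

definition Child :: "expr \<Rightarrow> expr \<Rightarrow> expr" where
  "Child c e = Bin Plus (Bin Plus (Lit 69) c) (Bin Times (Lit 8) e)"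

abbreviation Arr :: "nat \<Rightarrow> expr \<Rightarrow> expr" where "Arr f e \<equiv> Mem (Addr f e)"

notation Seq (infixr ";;" 60)

abbreviation Set_Var :: "nat \<Rightarrow> expr \<Rightarrow> com" (infix ":=\<^sub>v" 65) where
  "k :=\<^sub>v e \<equiv> Store (Lit k) e"

abbreviation Plus_E (infixl "\<oplus>" 75) where "a \<oplus> b \<equiv> Bin Plus a b"
abbreviation Minus_E (infixl "\<ominus>" 75) where "a \<ominus> b \<equiv> Bin Minus a b"
abbreviation Times_E (infixl "\<otimes>" 80) where "a \<otimes> b \<equiv> Bin Times a b"
abbreviation Divide_E (infixl "\<oslash>" 80) where "a \<oslash> b \<equiv> Bin Divide a b"
abbreviation Less_E (infix "\<lless>" 70) where "a \<lless> b \<equiv> Bin Less_Than a b"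
abbreviation Equal_E (infix "\<doteq>" 70) where "a \<doteq> b \<equiv> Bin Equal a b"

lemma val_Addr [simp]: "val s (Addr f e) = cell f (val s e)"
  by (simp add: Addr_def cell_def)

lemma val_Child [simp]: "val s (Child c e) = cell (5 + val s c) (val s e)"
  by (simp add: Child_def cell_def)

lemma cost_Addr [simp]: "expr_cost (Addr f e) = expr_cost e + 4"
  by (simp add: Addr_def)

lemma cost_Child [simp]: "expr_cost (Child c e) = expr_cost c + expr_cost e + 5"
  by (simp add: Child_def)

text \<open>\<open>P\<close> is the common length of the eight arrays.
  \<open>64 + 8 * P \<le> W\<close> makes every usable address a word, and
  \<open>1024 \<le> W\<close> takes care of the small literals in the programs.\<close>

locale machine =
  fixes w P W :: nat
  assumes W_eq: "W = 2 ^ w" and P_le: "64 + 8 * P \<le> W" and W_ge: "1024 \<le> W"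
begin

definition S :: nat where "S = 64 + 8 * P"

abbreviation ok :: "memory \<Rightarrow> expr \<Rightarrow> bool" where "ok \<equiv> safe W S"

definition mem_ok :: "memory \<Rightarrow> bool" where "mem_ok s \<longleftrightarrow> (\<forall>a. s a < W)"

text \<open>That memory cells stay below the word bound is carried along inside \<open>wp\<close>, so that only
  sums and products have to be bounded.\<close>

definition wp :: "com \<Rightarrow> (nat \<Rightarrow> memory \<Rightarrow> bool) \<Rightarrow> memory \<Rightarrow> bool" where
  "wp c Q s \<longleftrightarrow> (mem_ok s \<longrightarrow> (\<exists>t s'. exec w S c s t s' \<and> mem_ok s' \<and> Q t s'))"

lemma lit_less [simp]: "numeral k < (1024::nat) \<Longrightarrow> numeral k < W" "0 < W" "Suc 0 < W" "1 < W"
  using W_ge by linarith+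

lemma eval_ok: "mem_ok s \<Longrightarrow> ok s e \<Longrightarrow> eval w S s e = Some (val s e)"
  and val_less: "mem_ok s \<Longrightarrow> ok s e \<Longrightarrow> val s e < W"
proof -
  assume "mem_ok s" "ok s e"
  then have "eval w S s e = Some (val s e) \<and> val s e < 2 ^ w"
    using W_ge by (intro eval_val) (auto simp: mem_ok_def simp flip: W_eq)
  then show "eval w S s e = Some (val s e)" "val s e < W" by (simp_all add: W_eq)
qed

lemma ok_Addr [simp]: "f < 8 \<Longrightarrow> ok s (Addr f e) \<longleftrightarrow> ok s e \<and> cell f (val s e) < W"
  using P_le W_ge unfolding Addr_def cell_def by auto

lemma ok_Child [simp]: "ok s (Child c e) \<longleftrightarrow> ok s c \<and> ok s e \<and> cell (5 + val s c) (val s e) < W"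
  using P_le W_ge unfolding Child_def cell_def by auto

lemma cell_less: "f < 8 \<Longrightarrow> i < P \<Longrightarrow> cell f i < W" "f < 8 \<Longrightarrow> cell f i < S \<longleftrightarrow> i < P"
  using P_le unfolding cell_def S_def by auto

lemma wp_conseq: "wp c Q s \<Longrightarrow> (\<And>t s'. Q t s' \<Longrightarrow> Q' t s') \<Longrightarrow> wp c Q' s"
  unfolding wp_def by blast

lemma wp_Skip: "wp Skip Q s \<longleftrightarrow> (mem_ok s \<longrightarrow> Q 1 s)"
  unfolding wp_def by (metis exec.Skip exec_SkipE)

lemma wp_Skip_I: "Q 1 s \<Longrightarrow> wp Skip Q s"
  by (simp add: wp_Skip)

lemma wp_Store:
  assumes "ok s a" "val s a < S" "ok s b"
    "Q (expr_cost a + expr_cost b + 1) (s(val s a := val s b))"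
  shows "wp (Store a b) Q s"
proof -
  have "mem_ok (s(val s a := val s b))" if "mem_ok s"
    using val_less[OF that assms(3)] that by (auto simp: mem_ok_def)
  then show ?thesis
    unfolding wp_def using assms exec.Store[of w S s a "val s a" b "val s b"] eval_ok by blast
qed

lemma wp_Seq: "wp c (\<lambda>t s'. wp d (\<lambda>t'. Q (t + t')) s') s \<Longrightarrow> wp (c ;; d) Q s"
  unfolding wp_def by (meson exec.Seq)

lemma wp_Cond:
  assumes "ok s b" "val s b \<noteq> 0 \<Longrightarrow> wp c (\<lambda>t. Q (expr_cost b + 1 + t)) s"
    "val s b = 0 \<Longrightarrow> wp d (\<lambda>t. Q (expr_cost b + 1 + t)) s"
  shows "wp (Cond b c d) Q s"
proof (cases "val s b = 0")
  case True
  then show ?thesis using assms(1,3) unfolding wp_def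
    by (metis eval_ok exec.CondFalse)
next
  case False
  then show ?thesis using assms(1,2) unfolding wp_def
    by (metis eval_ok exec.CondTrue)
qed

text \<open>The natural number in the loop invariant is the time still available; it also makes the
  loop terminate.\<close>

lemma wp_Loop:
  assumes "I k s"
    and step: "\<And>k s. I k s \<Longrightarrow> mem_ok s \<Longrightarrow> ok s b"
      "\<And>k s. I k s \<Longrightarrow> mem_ok s \<Longrightarrow> val s b \<noteq> 0 \<Longrightarrow>
         wp c (\<lambda>t s'. \<exists>k'. I k' s' \<and> k' + t + expr_cost b + 1 \<le> k) s"
    and exit: "\<And>k' t s'. I k' s' \<Longrightarrow> val s' b = 0 \<Longrightarrow> t + k' \<le> k + expr_cost b + 1 \<Longrightarrow> Q t s'"
  shows "wp (Loop b c) Q s"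
proof -
  have "I k s \<Longrightarrow> wp (Loop b c) (\<lambda>t s'. \<exists>k'. I k' s' \<and> val s' b = 0 \<and> t + k' \<le> k + expr_cost b + 1) s"
    for k s
  proof (induction k arbitrary: s rule: less_induct)
    case (less k)
    show ?case
    proof (cases "mem_ok s")
      case ms: True
      note okb = step(1)[OF less.prems ms]
      show ?thesis
      proof (cases "val s b = 0")
        case True
        then show ?thesis unfolding wp_def
          using exec.LoopFalse[of w S s b c] less.prems ms eval_ok[OF ms okb] by fastforce
      next
        case False
        obtain t s' k' where 1: "exec w S c s t s'" "mem_ok s'" "I k' s'"
          "k' + t + expr_cost b + 1 \<le> k"
          using step(2)[OF less.prems ms False] ms unfolding wp_def by blast
        then obtain t' s'' k'' where 2: "exec w S (Loop b c) s' t' s''" "mem_ok s''" "I k'' s''"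
          "val s'' b = 0" "t' + k'' \<le> k' + expr_cost b + 1"
          using less.IH[of k' s'] unfolding wp_def by fastforce
        have "exec w S (Loop b c) s (expr_cost b + 1 + t + t') s''"
          using exec.LoopTrue[OF _ False 1(1) 2(1)] eval_ok[OF ms okb] by simp
        then show ?thesis unfolding wp_def using 1 2 by fastforce
      qed
    qed (simp add: wp_def)
  qed
  from wp_conseq[OF this[OF assms(1)]] show ?thesis using exit by blast
qed

lemma wp_exec:
  assumes "wp c Q s" "mem_ok s" "S \<le> S'"
  obtains t s' where "exec w S' c s t s'" "mem_ok s'" "Q t s'"
  using assms exec_mono unfolding wp_def by blast

end

context machine begin

lemma ok_Arr: "f < 8 \<Longrightarrow> ok s (Arr f e) \<longleftrightarrow> ok s e \<and> val s e < P"
  using cell_less[of f "val s e"] by auto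

lemma ok_Mem_Child: "val s c < 3 \<Longrightarrow> ok s (Mem (Child c e)) \<longleftrightarrow> ok s c \<and> ok s e \<and> val s e < P"
  using cell_less[of "5 + val s c" "val s e"] by auto

lemma ok_Var: "k < 64 \<Longrightarrow> ok s (Var k)"
  using W_ge by (simp add: S_def)

lemma header_less [simp]: "0 < S" "Suc 0 < S" "numeral k < (64::nat) \<Longrightarrow> numeral k < S"
  unfolding S_def by (simp_all add: trans_less_add1)

lemma wp_Var: "k < 64 \<Longrightarrow> ok s x \<Longrightarrow> Q (expr_cost x + 2) (s(k := val s x)) \<Longrightarrow> wp (k :=\<^sub>v x) Q s"
  using W_ge by (intro wp_Store) (auto simp: S_def)

lemma wp_Arr: "f < 8 \<Longrightarrow> ok s e \<Longrightarrow> val s e < P \<Longrightarrow> ok s x \<Longrightarrow>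
    Q (expr_cost e + expr_cost x + 5) (s(cell f (val s e) := val s x)) \<Longrightarrow>
    wp (Store (Addr f e) x) Q s"
  using cell_less[of f "val s e"] by (intro wp_Store) (auto simp: add_ac)

lemma wp_Child: "val s c < 3 \<Longrightarrow> ok s c \<Longrightarrow> ok s e \<Longrightarrow> val s e < P \<Longrightarrow> ok s x \<Longrightarrow>
    Q (expr_cost c + expr_cost e + expr_cost x + 6) (s(cell (5 + val s c) (val s e) := val s x)) \<Longrightarrow>
    wp (Store (Child c e) x) Q s"
  using cell_less[of "5 + val s c" "val s e"] by (intro wp_Store) (auto simp: add_ac)

text \<open>A sequence is split here only if its head is an assignment or a conditional. Repeated
  application thus stops at the call of a verified subprogram, whose specification is then applied
  explicitly.\<close>

lemmas wp_steps = wp_Skip_I wp_Var wp_Arr wp_Child wp_Seq[OF wp_Var] wp_Seq[OF wp_Arr]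
  wp_Seq[OF wp_Child] wp_Seq[OF wp_Cond] wp_Cond

lemmas wp_rules = wp_Skip_I wp_Var wp_Arr wp_Child wp_Seq wp_Cond

end

section \<open>A forest of binary tries\<close>

text \<open>The nodes are numbered \<open>0, \<dots>, p - 1\<close>, and the numbers below \<open>R\<close> are the roots. A node
  is identified by its code: the root \<open>r\<close> has code \<open>R + r\<close> and the children of a node with code
  \<open>c\<close> have codes \<open>2 c\<close> and \<open>2 c + 1\<close>. A child pointer \<open>0\<close> is a null pointer. Every inner node
  that is neither a root nor the exceptional node \<open>e\<close> must have a child.\<close>

definition forest ::
    "nat \<Rightarrow> nat \<Rightarrow> (nat \<Rightarrow> nat) \<Rightarrow> (nat \<Rightarrow> nat \<Rightarrow> nat) \<Rightarrow> (nat \<Rightarrow> nat) \<Rightarrow> nat \<Rightarrow> nat \<Rightarrow> bool" where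
  "forest R b code ch par p e \<longleftrightarrow>
     R \<le> p \<and> inj_on code {..<p} \<and>
     (\<forall>k<p. R \<le> code k \<and> code k < 2 * R * 2 ^ b) \<and>
     (\<forall>k<R. code k = R + k) \<and>
     (\<forall>k<p. \<forall>c<2. ch c k \<noteq> 0 \<longrightarrow> R \<le> ch c k \<and> ch c k < p \<and> code (ch c k) = 2 * code k + c) \<and>
     (\<forall>k. R \<le> k \<and> k < p \<longrightarrow> par k < p \<and> code (par k) = code k div 2 \<and>
        ch (code k mod 2) (par k) = k) \<and>
     (\<forall>k. R \<le> k \<and> k < p \<and> k \<noteq> e \<and> code k < R * 2 ^ b \<longrightarrow> ch 0 k \<noteq> 0 \<or> ch 1 k \<noteq> 0)"

context
  fixes R b code ch par p e
  assumes forest: "forest R b code ch par p e"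
begin

lemmas forest_conjs = forest[unfolded forest_def]

lemma roots_le: "R \<le> p"
  using forest_conjs by (rule conjunct1)

lemma code_inj: "i < p \<Longrightarrow> j < p \<Longrightarrow> code i = code j \<longleftrightarrow> i = j"
  using forest_conjs[THEN conjunct2, THEN conjunct1] by (simp add: inj_on_eq_iff)

lemma code_ge: "k < p \<Longrightarrow> R \<le> code k"
  and code_less: "k < p \<Longrightarrow> code k < 2 * R * 2 ^ b"
  using forest_conjs[THEN conjunct2, THEN conjunct2, THEN conjunct1] by blast+

lemma code_root: "k < R \<Longrightarrow> code k = R + k"
  using forest_conjs[THEN conjunct2, THEN conjunct2, THEN conjunct2, THEN conjunct1] by blast

lemma child_ge: "k < p \<Longrightarrow> c < 2 \<Longrightarrow> ch c k \<noteq> 0 \<Longrightarrow> R \<le> ch c k"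
  and child_less: "k < p \<Longrightarrow> c < 2 \<Longrightarrow> ch c k \<noteq> 0 \<Longrightarrow> ch c k < p"
  and code_child: "k < p \<Longrightarrow> c < 2 \<Longrightarrow> ch c k \<noteq> 0 \<Longrightarrow> code (ch c k) = 2 * code k + c"
  using forest_conjs[THEN conjunct2, THEN conjunct2, THEN conjunct2, THEN conjunct2, THEN conjunct1]
  by blast+

lemma par_less: "R \<le> k \<Longrightarrow> k < p \<Longrightarrow> par k < p"
  and code_par: "R \<le> k \<Longrightarrow> k < p \<Longrightarrow> code (par k) = code k div 2"
  and child_par: "R \<le> k \<Longrightarrow> k < p \<Longrightarrow> ch (code k mod 2) (par k) = k"
  using forest_conjs[THEN conjunct2, THEN conjunct2, THEN conjunct2, THEN conjunct2,
      THEN conjunct2, THEN conjunct1]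
  by blast+

lemma has_child: "R \<le> k \<Longrightarrow> k < p \<Longrightarrow> k \<noteq> e \<Longrightarrow> code k < R * 2 ^ b \<Longrightarrow> ch 0 k \<noteq> 0 \<or> ch 1 k \<noteq> 0"
  using forest_conjs[THEN conjunct2, THEN conjunct2, THEN conjunct2, THEN conjunct2,
      THEN conjunct2, THEN conjunct2]
  by blast

text \<open>The codes from \<open>R\<close> to \<open>2 * R - 1\<close> are all taken by the roots,
  and codes are distinct.\<close>

lemma code_nonroot:
  assumes "R \<le> k" "k < p"
  shows "2 * R \<le> code k"
proof (rule ccontr)
  assume "\<not> ?thesis"
  then have *: "code k - R < R" "R + (code k - R) = code k" using code_ge[OF assms(2)] by auto
  then have "code (code k - R) = code k" using code_root by simp
  then show False using code_inj[of "code k - R" k] * assms by auto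
qed

text \<open>Links are determined by codes: halving the code of \<open>j\<close> gives the code of
  its parent, and distinctness leaves only \<open>k\<close>. In particular, a null pointer means
  that no node has the corresponding code.\<close>

lemma child_par_eq:
  assumes "0 < R" "j < p" "k < p" "c < 2" "code j = 2 * code k + c"
  shows "R \<le> j" "par j = k" "ch c k = j" "ch c k \<noteq> 0"
proof -
  have "code j mod 2 = c" "code j div 2 = code k" using assms by auto
  moreover show "R \<le> j"
  proof (rule ccontr)
    assume "\<not> R \<le> j"
    then have "code j < 2 * R" using code_root[of j] by auto
    then show False using code_ge[of k] assms by auto
  qed
  ultimately show "par j = k" "ch c k = j"
    using code_par[of j] child_par[of j] par_less[of j] code_inj[of "par j" k] assms by auto
  then show "ch c k \<noteq> 0" using \<open>R \<le> j\<close> assms by auto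
qed

text \<open>The exception permits one childless inner node while an insertion descends or a deletion
  climbs. The assumption lists the situations in which this permission is no longer used by
  \<open>e\<close>, so that any other node may take it over.\<close>

lemma forest_exception:
  assumes "ch 0 e \<noteq> 0 \<or> ch 1 e \<noteq> 0 \<or> e < R \<or> R * 2 ^ b \<le> code e"
  shows "forest R b code ch par p e'"
proof -
  have "ch 0 k \<noteq> 0 \<or> ch 1 k \<noteq> 0" if "R \<le> k" "k < p" "code k < R * 2 ^ b" for k
    using has_child[of k] that assms by (cases "k = e") auto
  then show ?thesis
    unfolding forest_def
    by (intro conjI forest_conjs[THEN conjunct2, THEN conjunct1] allI impI)
      (auto simp: roots_le code_ge code_less code_root child_ge child_less code_child par_less
        code_par child_par)
qed

text \<open>Following nonnull child pointers ends at a leaf, because codes at least double and are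
  bounded; as \<open>e\<close> is a root, it exempts no node on the way. The distance is below
  \<open>b\<close>, since dividing a leaf code by \<open>2 ^ b\<close> already gives a root
  code.\<close>

lemma code_prefix:
  assumes "0 < R" "R \<le> k" "k < p" "e < R"
  shows "\<exists>j<b. \<exists>l<p. R * 2 ^ b \<le> code l \<and> code k = code l div 2 ^ j"
proof -
  have "\<exists>j. \<exists>l<p. R * 2 ^ b \<le> code l \<and> code k = code l div 2 ^ j"
    using assms
  proof (induction "2 * R * 2 ^ b - code k" arbitrary: k rule: less_induct)
    case less
    show ?case
    proof (cases "R * 2 ^ b \<le> code k")
      case True
      then show ?thesis using less.prems by (intro exI[of _ 0] exI[of _ k]) auto
    next
      case False
      obtain c where c: "c < 2" "ch c k \<noteq> 0"
        using has_child[of k] False less.prems that[of 0] that[of 1] by fastforce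
      define k' where "k' = ch c k"
      have k': "R \<le> k'" "k' < p" "code k' = 2 * code k + c"
        using c less.prems child_less child_ge code_child by (auto simp: k'_def)
      have "code k > 0" using code_ge[of k] less.prems by auto
      then have "2 * R * 2 ^ b - code k' < 2 * R * 2 ^ b - code k"
        using code_less[of k'] k' by auto
      from less.hyps[OF this] k' less.prems
      obtain j l where *: "l < p" "R * 2 ^ b \<le> code l" "code k' = code l div 2 ^ j" by blast
      have "code k = code k' div 2" using k' c by auto
      also have "\<dots> = code l div 2 ^ Suc j" using * by (simp only: power_Suc2 div_mult2_eq)
      finally show ?thesis using * by blast
    qed
  qed
  then obtain j l where *: "l < p" "R * 2 ^ b \<le> code l" "code k = code l div 2 ^ j" by blast
  have "j < b"
  proof (rule ccontr)
    assume "\<not> j < b"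
    then have "code l div 2 ^ j \<le> code l div 2 ^ b"
      by (intro div_le_mono2) (auto intro: power_increasing)
    also have "\<dots> < 2 * R" using code_less[of l] * by (simp add: less_mult_imp_div_less)
    finally show False using code_nonroot[of k] assms * by simp
  qed
  then show ?thesis using * by blast
qed

text \<open>A node that is not a root is the ancestor of some leaf at a distance below
  \<open>b\<close>, so the pairs of a distance and a leaf code cover all such nodes. This keeps the
  pool linear in the number of keys, up to the factor \<open>b\<close>.\<close>

lemma nodes_le:
  assumes "0 < R" "e < R"
  shows "p \<le> R + b * card {x \<in> code ` {..<p}. R * 2 ^ b \<le> x}"
proof -
  let ?X = "{x \<in> code ` {..<p}. R * 2 ^ b \<le> x}"
  have "code ` {R..<p} \<subseteq> (\<lambda>(j, x). x div 2 ^ j) ` ({..<b} \<times> ?X)"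
    using code_prefix[OF assms(1) _ _ assms(2)] by (fastforce simp: image_iff)
  then have "card (code ` {R..<p}) \<le> card ({..<b} \<times> ?X)"
    by (intro surj_card_le) auto
  moreover have "card (code ` {R..<p}) = p - R"
    by (subst card_image) (auto simp: inj_on_def code_inj)
  ultimately show ?thesis by (simp add: card_cartesian_product)
qed

end

text \<open>The new node is childless and becomes the exception, while the old exception
  \<open>cur\<close> has gained a child. The new code cannot occur already, for otherwise the
  pointer in \<open>cur\<close> would be nonnull.\<close>

lemma forest_extend:
  assumes f: "forest R b code ch par p cur" and "0 < R" "cur < p" "c < 2" "ch c cur = 0"
    "2 * code cur + c < 2 * R * 2 ^ b" "ch 0 p = 0" "ch 1 p = 0"
  shows "forest R b (code(p := 2 * code cur + c)) (ch(c := (ch c)(cur := p))) (par(p := cur))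
    (Suc p) p"
proof -
  note F = roots_le[OF f] code_inj[OF f] code_ge[OF f] code_less[OF f] code_root[OF f]
    child_less[OF f] child_ge[OF f] code_child[OF f] par_less[OF f] code_par[OF f]
    child_par[OF f] has_child[OF f]
  have new: "code j \<noteq> 2 * code cur + c" if "j < p" for j
    using child_par_eq(4)[OF f _ that] assms by blast
  have ch0: "ch d p = 0" if "d < 2" for d using assms(7,8) less_2_cases[OF that] by auto
  have 3: "k < p \<Longrightarrow> d < 2 \<Longrightarrow> ch d k \<noteq> p" for d k
    using child_less[OF f, of k d] by (cases "ch d k = 0") auto
  show ?thesis
    unfolding forest_def
  proof (intro conjI allI impI)
    show "R \<le> Suc p" using F(1) by simp
    show "inj_on (code(p := 2 * code cur + c)) {..<Suc p}"
      using new F(2) unfolding inj_on_def by (auto simp: less_Suc_eq) (metis new)+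
    fix k
    show "k < R \<Longrightarrow> (code(p := 2 * code cur + c)) k = R + k" using F(1,5) by auto
    show "k < Suc p \<Longrightarrow> R \<le> (code(p := 2 * code cur + c)) k"
      using F(3) F(3)[OF assms(3)] by (auto simp: less_Suc_eq intro: trans_le_add1)
    show "k < Suc p \<Longrightarrow> (code(p := 2 * code cur + c)) k < 2 * R * 2 ^ b"
      using F(4) assms by (auto simp: less_Suc_eq)
    fix d :: nat
    assume d: "k < Suc p" "d < 2" "(ch(c := (ch c)(cur := p))) d k \<noteq> 0"
    show "R \<le> (ch(c := (ch c)(cur := p))) d k" using d F(1,7) ch0 by (auto simp: less_Suc_eq split: if_splits)
    show "(ch(c := (ch c)(cur := p))) d k < Suc p" using d F(6) ch0 by (auto simp: less_Suc_eq split: if_splits)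
    show "(code(p := 2 * code cur + c)) ((ch(c := (ch c)(cur := p))) d k) =
        2 * (code(p := 2 * code cur + c)) k + d"
    proof (cases "d = c \<and> k = cur")
      case True
      then show ?thesis using assms by auto
    next
      case False
      then have "k < p" "(ch(c := (ch c)(cur := p))) d k = ch d k" "ch d k \<noteq> 0"
        using d ch0[of d] assms(3) by (auto simp: less_Suc_eq split: if_splits)
      then show ?thesis using 3[of k d] F(8) d by auto
    qed
  next
    fix k assume "R \<le> k \<and> k < Suc p"
    then have k: "R \<le> k" "k < Suc p" by auto
    show "(par(p := cur)) k < Suc p" using k F(9) assms by (auto simp: less_Suc_eq)
    show "(code(p := 2 * code cur + c)) ((par(p := cur)) k) = (code(p := 2 * code cur + c)) k div 2"
      using k F(9)[of k] F(10) assms by (auto simp: less_Suc_eq)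
    show "(ch(c := (ch c)(cur := p))) ((code(p := 2 * code cur + c)) k mod 2) ((par(p := cur)) k) = k"
      using k F(11)[of k] assms by (auto simp: less_Suc_eq)
  next
    fix k assume "R \<le> k \<and> k < Suc p \<and> k \<noteq> p \<and> (code(p := 2 * code cur + c)) k < R * 2 ^ b"
    then have k: "R \<le> k" "k < p" "code k < R * 2 ^ b" by auto
    have "p \<noteq> 0" using assms by auto
    then show "(ch(c := (ch c)(cur := p))) 0 k \<noteq> 0 \<or> (ch(c := (ch c)(cur := p))) 1 k \<noteq> 0"
      using k F(12)[of k] assms less_2_cases[OF assms(4)] by (cases "k = cur") auto
  qed
qed

text \<open>Node \<open>k\<close> is deleted and the last node \<open>l\<close> takes over its number.\<close>

lemma forest_remove:
  assumes f: "forest R b code ch par p k" and k: "0 < R" "R \<le> k" "k < p" "ch 0 k = 0" "ch 1 k = 0"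
    and l: "l = p - 1"
    and code': "\<And>i. i < l \<Longrightarrow> code' i = code (if i = k then l else i)"
    and ch': "\<And>i d. i < l \<Longrightarrow> d < 2 \<Longrightarrow> ch' d i =
      (let j = ch d (if i = k then l else i) in if j = k then 0 else if j = l then k else j)"
    and par': "\<And>i. R \<le> i \<Longrightarrow> i < l \<Longrightarrow> par' i =
      (let j = par (if i = k then l else i) in if j = l then k else j)"
    and e: "e = (if par k = l then k else par k)"
  shows "forest R b code' ch' par' l e" "code' ` {..<l} = code ` {..<p} - {code k}"
proof -
  define old where "old i = (if i = k then l else i)" for i
  define new where "new j = (if j = l then k else j)" for j
  note F = roots_le[OF f] code_inj[OF f] code_ge[OF f] code_less[OF f] code_root[OF f]
  have old: "old i < p" "old i \<noteq> k" "new (old i) = i" if "i < l" for i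
    using that k l by (auto simp: old_def new_def)
  have new: "new j < l" "old (new j) = j" if "j < p" "j \<noteq> k" for j
    using that k l by (auto simp: old_def new_def)
  have old_ge: "R \<le> old i" if "R \<le> i" "i < l" for i using that k l by (auto simp: old_def)
  have new_ge: "R \<le> new i" if "R \<le> i" for i using that k l by (auto simp: new_def)
  have code: "code' i = code (old i)" if "i < l" for i using code'[OF that] by (simp add: old_def)
  have chn: "ch' d i = (if ch d (old i) = k then 0 else new (ch d (old i)))" if "i < l" "d < 2" for d i
    using ch'[OF that] by (simp add: old_def new_def Let_def)
  have parn: "par' i = new (par (old i))" if "R \<le> i" "i < l" for i
    using par'[OF that] by (simp add: old_def new_def Let_def)
  have kp: "par j \<noteq> k" if "R \<le> j" "j < p" for j
  proof
    assume "par j = k"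
    then have "ch (code j mod 2) k = j" using child_par[OF f that] by simp
    moreover have "ch (code j mod 2) k = 0" using k(4,5) mod2_eq_if[of "code j"] by auto
    ultimately show False using that k by simp
  qed
  have chE: "R \<le> ch' d i \<and> ch' d i < l \<and> code' (ch' d i) = 2 * code' i + d"
    if "i < l" "d < 2" "ch' d i \<noteq> 0" for i d
  proof -
    have x: "ch d (old i) \<noteq> k" "ch' d i = new (ch d (old i))"
      using that chn[OF that(1,2)] by (auto split: if_splits)
    have "new 0 = 0" using k l by (auto simp: new_def)
    then have x0: "ch d (old i) \<noteq> 0" using that(3) x(2) by metis
    have "R \<le> ch d (old i)" "ch d (old i) < p" "code (ch d (old i)) = 2 * code (old i) + d"
      using child_ge[OF f _ that(2) x0] child_less[OF f _ that(2) x0] code_child[OF f _ that(2) x0]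
        old(1)[OF that(1)] by auto
    then show ?thesis using x new new_ge code that(1) by metis
  qed
  have parE: "par' i < l \<and> code' (par' i) = code' i div 2 \<and> ch' (code' i mod 2) (par' i) = i"
    if "R \<le> i" "i < l" for i
  proof -
    let ?j = "old i"
    have j: "R \<le> ?j" "?j < p" "?j \<noteq> k" using old old_ge that by auto
    note q = par_less[OF f j(1,2)] code_par[OF f j(1,2)] child_par[OF f j(1,2)] kp[OF j(1,2)]
    have 1: "par' i < l" "old (par' i) = par ?j" using parn[OF that] new[OF q(1,4)] by auto
    have "ch' (code' i mod 2) (par' i) = new ?j"
      using chn[OF 1(1), of "code' i mod 2"] 1(2) q(3) j(3) code[OF that(2)] by simp
    then show ?thesis using 1 q code old(3) that by simp
  qed
  have child: "ch' 0 i \<noteq> 0 \<or> ch' 1 i \<noteq> 0" if i: "R \<le> i" "i < l" "i \<noteq> e" "code' i < R * 2 ^ b" for i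
  proof -
    let ?j = "old i"
    have j: "R \<le> ?j" "?j < p" "?j \<noteq> k" using old old_ge that by auto
    obtain d where d: "d = 0 \<or> d = 1" "d < 2" "ch d ?j \<noteq> 0"
      using has_child[OF f j(1,2,3)] code[OF i(2)] i(4) by force
    have "ch d ?j \<noteq> k"
    proof
      assume "ch d ?j = k"
      then have "code k = 2 * code ?j + d" using code_child[OF f j(2) d(2,3)] by simp
      then have "par k = ?j" using child_par_eq(2)[OF f k(1,3) j(2) d(2)] by simp
      then have "e = new ?j" by (simp add: e new_def)
      then show False using old(3) i by simp
    qed
    then have "ch' d i = new (ch d ?j)" using chn i d by auto
    moreover have "new (ch d ?j) \<noteq> 0"
      using child_ge[OF f j(2) d(2,3)] new_ge[of "ch d ?j"] k(1) by linarith
    ultimately show ?thesis using d by auto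
  qed
  have inj: "inj_on code' {..<l}"
    unfolding inj_on_def using code code_inj[OF f] old by (metis lessThan_iff)
  have root: "code' i = R + i" if "i < R" for i
    using that k l code[of i] code_root[OF f that] by (auto simp: old_def)
  show "forest R b code' ch' par' l e"
    unfolding forest_def
  proof (intro conjI)
    show "R \<le> l" using k l by simp
    show "inj_on code' {..<l}" by (rule inj)
    show "\<forall>i<l. R \<le> code' i \<and> code' i < 2 * R * 2 ^ b" using code F(3,4) old(1) by simp
    show "\<forall>i<R. code' i = R + i" using root by blast
  qed (use chE parE child in blast)+
  have "code ` {..<p} - {code k} = code ` ({..<p} - {k})"
    using k code_inj[OF f] by (auto simp: image_iff)
  also have "{..<p} - {k} = old ` {..<l}"
  proof
    show "old ` {..<l} \<subseteq> {..<p} - {k}" using old(1,2) by auto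
    show "{..<p} - {k} \<subseteq> old ` {..<l}"
    proof
      fix j assume "j \<in> {..<p} - {k}"
      then have "j = old (new j)" "new j \<in> {..<l}" using new[of j] by auto
      then show "j \<in> old ` {..<l}" by (rule image_eqI)
    qed
  qed
  also have "code ` old ` {..<l} = code' ` {..<l}"
    unfolding image_image using code by (intro image_cong) auto
  finally show "code' ` {..<l} = code ` {..<p} - {code k}" by simp
qed

text \<open>\<open>forest_remove\<close> renumbers by one simultaneous substitution, whereas the
  program writes one field after the other. \<open>ch1\<close> to \<open>ch4\<close> are the child
  arrays after its four groups of writes: unlinking \<open>k\<close>, copying the children of
  \<open>l\<close> to \<open>k\<close>, redirecting the parent of \<open>l\<close>, and unlinking
  once more. The last group serves the case \<open>k = l\<close>, where the redirection restores the
  pointer that has just been removed. A null child of \<open>l\<close> causes a write to the parent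
  field of node 0, which is a root; \<open>forest\<close> constrains parents only from
  \<open>R\<close> on.\<close>

lemma forest_remove_program:
  assumes f: "forest R b code ch par p k" and k: "0 < R" "R \<le> k" "k < p" "ch 0 k = 0" "ch 1 k = 0"
    and l: "l = p - 1" and c: "c = code k mod 2" and d: "d = code l mod 2"
    and e: "e = (if par k = l then k else par k)"
    and ch1: "\<And>g i. g < 2 \<Longrightarrow> ch1 g i = (if g = c \<and> i = par k then 0 else ch g i)"
    and ch2: "\<And>g i. g < 2 \<Longrightarrow> ch2 g i = (if i = k then ch1 g l else ch1 g i)"
    and ch3: "\<And>g i. g < 2 \<Longrightarrow> ch3 g i = (if g = d \<and> i = par l then k else ch2 g i)"
    and ch4: "\<And>g i. g < 2 \<Longrightarrow> i < l \<Longrightarrow> ch4 g i = (if g = c \<and> i = e then 0 else ch3 g i)"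
    and code': "\<And>i. i < l \<Longrightarrow> code' i = (if i = k then code l else code i)"
    and par': "\<And>i. i < l \<Longrightarrow> par' i =
      (if i = ch1 1 l \<or> i = ch1 0 l then k else if i = k then par l else par i)"
  shows "forest R b code' ch4 par' l e" "code' ` {..<l} = code ` {..<p} - {code k}"
proof -
  have cd: "c < 2" "d < 2" by (auto simp: c d)
  have lp: "l < p" "R \<le> l" using k l by auto
  have ck: "ch c (par k) = k" and dl: "ch d (par l) = l"
    using child_par[OF f] k lp by (auto simp: c d)
  have pk: "par k < p" and pl: "par l < p" using par_less[OF f] k lp by auto
  have uniq: "x = par j" "g = code j mod 2"
    if "ch g x = j" "g < 2" "x < p" "R \<le> j" "j < p" for g x j
  proof -
    have "code j = 2 * code x + g" using code_child[OF f that(3,2)] that k by auto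
    then show "x = par j" "g = code j mod 2"
      using child_par_eq(2)[OF f k(1) that(5,3,2)] that by auto
  qed
  have g0: "ch g k = 0" if "g < 2" for g using that k(4,5) less_2_cases[of g] by auto
  have pkk: "par k \<noteq> k" "par l \<noteq> k" using ck dl g0 cd k lp by auto
  have pll: "par l \<noteq> l"
  proof
    assume "par l = l"
    then have "code l = 2 * code l + d" using dl code_child[OF f lp(1) cd(2)] lp k by simp
    then show False using code_ge[OF f lp(1)] k by simp
  qed
  have ch': "ch4 g i = (let j = ch g (if i = k then l else i) in if j = k then 0 else if j = l then k else j)"
    if i: "i < l" and g: "g < 2" for i g
  proof (cases "i = k")
    case True
    then have kl: "k \<noteq> l" using i by simp
    have 1: "ch g l = k \<longleftrightarrow> g = c \<and> l = par k"
      using uniq[of g l k] ck g lp k by (auto simp: c)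
    have 2: "ch g l \<noteq> l" using uniq[of g l l] pll g lp by auto
    have "ch4 g k = (if g = c \<and> l = par k then 0 else ch g l)"
      using kl i g pkk by (auto simp: ch4 ch3 ch2 ch1 e True)
    then show ?thesis using True 1 2 by (simp add: Let_def)
  next
    case False
    have 1: "ch g i = k \<longleftrightarrow> g = c \<and> i = par k"
      using uniq[of g i k] ck g lp k i by (auto simp: c)
    have 2: "ch g i = l \<longleftrightarrow> g = d \<and> i = par l"
      using uniq[of g i l] dl g lp k i by (auto simp: d)
    have "i = e \<longleftrightarrow> i = par k" using False i by (simp add: e)
    then have "ch4 g i = (if g = c \<and> i = par k then 0 else if g = d \<and> i = par l then k else ch g i)"
      using False i g by (simp add: ch4 ch3 ch2 ch1)
    then show ?thesis using False unfolding Let_def 1[symmetric] 2[symmetric] by simp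
  qed
  have code'': "code' i = code (if i = k then l else i)" if "i < l" for i
    using that by (simp add: code')
  have par'': "par' i = (let j = par (if i = k then l else i) in if j = l then k else j)"
    if i: "R \<le> i" "i < l" for i
  proof (cases "i = k")
    case True
    have "ch1 0 l \<noteq> k" "ch1 1 l \<noteq> k"
      using uniq[of 0 l k] uniq[of 1 l k] lp k by (auto simp: ch1 c)
    then show ?thesis using True i pll by (simp add: par')
  next
    case False
    have 1: "ch1 g l = i \<longleftrightarrow> ch g l = i" if "g < 2" for g
      using False i k ck ch1[OF that, of l] by (auto split: if_splits)
    have 2: "ch 0 l = i \<or> ch 1 l = i \<longleftrightarrow> par i = l"
    proof
      assume "ch 0 l = i \<or> ch 1 l = i"
      then show "par i = l" using uniq(1)[of 0 l i] uniq(1)[of 1 l i] lp i by auto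
    next
      assume "par i = l"
      then show "ch 0 l = i \<or> ch 1 l = i"
        using child_par[OF f, of i] i lp mod2_eq_if[of "code i"] by (auto split: if_splits)
    qed
    have "i = ch1 1 l \<or> i = ch1 0 l \<longleftrightarrow> par i = l"
      unfolding 2[symmetric] using 1[of 0] 1[of 1] by auto
    then show ?thesis unfolding par'[OF i(2)] Let_def using False by simp
  qed
  show "forest R b code' ch4 par' l e" "code' ` {..<l} = code ` {..<p} - {code k}"
    using forest_remove[OF f k l code'' ch' par'' e] by blast+
qed

section \<open>Trie nodes as memory cells\<close>

definition code_of :: "memory \<Rightarrow> nat \<Rightarrow> nat" where
  "code_of s k = s (cell 4 k)"

text \<open>The children occupy arrays 5 and 6, and array 7 holds the parents. Without the guard,
  \<open>child_of s 2\<close> would read parents, and the update rules below could not be equations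
  between functions.\<close>

definition child_of :: "memory \<Rightarrow> nat \<Rightarrow> nat \<Rightarrow> nat" where
  "child_of s c k = (if c < 2 then s (cell (5 + c) k) else 0)"

definition par_of :: "memory \<Rightarrow> nat \<Rightarrow> nat" where
  "par_of s k = s (cell 7 k)"

lemma node_header_update [simp]:
  assumes "a < 64"
  shows "code_of (s(a := x)) = code_of s" "child_of (s(a := x)) = child_of s"
    "par_of (s(a := x)) = par_of s"
  using assms by (auto simp: code_of_def child_of_def par_of_def fun_eq_iff)

lemma node_code_update [simp]:
  "code_of (s(cell 4 k := x)) = (code_of s)(k := x)" "child_of (s(cell 4 k := x)) = child_of s"
  "par_of (s(cell 4 k := x)) = par_of s"
  by (auto simp: code_of_def child_of_def par_of_def fun_eq_iff cell_inject)

lemma node_par_update [simp]: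
  "code_of (s(cell 7 k := x)) = code_of s" "child_of (s(cell 7 k := x)) = child_of s"
  "par_of (s(cell 7 k := x)) = (par_of s)(k := x)"
  by (auto simp: code_of_def child_of_def par_of_def fun_eq_iff cell_inject)

lemma node_child_update [simp]:
  assumes "c < 2"
  shows "code_of (s(cell (5 + c) k := x)) = code_of s"
    "child_of (s(cell (5 + c) k := x)) = (child_of s)(c := (child_of s c)(k := x))"
    "par_of (s(cell (5 + c) k := x)) = par_of s"
  using assms by (auto simp: code_of_def child_of_def par_of_def fun_eq_iff cell_inject)

lemmas node_child_update_01 [simp] =
  node_child_update[of 0, simplified] node_child_update[of 1, simplified]

lemma node_field_update [simp]:
  assumes "f < 4"
  shows "code_of (s(cell f k := x)) = code_of s" "child_of (s(cell f k := x)) = child_of s"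
    "par_of (s(cell f k := x)) = par_of s"
  using assms by (auto simp: code_of_def child_of_def par_of_def fun_eq_iff cell_inject)

lemma child_cells: "s (cell 5 k) = child_of s 0 k" "s (cell 6 k) = child_of s 1 k"
  by (auto simp: child_of_def)

lemma child_cell: "c < 2 \<Longrightarrow> s (cell (5 + c) k) = child_of s c k"
  by (auto simp: child_of_def)

lemma code_cell: "s (cell 4 k) = code_of s k" and par_cell: "s (cell 7 k) = par_of s k"
  by (auto simp: code_of_def par_of_def)

text \<open>The trie operations use the variables 42 to 54 as scratch space; 51 holds the number
  of nodes.\<close>

definition trie_frame :: "memory \<Rightarrow> memory \<Rightarrow> bool" where
  "trie_frame s s' \<longleftrightarrow> (\<forall>a<42. s' a = s a) \<and> (\<forall>f<4. \<forall>i. s' (cell f i) = s (cell f i))"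

lemma trie_frame_refl: "trie_frame s s"
  and trie_frame_trans: "trie_frame s s' \<Longrightarrow> trie_frame s' s'' \<Longrightarrow> trie_frame s s''"
  by (auto simp: trie_frame_def)

lemma trie_frame_header [simp]: "42 \<le> a \<Longrightarrow> a < 64 \<Longrightarrow> trie_frame s (s'(a := x)) \<longleftrightarrow> trie_frame s s'"
  by (auto simp: trie_frame_def)

lemma trie_frame_cell [simp]:
  "4 \<le> f \<Longrightarrow> f < 8 \<Longrightarrow> trie_frame s (s'(cell f k := x)) \<longleftrightarrow> trie_frame s s'"
  by (auto simp: trie_frame_def cell_inject)

lemma trie_frame_var: "trie_frame s s' \<Longrightarrow> a < 42 \<Longrightarrow> s' a = s a"
  and trie_frame_field: "trie_frame s s' \<Longrightarrow> f < 4 \<Longrightarrow> s' (cell f i) = s (cell f i)"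
  by (auto simp: trie_frame_def)

text \<open>A node freshly taken from the pool thus has null children without initialization, and
  the cells beyond the space bound are empty between operations.\<close>

definition clear_from :: "nat \<Rightarrow> memory \<Rightarrow> bool" where
  "clear_from p s \<longleftrightarrow> (\<forall>a \<ge> cell 0 p. s a = 0)"

lemma clear_from_header [simp]: "a < 64 \<Longrightarrow> clear_from p (s(a := x)) \<longleftrightarrow> clear_from p s"
  by (auto simp: clear_from_def cell_def)

lemma clear_from_cell [simp]:
  "f < 8 \<Longrightarrow> k < p \<Longrightarrow> clear_from p (s(cell f k := x)) \<longleftrightarrow> clear_from p s"
  by (auto simp: clear_from_def cell_def)

lemma clear_from_mono: "clear_from p s \<Longrightarrow> p \<le> q \<Longrightarrow> clear_from q s"
  by (auto simp: clear_from_def cell_def)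

lemma clear_fromD:
  assumes "clear_from p s" "p \<le> k"
  shows "code_of s k = 0" "child_of s c k = 0" "par_of s k = 0" "f < 8 \<Longrightarrow> s (cell f k) = 0"
  using assms by (auto simp: clear_from_def cell_def code_of_def child_of_def par_of_def)

text \<open>Because the arrays are interleaved, the eight cells of index \<open>p\<close> are
  contiguous and fill exactly the gap between the two bounds.\<close>

lemma clear_from_shrink:
  assumes "clear_from (Suc p) s" "\<And>f. f < 8 \<Longrightarrow> s (cell f p) = 0"
  shows "clear_from p s"
  unfolding clear_from_def
proof (intro allI impI)
  fix a assume a: "cell 0 p \<le> a"
  show "s a = 0"
  proof (cases "cell 0 (Suc p) \<le> a")
    case True
    then show ?thesis using assms(1) by (simp add: clear_from_def)
  next
    case False
    then have "a = cell (a - cell 0 p) p" "a - cell 0 p < 8" using a by (auto simp: cell_def)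
    then show ?thesis using assms(2) by metis
  qed
qed

lemmas node_cells = code_cell par_cell child_cells

section \<open>Programs on tries\<close>

definition t_key :: com where
  "t_key = (42 :=\<^sub>v ((Var 6 \<oplus> Var 40) \<otimes> Var 5 \<oplus> Var 41) ;; 43 :=\<^sub>v Var 40 ;; 44 :=\<^sub>v Var 5)"

text \<open>Variable 44 is the power of two belonging to the bits not yet read, 45 the prefix of the
  key that is the code of the next node, 46 the last bit of this prefix, obtained as a remainder,
  and 47 the next node. At a null pointer the first free number, \<open>Var 51\<close>, is
  taken.\<close>

definition t_insert_step :: com where
  "t_insert_step = (
     44 :=\<^sub>v (Var 44 \<oslash> Lit 2) ;;
     45 :=\<^sub>v (Var 42 \<oslash> Var 44) ;;
     46 :=\<^sub>v (Var 45 \<ominus> Lit 2 \<otimes> (Var 45 \<oslash> Lit 2)) ;;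
     47 :=\<^sub>v Mem (Child (Var 46) (Var 43)) ;;
     Cond (Var 47) Skip (
       Store (Addr 4 (Var 51)) (Var 45) ;;
       Store (Addr 7 (Var 51)) (Var 43) ;;
       Store (Child (Var 46) (Var 43)) (Var 51) ;;
       47 :=\<^sub>v Var 51 ;;
       51 :=\<^sub>v (Var 51 \<oplus> Lit 1)) ;;
     43 :=\<^sub>v Var 47)"

definition t_insert :: com where
  "t_insert = (t_key ;; Loop (Lit 1 \<lless> Var 44) t_insert_step)"

text \<open>Variable 43 is the node \<open>k\<close> to be deleted and 49 the last node
  \<open>l\<close>. Their parents are 48 and 47, the sides on which they hang are 45 and 46, and 53
  and 54 are the children of \<open>l\<close>. Afterwards 43 is the parent of the deleted node,
  which now has the number \<open>k\<close> if it was \<open>l\<close>.\<close>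

definition t_remove_node :: com where
  "t_remove_node = (
     45 :=\<^sub>v Arr 4 (Var 43) ;;
     45 :=\<^sub>v (Var 45 \<ominus> Lit 2 \<otimes> (Var 45 \<oslash> Lit 2)) ;;
     48 :=\<^sub>v Arr 7 (Var 43) ;;
     49 :=\<^sub>v (Var 51 \<ominus> Lit 1) ;;
     52 :=\<^sub>v Arr 4 (Var 49) ;;
     46 :=\<^sub>v (Var 52 \<ominus> Lit 2 \<otimes> (Var 52 \<oslash> Lit 2)) ;;
     47 :=\<^sub>v Arr 7 (Var 49) ;;
     Store (Child (Var 45) (Var 48)) (Lit 0) ;;
     53 :=\<^sub>v Arr 5 (Var 49) ;;
     54 :=\<^sub>v Arr 6 (Var 49) ;;
     Store (Addr 4 (Var 43)) (Var 52) ;;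
     Store (Addr 7 (Var 43)) (Var 47) ;;
     Store (Addr 7 (Var 53)) (Var 43) ;;
     Store (Addr 7 (Var 54)) (Var 43) ;;
     Store (Addr 5 (Var 43)) (Var 53) ;;
     Store (Addr 6 (Var 43)) (Var 54) ;;
     Store (Child (Var 46) (Var 47)) (Var 43) ;;
     Cond (Var 48 \<doteq> Var 49) (43 :=\<^sub>v Var 43) (43 :=\<^sub>v Var 48) ;;
     Store (Child (Var 45) (Var 43)) (Lit 0) ;;
     Store (Addr 4 (Var 49)) (Lit 0) ;;
     Store (Addr 5 (Var 49)) (Lit 0) ;;
     Store (Addr 6 (Var 49)) (Lit 0) ;;
     Store (Addr 7 (Var 49)) (Lit 0) ;;
     51 :=\<^sub>v Var 49)"

definition t_descend :: com where
  "t_descend = (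
     44 :=\<^sub>v (Var 44 \<oslash> Lit 2) ;;
     45 :=\<^sub>v (Var 42 \<oslash> Var 44) ;;
     46 :=\<^sub>v (Var 45 \<ominus> Lit 2 \<otimes> (Var 45 \<oslash> Lit 2)) ;;
     43 :=\<^sub>v Mem (Child (Var 46) (Var 43)))"

text \<open>\<open>Less_Than\<close> between two truth values means that the first is false and the
  second is true. The loop thus removes the current node as long as it is not a root and has no
  child, climbing from the leaf upwards.\<close>

definition t_delete :: com where
  "t_delete = (t_key ;; Loop (Lit 1 \<lless> Var 44) t_descend ;;
     Loop ((Var 43 \<lless> Var 6) \<lless> (Arr 5 (Var 43) \<oplus> Arr 6 (Var 43) \<doteq> Lit 0)) t_remove_node)"

definition t_min_step :: com where
  "t_min_step = (
     47 :=\<^sub>v Arr 5 (Var 43) ;;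
     Cond (Var 47) Skip (47 :=\<^sub>v Arr 6 (Var 43)) ;;
     43 :=\<^sub>v Var 47)"

text \<open>The entry found serves as a representative of a nonempty row. The leaf level is
  recognized by comparing the code with \<open>R * 2 ^ b\<close> in variable 7.\<close>

definition t_min :: com where
  "t_min = (43 :=\<^sub>v Var 40 ;; Loop (Arr 4 (Var 43) \<lless> Var 7) t_min_step ;;
     41 :=\<^sub>v (Arr 4 (Var 43) \<ominus> (Var 6 \<oplus> Var 40) \<otimes> Var 5))"

text \<open>The arrays other than the tries occupy the indices below \<open>R\<close> only.\<close>

definition low_clear :: "nat \<Rightarrow> memory \<Rightarrow> bool" where
  "low_clear R s \<longleftrightarrow> (\<forall>f<4. \<forall>i\<ge>R. s (cell f i) = 0)"

lemma low_clear_updates [simp]: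
  "a < 64 \<Longrightarrow> low_clear R (s(a := x)) \<longleftrightarrow> low_clear R s"
  "4 \<le> f \<Longrightarrow> f < 8 \<Longrightarrow> low_clear R (s(cell f k := x)) \<longleftrightarrow> low_clear R s"
  "f < 4 \<Longrightarrow> k < R \<Longrightarrow> low_clear R (s(cell f k := x)) \<longleftrightarrow> low_clear R s"
  by (auto simp: low_clear_def cell_inject)

definition row_test :: "expr \<Rightarrow> expr" where
  "row_test r = Arr 5 r \<oplus> Arr 6 r"

section \<open>Correctness and running time of the trie programs\<close>

locale trie_machine = machine +
  fixes R b :: nat
  assumes R_pos: "0 < R" and b_pos: "0 < b" and R_b_le: "2 * R * 2 ^ b \<le> W" and R_le: "R \<le> P"
begin

definition nodes :: "memory \<Rightarrow> nat \<Rightarrow> bool" where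
  "nodes s e \<longleftrightarrow> s 5 = 2 ^ b \<and> s 6 = R \<and> s 7 = R * 2 ^ b \<and>
     forest R b (code_of s) (child_of s) (par_of s) (s 51) e \<and> clear_from (s 51) s \<and>
     low_clear R s"

definition leaves :: "memory \<Rightarrow> nat set" where
  "leaves s = {x \<in> code_of s ` {..<s 51}. R * 2 ^ b \<le> x}"

text \<open>This is the code of the node that is reached from root \<open>r\<close> by reading the
  \<open>b\<close> bits of \<open>v\<close> from the top. Its quotients by powers of two are the
  codes along that path.\<close>

definition key :: "nat \<times> nat \<Rightarrow> nat" where
  "key = (\<lambda>(r, v). (R + r) * 2 ^ b + v)"

definition trie :: "memory \<Rightarrow> (nat \<times> nat) set \<Rightarrow> bool" where
  "trie s K \<longleftrightarrow> nodes s 0 \<and> K \<subseteq> {..<R} \<times> {..<2 ^ b} \<and> leaves s = key ` K"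

lemma key_div_mod: "v < 2 ^ b \<Longrightarrow> key (r, v) div 2 ^ b = R + r" "v < 2 ^ b \<Longrightarrow> key (r, v) mod 2 ^ b = v"
  by (simp_all add: key_def del: add_mult_distrib distrib_right)

lemma inj_key: "inj_on key ({..<R} \<times> {..<2 ^ b})"
proof (rule inj_onI)
  fix x y assume *: "x \<in> {..<R} \<times> {..<2 ^ b}" "y \<in> {..<R} \<times> {..<2 ^ b}" "key x = key y"
  obtain r v q u where xy: "x = (r, v)" "y = (q, u)" by (cases x, cases y)
  have "R + r = R + q" "v = u"
    using key_div_mod[of v r] key_div_mod[of u q] * unfolding xy by auto
  then show "x = y" using xy by simp
qed

lemma key_bounds:
  assumes "r < R" "v < 2 ^ b"
  shows "R * 2 ^ b \<le> key (r, v)" "key (r, v) < 2 * R * 2 ^ b" "key (r, v) div 2 ^ b = R + r"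
    "key (r, v) < W"
proof -
  have "(R + r + 1) * 2 ^ b \<le> (2 * R) * 2 ^ b" using assms by (intro mult_right_mono) auto
  then show "key (r, v) < 2 * R * 2 ^ b" using assms by (simp add: key_def algebra_simps)
  then show "key (r, v) < W" using R_b_le by simp
  show "R * 2 ^ b \<le> key (r, v)" by (simp add: key_def algebra_simps)
  show "key (r, v) div 2 ^ b = R + r" using key_div_mod[OF assms(2)] by simp
qed

lemma trie_nodes_le:
  assumes "trie s K"
  shows "s 51 \<le> R + b * card K"
proof -
  have "card (leaves s) = card K"
    using assms inj_on_subset[OF inj_key] by (auto simp: trie_def card_image)
  then show ?thesis
    using nodes_le[of R b "code_of s" "child_of s" "par_of s" "s 51" 0] assms R_pos
    by (auto simp: trie_def nodes_def leaves_def)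
qed

lemma trie_roots_le: "trie s K \<Longrightarrow> R \<le> s 51"
  using roots_le by (auto simp: trie_def nodes_def)

lemma t_key_spec:
  assumes "r < R" "v < 2 ^ b" "s 5 = 2 ^ b" "s 6 = R" "s 40 = r" "s 41 = v"
    and Q: "\<And>t. t \<le> 30 \<Longrightarrow> Q t (s(42 := key (r, v), 43 := r, 44 := 2 ^ b))"
  shows "wp t_key Q s"
proof -
  have 1: "(R + r) * 2 ^ b + v < W" using key_bounds(4)[OF assms(1,2)] by (simp add: key_def)
  then have 2: "(R + r) * 2 ^ b < W" by simp
  then have 3: "R + r < W" by (metis mult.right_neutral mult_le_mono2 one_le_numeral one_le_power order.strict_trans1)
  show ?thesis
    unfolding t_key_def using assms 1 2 3
    by (intro wp_rules) (simp_all add: ok_Var key_def)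
qed

lemma div_step: "x div 2 ^ j div 2 = x div (2::nat) ^ Suc j"
  by (simp only: power_Suc2 div_mult2_eq)

text \<open>\<open>j\<close> counts the bits still to be read; the current node carries
  \<open>x\<close> without its last \<open>j\<close> bits.\<close>

definition on_path :: "memory \<Rightarrow> nat \<Rightarrow> nat \<Rightarrow> memory \<Rightarrow> bool" where
  "on_path s x j s' \<longleftrightarrow> j \<le> b \<and> s' 44 = 2 ^ j \<and> s' 42 = x \<and> s' 43 < s' 51 \<and>
     code_of s' (s' 43) = x div 2 ^ j \<and> trie_frame s s'"

lemma on_path_start:
  assumes "trie s K" "r < R" "v < 2 ^ b"
  shows "on_path s (key (r, v)) b (s(42 := key (r, v), 43 := r, 44 := 2 ^ b))"
proof -
  have "code_of s r = R + r" using assms code_root by (auto simp: trie_def nodes_def)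
  then show ?thesis
    using assms key_bounds[OF assms(2,3)] trie_roots_le[OF assms(1)]
    by (auto simp: on_path_def trie_frame_refl)
qed

lemma nodes_exception:
  "nodes s e \<Longrightarrow> child_of s 0 e \<noteq> 0 \<or> child_of s 1 e \<noteq> 0 \<or> e < R \<or> R * 2 ^ b \<le> code_of s e \<Longrightarrow>
    nodes s e'"
  using forest_exception unfolding nodes_def by blast

text \<open>The current node is the exception because it may have been created one step before. The
  leaves change only in the last step: for \<open>j > 0\<close> the new code lies below
  \<open>R * 2 ^ b\<close>, and for \<open>j = 0\<close> it is \<open>x\<close> itself.\<close>

lemma t_insert_step_spec:
  assumes path: "on_path s x (Suc j) s'" and n: "nodes s' (s' 43)" and p: "s' 51 < P"
    and x: "R * 2 ^ b \<le> x" "x < 2 * R * 2 ^ b"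
    and Q: "\<And>t s''. on_path s x j s'' \<Longrightarrow> nodes s'' (s'' 43) \<Longrightarrow> s'' 51 \<le> s' 51 + 1 \<Longrightarrow>
      leaves s'' = (if j = 0 then insert x (leaves s') else leaves s') \<Longrightarrow> t \<le> 100 \<Longrightarrow> Q t s''"
  shows "wp t_insert_step Q s'"
proof -
  define c where "c = x div 2 ^ j"
  define cur where "cur = s' 43"
  define bit where "bit = c mod 2"
  define p where "p = s' 51"
  have bit: "bit < 2" by (simp add: bit_def)
  have cur: "cur < p" "cur < P" "code_of s' cur = c div 2"
    using path assms(3) unfolding on_path_def div_step[symmetric] c_def cur_def p_def by auto
  have c: "2 * code_of s' cur + bit = c" using cur by (simp add: bit_def)
  have f: "forest R b (code_of s') (child_of s') (par_of s') p cur"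
    using n by (simp add: nodes_def p_def cur_def)
  have cl: "clear_from p s'" using n by (simp add: nodes_def p_def)
  have c_less: "c < 2 * R * 2 ^ b" unfolding c_def using x by (meson div_le_dividend le_less_trans)
  have c_leaf: "R * 2 ^ b \<le> c \<longleftrightarrow> j = 0"
  proof (cases "j = 0")
    case False
    then have "c \<le> x div 2" unfolding c_def using div_le_mono2[of 2 "2 ^ j" x] by (cases j) auto
    then show ?thesis using x False by auto
  qed (use x in \<open>simp add: c_def\<close>)
  have c0: "c = x" if "j = 0" using that by (simp add: c_def)
  note [simp] = ok_Var ok_Mem_Child minus_mult_div_eq_mod cell_less
  have [simp]: "s' 43 = cur" "s' 44 = 2 * 2 ^ j" "s' 42 = x" "x div 2 ^ j = c" "c mod 2 = bit" "bit < 3"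
    "bit < 2" "cur < P" "s' 51 = p"
    using path bit cur by (auto simp: on_path_def cur_def c_def bit_def p_def)
  have [simp]: "2 * (c div 2) < W" using c_less R_b_le by linarith
  show ?thesis
  proof (cases "child_of s' bit cur = 0")
    case False
    define nx where "nx = child_of s' bit cur"
    have nx: "nx < p" "code_of s' nx = c" "nx \<noteq> 0"
      using child_less[OF f cur(1) bit] code_child[OF f cur(1) bit] False c by (auto simp: nx_def)
    have "child_of s' 0 cur \<noteq> 0 \<or> child_of s' 1 cur \<noteq> 0" using False less_2_cases[OF bit] by auto
    then have n': "nodes s' nx" unfolding cur_def by (intro nodes_exception[OF n]) blast
    have lv: "leaves s' = (if j = 0 then insert x (leaves s') else leaves s')"
      using nx c_leaf c0 by (auto simp: leaves_def p_def[symmetric])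
    have [simp]: "s' (cell (5 + bit) cur) = nx" "0 < nx" "nx \<noteq> 0" using nx by (simp_all add: child_cell nx_def)
    show ?thesis
      unfolding t_insert_step_def
      apply (rule wp_steps; simp?)+
      apply (rule Q)
      subgoal using path nx by (simp add: on_path_def)
      subgoal using n' by (simp add: nodes_def)
      subgoal by simp
      subgoal using lv by (simp add: leaves_def)
      subgoal by simp
      done
  next
    case True
    have [simp]: "s' (cell (5 + bit) cur) = 0" using True by (simp add: child_cell)
    have [simp]: "p < P" "Suc p < W" using assms(3) P_le by simp_all
    have ext: "forest R b ((code_of s')(p := c)) ((child_of s')(bit := (child_of s' bit)(cur := p)))
        ((par_of s')(p := cur)) (Suc p) p"
      using forest_extend[OF f R_pos cur(1) bit True, unfolded c, OF c_less]
        clear_fromD(2)[OF cl order_refl] by simp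
    show ?thesis
      unfolding t_insert_step_def
      apply (rule wp_steps; simp?)+
      apply (rule Q)
      subgoal using path by (simp add: on_path_def)
      subgoal using ext n cl clear_from_mono[OF cl, of "Suc p"] cur(1) by (simp add: nodes_def)
      subgoal by simp
      subgoal using c_leaf c0 by (auto simp: leaves_def lessThan_Suc)
      subgoal by simp
      done
  qed
qed

lemma t_insert_spec:
  assumes t: "trie s K" and rv: "r < R" "v < 2 ^ b" "s 40 = r" "s 41 = v"
    and cap: "R + b * (card K + 1) \<le> P"
    and Q: "\<And>t s'. trie s' (insert (r, v) K) \<Longrightarrow> trie_frame s s' \<Longrightarrow> t \<le> 150 * (b + 1) \<Longrightarrow> Q t s'"
  shows "wp t_insert Q s"
proof -
  define x where "x = key (r, v)"
  \<comment> \<open>The present nodes number at most \<open>R + b * card K\<close>, and an insertion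
    creates at most one node in each of its \<open>b\<close> steps.\<close>
  have cap': "s 51 + b \<le> P" using trie_nodes_le[OF t] cap by simp
  have n: "nodes s 0" using t by (simp add: trie_def)
  note x = key_bounds[OF rv(1,2), folded x_def]
  let ?I = "\<lambda>m s'. \<exists>j. on_path s x j s' \<and> nodes s' (s' 43) \<and> s' 51 \<le> s 51 + (b - j) \<and>
    leaves s' = (if j = 0 then insert x (leaves s) else leaves s) \<and> m = 110 * j"
  show ?thesis
    unfolding t_insert_def
  proof (intro wp_Seq, rule t_key_spec[OF rv(1,2) _ _ rv(3,4)])
    show "s 5 = 2 ^ b" "s 6 = R" using n by (auto simp: nodes_def)
    fix t0 :: nat assume t0: "t0 \<le> 30"
    let ?s = "s(42 := key (r, v), 43 := r, 44 := 2 ^ b)"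
    show "wp (Loop (Lit 1 \<lless> Var 44) t_insert_step) (\<lambda>t'. Q (t0 + t')) ?s"
    proof (rule wp_Loop[where I = ?I and k = "110 * b"])
      have "nodes ?s r"
        using n rv(1) R_pos nodes_exception[OF n, of r] by (simp add: nodes_def)
      then show "?I (110 * b) ?s"
        using on_path_start[OF t rv(1,2)] b_pos
        by (intro exI[of _ b]) (auto simp: x_def leaves_def)
    next
      fix k s' assume "?I k s'"
      then show "ok s' (Lit 1 \<lless> Var 44)" by (simp add: ok_Var)
    next
      fix k s' assume I: "?I k s'" and c: "val s' (Lit 1 \<lless> Var 44) \<noteq> 0"
      then obtain i where i: "on_path s x i s'" "nodes s' (s' 43)" "s' 51 \<le> s 51 + (b - i)"
        "leaves s' = (if i = 0 then insert x (leaves s) else leaves s)" "k = 110 * i" by blast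
      have "i \<noteq> 0" by (rule notI) (use c i(1) in \<open>simp add: on_path_def\<close>)
      then obtain j where ij: "i = Suc j" using not0_implies_Suc by blast
      have j: "on_path s x (Suc j) s'" "nodes s' (s' 43)" "s' 51 \<le> s 51 + (b - Suc j)"
        "leaves s' = leaves s" "k = 110 * Suc j"
        using i ij by simp_all
      have "s' 51 < P" using j(1,3) cap' unfolding on_path_def by linarith
      then show "wp t_insert_step
          (\<lambda>t s'. \<exists>k'. ?I k' s' \<and> k' + t + expr_cost (Lit 1 \<lless> Var 44) + 1 \<le> k) s'"
      proof (rule t_insert_step_spec[OF j(1,2) _ x(1,2)], goal_cases)
        case (1 t s'')
        then show ?case
          using j by (intro exI[of _ "110 * j"] conjI exI[of _ j]) (auto simp: on_path_def)
      qed
    next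
      fix k' t s' assume I: "?I k' s'" and c: "val s' (Lit 1 \<lless> Var 44) = 0"
        and t': "t + k' \<le> 110 * b + expr_cost (Lit 1 \<lless> Var 44) + 1"
      then obtain j where j: "on_path s x j s'" "nodes s' (s' 43)"
        "leaves s' = (if j = 0 then insert x (leaves s) else leaves s)" by blast
      have j0: "j = 0"
        using c j(1) one_less_power[of "2::nat" j] by (auto simp: on_path_def split: if_splits)
      have "nodes s' 0" using nodes_exception[OF j(2)] j(1) x(1) j0 by (simp add: on_path_def)
      then have "trie s' (insert (r, v) K)"
        using t j(3) j0 rv(1,2) by (simp add: trie_def x_def)
      then show "Q (t0 + t) s'"
        using t0 t' j(1) by (intro Q) (auto simp: on_path_def)
    qed
  qed
qed

text \<open>Parents have halved codes, so climbing \<open>j\<close> times produces the required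
  node. The bound by \<open>R\<close> keeps the climb from passing a root.\<close>

lemma code_prefix_closed:
  assumes "nodes s e" "k < s 51" "R \<le> code_of s k div 2 ^ j"
  shows "\<exists>l<s 51. code_of s l = code_of s k div 2 ^ j"
  using assms(3)
proof (induction j)
  case 0
  then show ?case using assms(2) by auto
next
  case (Suc j)
  have f: "forest R b (code_of s) (child_of s) (par_of s) (s 51) e"
    using assms(1) by (simp add: nodes_def)
  have "R \<le> code_of s k div 2 ^ j" using Suc.prems unfolding div_step[symmetric] by simp
  then obtain l where l: "l < s 51" "code_of s l = code_of s k div 2 ^ j" using Suc.IH by blast
  have "2 * R \<le> code_of s l" using Suc.prems unfolding div_step[symmetric] l(2) by simp
  then have "R \<le> l" using code_root[OF f, of l] by (cases "l < R") auto
  then have "code_of s (par_of s l) = code_of s k div 2 ^ Suc j" "par_of s l < s 51"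
    using code_par[OF f _ l(1)] par_less[OF f _ l(1)] l(2) unfolding div_step[symmetric] by auto
  then show ?case by blast
qed

text \<open>No null pointer is met because \<open>x\<close> is stored:
  \<open>code_prefix_closed\<close> supplies a node with the next prefix, and
  \<open>child_par_eq\<close> identifies it with the child.\<close>

lemma t_descend_spec:
  assumes path: "on_path s x (Suc j) s'" and n: "nodes s' 0" and p: "s' 51 \<le> P"
    and x: "x \<in> leaves s'"
    and Q: "\<And>t s''. on_path s x j s'' \<Longrightarrow> nodes s'' 0 \<Longrightarrow> s'' 51 = s' 51 \<Longrightarrow>
      leaves s'' = leaves s' \<Longrightarrow> t \<le> 50 \<Longrightarrow> Q t s''"
  shows "wp t_descend Q s'"
proof -
  define c where "c = x div 2 ^ j"
  define cur where "cur = s' 43"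
  define bit where "bit = c mod 2"
  define p where "p = s' 51"
  have bit: "bit < 2" by (simp add: bit_def)
  have cur: "cur < p" "cur < P" "code_of s' cur = c div 2"
    using path assms(3) unfolding on_path_def div_step[symmetric] c_def cur_def p_def by auto
  have c: "c = 2 * code_of s' cur + bit" using cur by (simp add: bit_def)
  have f: "forest R b (code_of s') (child_of s') (par_of s') p 0"
    using n by (simp add: nodes_def p_def cur_def)
  obtain l0 where l0: "l0 < p" "code_of s' l0 = x" using x by (auto simp: leaves_def p_def)
  have "x < 2 * R * 2 ^ b" using code_less[OF f l0(1)] l0 by simp
  then have "c < W" unfolding c_def using R_b_le by (meson div_le_dividend le_less_trans less_le_trans)
  then have [simp]: "2 * (c div 2) < W" by linarith
  have "R \<le> c" using code_ge[OF f cur(1)] R_pos c by linarith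
  then obtain l where l: "l < p" "code_of s' l = c"
    using code_prefix_closed[OF n, of l0 j] l0 by (auto simp: c_def p_def)
  have nx: "child_of s' bit cur = l" using child_par_eq(3)[OF f R_pos l(1) cur(1) bit] c l by simp
  note [simp] = ok_Var ok_Mem_Child minus_mult_div_eq_mod cell_less
  have [simp]: "s' 43 = cur" "s' 44 = 2 * 2 ^ j" "s' 42 = x" "x div 2 ^ j = c" "c mod 2 = bit" "bit < 3"
    "bit < 2" "cur < P" "s' 51 = p"
    using path bit cur by (auto simp: on_path_def cur_def c_def bit_def p_def)
  have [simp]: "s' (cell (5 + bit) cur) = l" using nx by (simp add: child_cell)
  show ?thesis
    unfolding t_descend_def
    apply (rule wp_steps; simp?)+
    apply (rule Q)
    subgoal using path l by (simp add: on_path_def)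
    subgoal using n by (simp add: nodes_def)
    subgoal by simp
    subgoal by (simp add: leaves_def)
    subgoal by simp
    done
qed

lemma t_remove_node_spec:
  assumes n: "nodes s k" and k: "s 43 = k" "R \<le> k" "k < s 51" "child_of s 0 k = 0" "child_of s 1 k = 0"
    and p: "s 51 \<le> P"
    and Q: "\<And>t s'. nodes s' (s' 43) \<Longrightarrow> s' 51 = s 51 - 1 \<Longrightarrow> s' 43 < s' 51 \<Longrightarrow>
      leaves s' = leaves s - {code_of s k} \<Longrightarrow> code_of s' (s' 43) = code_of s k div 2 \<Longrightarrow>
      trie_frame s s' \<Longrightarrow> t \<le> 250 \<Longrightarrow> Q t s'"
  shows "wp t_remove_node Q s"
proof -
  define p where "p = s 51"
  define l where "l = p - 1"
  define c where "c = code_of s k mod 2"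
  define d where "d = code_of s l mod 2"
  define e where "e = (if par_of s k = l then k else par_of s k)"
  define ch1 where "ch1 g i = (if g = c \<and> i = par_of s k then 0 else child_of s g i)" for g i
  define ch2 where "ch2 g i = (if i = k then ch1 g l else ch1 g i)" for g i
  define ch3 where "ch3 g i = (if g = d \<and> i = par_of s l then k else ch2 g i)" for g i
  have f: "forest R b (code_of s) (child_of s) (par_of s) p k" and cl: "clear_from p s"
    using n by (auto simp: nodes_def p_def)
  have kp: "k < p" "l < p" "Suc l = p" "R \<le> l" "p \<le> P" using k p by (auto simp: p_def l_def)
  have cd: "c < 2" "d < 2" by (auto simp: c_def d_def)
  define pk where "pk = par_of s k"
  define pl where "pl = par_of s l"
  have pkl: "pk < p" "pl < p"
    using par_less[OF f] k kp by (auto simp: pk_def pl_def)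
  define a0 where "a0 = ch1 0 l"
  define a1 where "a1 = ch1 1 l"
  have a: "a0 < p" "a1 < p"
    using child_less[OF f kp(2), of 0] child_less[OF f kp(2), of 1] kp
    by (cases "child_of s 0 l = 0"; cases "child_of s 1 l = 0"; simp add: a0_def a1_def ch1_def)+
  have ckl: "code_of s k < W" "code_of s l < W"
    using code_less[OF f kp(1)] code_less[OF f kp(2)] R_b_le by auto
  have pW: "p < W" using kp(5) P_le by simp
  note [simp] = ok_Var ok_Mem_Child minus_mult_div_eq_mod ok_Arr cell_less
  have [simp]: "s 43 = k" "k < P" "s 51 = p" "p - Suc 0 = l" "l < P" "pk < P" "pl < P" "a0 < P" "a1 < P"
    "c < 2" "c < 3" "d < 2" "d < 3" "e < P"
    using k kp cd pkl a by (auto simp: p_def l_def e_def pk_def)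
  have [simp]: "s (cell 4 k) = code_of s k" "s (cell 7 k) = pk" "s (cell 4 l) = code_of s l"
    "s (cell 7 l) = pl" "code_of s k mod 2 = c" "code_of s l mod 2 = d"
    by (auto simp: node_cells c_def d_def pk_def pl_def)
  have [simp]: "2 * (code_of s k div 2) < W" "2 * (code_of s l div 2) < W"
    using ckl by linarith+
  let ?s = "s(45 := c, 48 := pk, 49 := l, 52 := code_of s l, 46 := d, 47 := pl)"
  have [simp]: "(if cell 5 l = cell (5 + c) pk then 0 else ?s (cell 5 l)) = a0"
    "(if cell 6 l = cell (5 + c) pk then 0 else ?s (cell 6 l)) = a1"
    using cd by (auto simp: a0_def a1_def ch1_def pk_def cell_inject child_cells)
  have e_alt: "e = (if pk = l then k else pk)" by (simp add: e_def pk_def)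
  \<comment> \<open>The memory after the whole program as one chain of updates; in either branch of
    the conditional, variable 43 receives \<open>e\<close>.\<close>
  define M where "M = s(45 := c, 48 := pk, 49 := l, 52 := code_of s l, 46 := d, 47 := pl,
    cell (5 + c) pk := 0, 53 := a0, 54 := a1, cell 4 k := code_of s l, cell 7 k := pl,
    cell 7 a0 := k, cell 7 a1 := k, cell 5 k := a0, cell 6 k := a1, cell (5 + d) pl := k,
    43 := e, cell (5 + c) e := 0, cell 4 l := 0, cell 5 l := 0, cell 6 l := 0, cell 7 l := 0, 51 := l)"
  have code_M: "code_of M i = (if i = l then 0 else if i = k then code_of s l else code_of s i)" for i
    by (simp add: M_def)
  have par_M: "par_of M i = (if i = l then 0 else if i = a1 \<or> i = a0 then k else if i = k then pl else par_of s i)"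
    for i by (simp add: M_def)
  have child_M: "child_of M g i = (if i = l then 0 else if g = c \<and> i = e then 0 else ch3 g i)" if "g < 2" for g i
    using less_2_cases[OF that] less_2_cases[OF cd(1)] less_2_cases[OF cd(2)]
    by (elim disjE) (simp_all add: M_def ch3_def ch2_def ch1_def a0_def a1_def pk_def pl_def)
  have new: "forest R b (code_of M) (child_of M) (par_of M) l e"
    "code_of M ` {..<l} = code_of s ` {..<p} - {code_of s k}"
    by (rule forest_remove_program[where k = k and c = c and d = d and ?ch1.0 = ch1 and ?ch2.0 = ch2 and ?ch3.0 = ch3, OF f R_pos k(2) kp(1) k(4,5) l_def c_def d_def e_def];
      simp add: code_M child_M par_M a0_def a1_def pl_def ch1_def ch2_def ch3_def; fail)+
  have cells: "M (cell g l) = 0" if g: "g < 8" for g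
  proof -
    consider "g < 4" | "g = 4" | "g = 5" | "g = 6" | "g = 7" using g by linarith
    then show ?thesis
    proof cases
      case 1
      \<comment> \<open>The program clears only arrays 4 to 7 at \<open>l\<close>. Arrays 0 to 3 are
        0 there because they extend over indices below \<open>R\<close> only, and \<open>l\<close>
        is not a root.\<close>
      have "low_clear R M" using n by (simp add: M_def nodes_def)
      then show ?thesis using kp(4) 1 by (simp add: low_clear_def)
    qed (use code_M[of l] child_M[of 0 l] child_M[of 1 l] par_M[of l] in
        \<open>simp_all add: code_of_def par_of_def child_of_def\<close>)
  qed
  have cl_M: "clear_from l M"
  proof (rule clear_from_shrink)
    show "M (cell g l) = 0" if "g < 8" for g using cells that .
    have "e < p" using kp pkl by (auto simp: e_alt)
    then show "clear_from (Suc l) M"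
      using cl kp pkl a by (simp add: M_def)
  qed
  have "code_of s pk < code_of s k"
    using code_par[OF f k(2) kp(1)] code_ge[OF f kp(1)] R_pos by (simp add: pk_def)
  then have "pk \<noteq> k" by auto
  then have e_l: "e < l" "e = k \<longleftrightarrow> pk = l"
    using kp(1,3) pkl(1) by (cases "pk = l"; auto simp: e_alt)+
  moreover have "code_of M e = code_of s k div 2"
  proof (cases "pk = l")
    case True
    then have "code_of M e = code_of s l" using code_M[of e] e_l by auto
    then show ?thesis using code_par[OF f k(2) kp(1)] True unfolding pk_def by metis
  next
    case False
    then have "e = pk" "code_of M e = code_of s e" using code_M[of e] e_l e_alt by auto
    then show ?thesis using code_par[OF f k(2) kp(1)] unfolding pk_def by metis
  qed
  moreover have "leaves M = leaves s - {code_of s k}"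
  proof -
    have "M 51 = l" "s 51 = p" by (simp_all add: M_def)
    then show ?thesis unfolding leaves_def using new(2) by auto
  qed
  moreover have "nodes M e"
    using n new(1) cl_M by (simp add: nodes_def) (simp add: M_def)
  moreover have "M 43 = e" "M 51 = l" "trie_frame s M"
    by (simp_all add: M_def trie_frame_refl)
  ultimately have M: "Q t M" if "t \<le> 250" for t
    using that by (intro Q) simp_all
  show ?thesis
    unfolding t_remove_node_def
    apply (rule wp_steps; (simp split del: if_split)?)+
    subgoal using M by (simp add: M_def e_alt split: if_splits)
    apply (rule wp_steps; (simp split del: if_split)?)+
    subgoal using M by (simp add: M_def e_alt split: if_splits)
    done
qed

lemma t_delete_spec:
  assumes t: "trie s K" and rv: "(r, v) \<in> K" "s 40 = r" "s 41 = v" and cap: "s 51 \<le> P"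
    and Q: "\<And>t s'. trie s' (K - {(r, v)}) \<Longrightarrow> trie_frame s s' \<Longrightarrow> t \<le> 500 * (b + 1) \<Longrightarrow> Q t s'"
  shows "wp t_delete Q s"
proof -
  define x where "x = key (r, v)"
  have n: "nodes s 0" using t by (simp add: trie_def)
  have rv': "r < R" "v < 2 ^ b" using t rv(1) by (auto simp: trie_def)
  note x = key_bounds[OF rv', folded x_def]
  have x_leaf: "x \<in> leaves s" using t rv(1) by (auto simp: trie_def x_def)
  have rest: "leaves s - {x} = key ` (K - {(r, v)})"
  proof -
    have "inj_on key K" using t inj_on_subset[OF inj_key] by (auto simp: trie_def)
    then have "key ` (K - {(r, v)}) = key ` K - key ` {(r, v)}"
      using rv(1) by (intro inj_on_image_set_diff) auto
    then show ?thesis using t by (simp add: trie_def x_def)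
  qed
  let ?I = "\<lambda>m s'. \<exists>j. on_path s x j s' \<and> nodes s' 0 \<and> s' 51 = s 51 \<and> leaves s' = leaves s \<and> m = 60 * j"
  \<comment> \<open>\<open>j\<close> nodes of the path have been removed and the current node is the
    ancestor with code \<open>x div 2 ^ j\<close>; it alone may have lost its last child. The leaf
    disappears with the first removal, and later removals concern inner nodes.\<close>
  let ?J = "\<lambda>m s'. \<exists>j\<le>b. trie_frame s s' \<and> nodes s' (s' 43) \<and> s' 43 < s' 51 \<and> s' 51 \<le> P \<and>
    code_of s' (s' 43) = x div 2 ^ j \<and> leaves s' = (if j = 0 then leaves s else leaves s - {x}) \<and>
    m = 300 * (b - j)"
  let ?c = "(Var 43 \<lless> Var 6) \<lless> (Arr 5 (Var 43) \<oplus> Arr 6 (Var 43) \<doteq> Lit 0)"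
  have J_forest: "forest R b (code_of s') (child_of s') (par_of s') (s' 51) (s' 43)"
    if "nodes s' (s' 43)" for s' using that by (simp add: nodes_def)
  have J_leaf: "child_of s' 0 (s' 43) = 0" "child_of s' 1 (s' 43) = 0"
    if s': "nodes s' (s' 43)" "s' 43 < s' 51" "code_of s' (s' 43) = x" for s'
  proof -
    have "child_of s' g (s' 43) = 0" if g: "g < 2" for g
    proof (rule ccontr)
      assume c: "child_of s' g (s' 43) \<noteq> 0"
      note f = J_forest[OF s'(1)]
      show False
        using code_child[OF f s'(2) g c] code_less[OF f child_less[OF f s'(2) g c]] s'(3) x(1) by simp
    qed
    then show "child_of s' 0 (s' 43) = 0" "child_of s' 1 (s' 43) = 0" by auto
  qed
  show ?thesis
    unfolding t_delete_def
  proof (rule wp_Seq, rule t_key_spec[OF rv' _ _ rv(2,3)])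
    show "s 5 = 2 ^ b" "s 6 = R" using n by (auto simp: nodes_def)
    fix t0 :: nat assume t0: "t0 \<le> 30"
    let ?s = "s(42 := key (r, v), 43 := r, 44 := 2 ^ b)"
    show "wp (Loop (Lit 1 \<lless> Var 44) t_descend ;; Loop ?c t_remove_node) (\<lambda>t'. Q (t0 + t')) ?s"
    proof (rule wp_Seq, rule wp_Loop[where I = ?I and k = "60 * b"])
      show "?I (60 * b) ?s"
        using on_path_start[OF t rv'] n by (intro exI[of _ b]) (auto simp: x_def leaves_def nodes_def)
    next
      fix k s' assume "?I k s'"
      then show "ok s' (Lit 1 \<lless> Var 44)" by (simp add: ok_Var)
    next
      fix k s' assume I: "?I k s'" and c: "val s' (Lit 1 \<lless> Var 44) \<noteq> 0"
      then obtain i where i: "on_path s x i s'" "nodes s' 0" "s' 51 = s 51" "leaves s' = leaves s" "k = 60 * i"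
        by blast
      have "i \<noteq> 0" by (rule notI) (use c i(1) in \<open>simp add: on_path_def\<close>)
      then obtain j where ij: "i = Suc j" using not0_implies_Suc by blast
      show "wp t_descend
          (\<lambda>t s'. \<exists>k'. ?I k' s' \<and> k' + t + expr_cost (Lit 1 \<lless> Var 44) + 1 \<le> k) s'"
      proof (rule t_descend_spec[OF i(1)[unfolded ij] i(2)], goal_cases)
        case 1
        show ?case using cap i(3) by simp
      next
        case 2
        show ?case using x_leaf i(4) by simp
      next
        case (3 t s'')
        then show ?case
          using i ij by (intro exI[of _ "60 * j"] conjI exI[of _ j]) (auto simp: on_path_def)
      qed
    next
      fix k' t1 s1 assume I: "?I k' s1" and c: "val s1 (Lit 1 \<lless> Var 44) = 0"
        and t1: "t1 + k' \<le> 60 * b + expr_cost (Lit 1 \<lless> Var 44) + 1"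
      then obtain j where j: "on_path s x j s1" "nodes s1 0" "s1 51 = s 51" "leaves s1 = leaves s" by blast
      have j0: "j = 0"
        using c j(1) one_less_power[of "2::nat" j] by (auto simp: on_path_def split: if_splits)
      show "wp (Loop ?c t_remove_node) (\<lambda>t'. Q (t0 + (t1 + t'))) s1"
      proof (rule wp_Loop[where I = ?J and k = "300 * b"])
        have "nodes s1 (s1 43)" using nodes_exception[OF j(2), of "s1 43"] R_pos by auto
        then show "?J (300 * b) s1"
          using j j0 cap by (intro exI[of _ 0]) (auto simp: on_path_def)
      next
        fix k s' assume J: "?J k s'"
        then obtain i where i: "nodes s' (s' 43)" "s' 43 < s' 51" "s' 51 \<le> P" by blast
        note f = J_forest[OF i(1)]
        have "child_of s' 0 (s' 43) < P \<and> child_of s' 1 (s' 43) < P"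
          using child_less[OF f i(2), of 0] child_less[OF f i(2), of 1] i(2,3)
          by (cases "child_of s' 0 (s' 43) = 0"; cases "child_of s' 1 (s' 43) = 0"; simp)
        then have "child_of s' 0 (s' 43) + child_of s' 1 (s' 43) < W" using P_le by linarith
        then show "ok s' ?c" using i by (simp add: ok_Var ok_Arr child_cells cell_less)
      next
        fix k s' assume J: "?J k s'" and c: "val s' ?c \<noteq> 0"
        then obtain i where i: "i \<le> b" "trie_frame s s'" "nodes s' (s' 43)" "s' 43 < s' 51" "s' 51 \<le> P"
          "code_of s' (s' 43) = x div 2 ^ i" "leaves s' = (if i = 0 then leaves s else leaves s - {x})"
          "k = 300 * (b - i)" by blast
        have "s' 6 = R" using i(3) by (simp add: nodes_def)
        then have c': "R \<le> s' 43" "child_of s' 0 (s' 43) = 0" "child_of s' 1 (s' 43) = 0"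
          using c by (auto simp: child_cells split: if_splits)
        note f = J_forest[OF i(3)]
        \<comment> \<open>After \<open>b\<close> removals the current code would be that of a root,
          but the loop condition has excluded roots.\<close>
        have "i < b"
        proof (rule ccontr)
          assume "\<not> i < b"
          then have "x div 2 ^ i < 2 * R" using i(1) x(2) by (simp add: less_mult_imp_div_less)
          then show False using code_nonroot[OF f c'(1) i(4)] i(6) by simp
        qed
        show "wp t_remove_node (\<lambda>t s'. \<exists>k'. ?J k' s' \<and> k' + t + expr_cost ?c + 1 \<le> k) s'"
        proof (rule t_remove_node_spec[OF i(3) refl c'(1) i(4) c'(2,3) i(5)], goal_cases)
          case (1 t s'')
          have "x div 2 ^ i \<notin> leaves s - {x}" if "i \<noteq> 0"
          proof -
            have "x div 2 ^ i \<le> x div 2" using that div_le_mono2[of 2 "2 ^ i" x] by (cases i) auto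
            then have "x div 2 ^ i < R * 2 ^ b" using x(2) by auto
            then show ?thesis by (simp add: leaves_def)
          qed
          then have "leaves s'' = leaves s - {x}" using 1(4) i(6,7) by (cases "i = 0") auto
          moreover have "300 * (b - Suc i) + t + expr_cost ?c + 1 \<le> k"
            using 1(7) i(8) \<open>i < b\<close> by simp
          moreover have "code_of s'' (s'' 43) = x div 2 ^ Suc i"
            using 1(5) i(6) by (simp only: div_step)
          moreover have "s'' 51 \<le> P" using 1(2) i(5) by simp
          ultimately show ?case
            using 1(1,3,6) \<open>i < b\<close> trie_frame_trans[OF i(2)]
            by (intro exI[of _ "300 * (b - Suc i)"] conjI exI[of _ "Suc i"]) simp_all
        qed
      next
        fix k2 t2 s2 assume J: "?J k2 s2" and c2: "val s2 ?c = 0"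
          and t2: "t2 + k2 \<le> 300 * b + expr_cost ?c + 1"
        then obtain i where i: "i \<le> b" "trie_frame s s2" "nodes s2 (s2 43)" "s2 43 < s2 51" "s2 51 \<le> P"
          "code_of s2 (s2 43) = x div 2 ^ i" "leaves s2 = (if i = 0 then leaves s else leaves s - {x})"
          by blast
        note f = J_forest[OF i(3)]
        have r6: "s2 6 = R" using i(3) by (simp add: nodes_def)
        \<comment> \<open>The loop cannot stop before the leaf is gone: the leaf is childless, and
          it is no root since \<open>b > 0\<close> puts leaf codes beyond the root codes.\<close>
        have "i \<noteq> 0"
        proof
          assume "i = 0"
          then have "child_of s2 0 (s2 43) = 0" "child_of s2 1 (s2 43) = 0" "code_of s2 (s2 43) = x"
            using J_leaf[OF i(3,4)] i(6) by auto
          moreover have "\<not> s2 43 < R"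
          proof
            assume "s2 43 < R"
            then have "x < 2 * R" using code_root[OF f] \<open>code_of s2 (s2 43) = x\<close> by simp
            moreover have "2 * R \<le> R * 2 ^ b" using b_pos by (cases b) auto
            ultimately show False using x(1) by simp
          qed
          ultimately show False using c2 r6 by (simp add: child_cells)
        qed
        moreover have "child_of s2 0 (s2 43) \<noteq> 0 \<or> child_of s2 1 (s2 43) \<noteq> 0 \<or> s2 43 < R"
          using c2 r6 by (simp add: child_cells split: if_split_asm) blast
        then have "nodes s2 0" by (intro nodes_exception[OF i(3)]) blast
        moreover have "K \<subseteq> {..<R} \<times> {..<2 ^ b}" using t unfolding trie_def by blast
        then have "K - {(r, v)} \<subseteq> {..<R} \<times> {..<2 ^ b}" by blast
        moreover have "leaves s2 = key ` (K - {(r, v)})" using rest i(7) \<open>i \<noteq> 0\<close> by simp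
        ultimately have "trie s2 (K - {(r, v)})" unfolding trie_def by blast
        then show "Q (t0 + (t1 + t2)) s2"
          using i(2) t0 t1 t2 by (intro Q) auto
      qed
    qed
  qed
qed

text \<open>Dividing by a larger or a smaller power of two leaves the range of the root codes, so
  the depth of a leaf below its root is exactly \<open>b\<close>.\<close>

lemma level_unique:
  assumes "R * 2 ^ b \<le> x" "x < 2 * R * 2 ^ b" "R \<le> x div 2 ^ i" "x div 2 ^ i < 2 * R"
  shows "i = b"
proof (rule antisym)
  show "i \<le> b"
  proof (rule ccontr)
    assume "\<not> i \<le> b"
    then have "x div 2 ^ i \<le> x div 2 ^ Suc b" by (intro div_le_mono2) (auto intro: power_increasing simp del: power_Suc)
    also have "\<dots> < R" using assms(2) by (simp add: less_mult_imp_div_less ac_simps)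
    finally show False using assms(3) by simp
  qed
  show "b \<le> i"
  proof (rule ccontr)
    assume "\<not> b \<le> i"
    then have "Suc i \<le> b" by simp
    then have "2 * R * 2 ^ i \<le> R * 2 ^ b" using power_increasing[of "Suc i" b "2::nat"] by simp
    also have "\<dots> \<le> x" by (rule assms(1))
    finally have "2 * R \<le> x div 2 ^ i" by (simp add: less_eq_div_iff_mult_less_eq)
    then show False using assms(4) by simp
  qed
qed

text \<open>No inner node other than a root is childless, so a child pointer of the root leads to a
  leaf, which is a key of this row. Conversely, the path of a key passes through a child of the
  root. Two pointers therefore decide emptiness.\<close>

lemma row_nonempty:
  assumes t: "trie s K" and r: "r < R"
  shows "child_of s 0 r \<noteq> 0 \<or> child_of s 1 r \<noteq> 0 \<longleftrightarrow> (\<exists>v. (r, v) \<in> K)"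
proof -
  have n: "nodes s 0" using t by (simp add: trie_def)
  then have f: "forest R b (code_of s) (child_of s) (par_of s) (s 51) 0" by (simp add: nodes_def)
  have r': "r < s 51" "code_of s r = R + r" using trie_roots_le[OF t] r code_root[OF f r] by auto
  show ?thesis
  proof
    assume "child_of s 0 r \<noteq> 0 \<or> child_of s 1 r \<noteq> 0"
    then have "\<exists>g<2. child_of s g r \<noteq> 0" by (auto intro: exI[of _ 0] exI[of _ 1])
    then obtain g where g: "g < 2" "child_of s g r \<noteq> 0" by blast
    note c = child_less[OF f r'(1) g] child_ge[OF f r'(1) g] code_child[OF f r'(1) g]
    obtain j l where l: "l < s 51" "R * 2 ^ b \<le> code_of s l" "code_of s (child_of s g r) = code_of s l div 2 ^ j"
      using code_prefix[OF f R_pos c(2,1) R_pos] by blast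
    have d: "code_of s l div 2 ^ Suc j = R + r"
      unfolding div_step[symmetric] l(3)[symmetric] c(3) r'(2) using g(1) by simp
    have "Suc j = b"
      using level_unique[OF l(2) code_less[OF f l(1)], of "Suc j"] d r by simp
    have "code_of s l \<in> key ` K" using l t by (auto simp: trie_def leaves_def)
    then obtain q v where qv: "(q, v) \<in> K" "code_of s l = key (q, v)" by auto
    then have "v < 2 ^ b" using t by (auto simp: trie_def)
    then have "R + q = R + r" using key_div_mod(1)[of v q] d qv(2) \<open>Suc j = b\<close> by simp
    then show "\<exists>v. (r, v) \<in> K" using qv by auto
  next
    assume "\<exists>v. (r, v) \<in> K"
    then obtain v where v: "(r, v) \<in> K" by blast
    then have "v < 2 ^ b" using t by (auto simp: trie_def)
    have "key (r, v) \<in> leaves s" using t v by (auto simp: trie_def)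
    then obtain k where k: "k < s 51" "code_of s k = key (r, v)" by (auto simp: leaves_def)
    obtain j where j: "b = Suc j" using b_pos gr0_implies_Suc by blast
    have d: "key (r, v) div 2 ^ j div 2 = R + r"
      unfolding div_step j[symmetric] using key_div_mod(1)[OF \<open>v < 2 ^ b\<close>] .
    then have "R \<le> code_of s k div 2 ^ j" unfolding k(2) by linarith
    from code_prefix_closed[OF n k(1) this] obtain l where l: "l < s 51" "code_of s l = key (r, v) div 2 ^ j"
      unfolding k(2) by blast
    define g where "g = code_of s l mod 2"
    have "code_of s l div 2 = code_of s r" unfolding l(2) r'(2) by (rule d)
    then have g: "g < 2" "code_of s l = 2 * code_of s r + g"
      using mult_div_mod_eq[of 2 "code_of s l"] by (simp_all add: g_def)
    have "child_of s g r \<noteq> 0" using child_par_eq(4)[OF f R_pos l(1) r'(1) g] .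
    then show "child_of s 0 r \<noteq> 0 \<or> child_of s 1 r \<noteq> 0" using less_2_cases[OF g(1)] by auto
  qed
qed

lemma row_test:
  assumes t: "trie s K" and P: "s 51 \<le> P" and e: "ok s e" "val s e = r" "r < R"
  shows "ok s (row_test e)" "val s (row_test e) \<noteq> 0 \<longleftrightarrow> (\<exists>v. (r, v) \<in> K)"
proof -
  have f: "forest R b (code_of s) (child_of s) (par_of s) (s 51) 0"
    using t by (simp add: trie_def nodes_def)
  have r: "r < s 51" using trie_roots_le[OF t] e by simp
  have "child_of s 0 r < P \<and> child_of s 1 r < P"
    using child_less[OF f r, of 0] child_less[OF f r, of 1] r P
    by (cases "child_of s 0 r = 0"; cases "child_of s 1 r = 0"; simp)
  then have "child_of s 0 r + child_of s 1 r < W" using P_le by linarith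
  then show "ok s (row_test e)"
    using e r P by (simp add: row_test_def child_cells cell_less)
  show "val s (row_test e) \<noteq> 0 \<longleftrightarrow> (\<exists>v. (r, v) \<in> K)"
    unfolding row_nonempty[OF t e(3), symmetric] using e(2) by (simp add: row_test_def child_cells)
qed

lemma cost_row_test [simp]: "expr_cost (row_test e) = 2 * expr_cost e + 11"
  by (simp add: row_test_def)

text \<open>The frame is stated relative to \<open>s(41 := v)\<close> because variable 41 carries
  the result and lies outside the scratch range.\<close>

lemma t_min_spec:
  assumes t: "trie s K" and r: "s 40 = r" "r < R" "\<exists>v. (r, v) \<in> K" and P: "s 51 \<le> P"
    and Q: "\<And>t s' v. (r, v) \<in> K \<Longrightarrow> trie s' K \<Longrightarrow> s' 41 = v \<Longrightarrow> trie_frame (s(41 := v)) s' \<Longrightarrow>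
      t \<le> 100 * (b + 1) \<Longrightarrow> Q t s'"
  shows "wp t_min Q s"
proof -
  have n: "nodes s 0" using t by (simp add: trie_def)
  then have f: "forest R b (code_of s) (child_of s) (par_of s) (s 51) 0"
    and s6: "s 6 = R" "s 7 = R * 2 ^ b" "s 5 = 2 ^ b" by (auto simp: nodes_def)
  have rp: "r < s 51" "code_of s r = R + r" using trie_roots_le[OF t] r code_root[OF f r(2)] by auto
  note [simp] = ok_Var ok_Arr cell_less
  \<comment> \<open>The walk changes only variables 43 and 47, so all facts about the trie in
    \<open>s\<close> stay available; \<open>j\<close> is the depth below the root.\<close>
  let ?I = "\<lambda>m s'. \<exists>j\<le>b. \<exists>k<s 51. \<exists>x. s' = s(43 := k, 47 := x) \<and> code_of s k div 2 ^ j = R + r \<and>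
    m = 60 * (b - j)"
  let ?c = "Arr 4 (Var 43) \<lless> Var 7"
  have step: "wp t_min_step Q' (s(43 := k, 47 := x))"
    if k: "k < s 51" "code_of s k < R * 2 ^ b" "code_of s k div 2 ^ j = R + r"
      and Q': "\<And>t g. child_of s g k < s 51 \<Longrightarrow> g < 2 \<Longrightarrow> code_of s (child_of s g k) = 2 * code_of s k + g \<Longrightarrow>
        t \<le> 40 \<Longrightarrow> Q' t (s(43 := child_of s g k, 47 := child_of s g k))" for Q' k x j
  proof -
    have hc: "child_of s 0 k \<noteq> 0 \<or> child_of s 1 k \<noteq> 0"
    proof (cases "k < R")
      case True
      then have kr: "code_of s k = R + k" using code_root[OF f] by simp
      have "j = 0"
      proof (rule ccontr)
        assume "j \<noteq> 0"
        then have "code_of s k div 2 ^ j \<le> code_of s k div 2" using div_le_mono2[of 2 "2 ^ j"] by (cases j) auto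
        then show False using kr k(3) True by linarith
      qed
      then have "k = r" using kr k(3) by simp
      then show ?thesis using row_nonempty[OF t r(2)] r(3) by simp
    next
      case False
      then show ?thesis using has_child[OF f _ k(1)] k(2) R_pos by auto
    qed
    have kP: "k < P" using k P by simp
    have c: "child_of s g k \<noteq> 0 \<Longrightarrow> g < 2 \<Longrightarrow> t \<le> 40 \<Longrightarrow> Q' t (s(43 := child_of s g k, 47 := child_of s g k))" for t g
      using child_less[OF f k(1)] code_child[OF f k(1)] by (intro Q') auto
    show ?thesis
    proof (cases "child_of s 0 k = 0")
      case False
      have [simp]: "s (cell 5 k) = child_of s 0 k" by (simp add: child_cells)
      show ?thesis
        unfolding t_min_step_def using kP False c[OF False]
        by (auto intro!: wp_steps simp: fun_upd_twist)
    next
      case True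
      have [simp]: "s (cell 5 k) = 0" "s (cell 6 k) = child_of s 1 k" using True by (simp_all add: child_cells)
      show ?thesis
        unfolding t_min_step_def using kP True hc c[of 1]
        by (auto intro!: wp_steps simp: fun_upd_twist)
    qed
  qed
  show ?thesis
    unfolding t_min_def
  proof (rule wp_Seq, rule wp_Var)
    show "(43::nat) < 64" by simp
    show "ok s (Var 40)" by simp
    let ?s = "s(43 := val s (Var 40))"
    show "wp (Loop ?c t_min_step ;; 41 :=\<^sub>v (Arr 4 (Var 43) \<ominus> (Var 6 \<oplus> Var 40) \<otimes> Var 5))
      (\<lambda>t'. Q (expr_cost (Var 40) + 2 + t')) ?s"
    proof (rule wp_Seq, rule wp_Loop[where I = ?I and k = "60 * b"])
      have "?s = s(43 := r, 47 := s 47)" using r(1) by (simp add: fun_upd_idem fun_upd_twist)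
      then show "?I (60 * b) ?s"
        using rp by (intro exI[of _ 0] conjI exI[of _ r] exI[of _ "s 47"]) auto
    next
      fix k s' assume "?I k s'"
      then show "ok s' ?c" using P by auto
    next
      fix m s' assume I: "?I m s'" and c: "val s' ?c \<noteq> 0"
      then obtain j k x where k: "j \<le> b" "k < s 51" "s' = s(43 := k, 47 := x)"
        "code_of s k div 2 ^ j = R + r" "m = 60 * (b - j)" by blast
      have lt: "code_of s k < R * 2 ^ b" using c k(3) s6 by (auto simp: code_cell split: if_splits)
      have "j < b"
      proof (rule ccontr)
        assume "\<not> j < b"
        then have "code_of s k div 2 ^ j < R" using lt k(1) by (simp add: less_mult_imp_div_less)
        then show False using k(4) by simp
      qed
      show "wp t_min_step (\<lambda>t s'. \<exists>m'. ?I m' s' \<and> m' + t + expr_cost ?c + 1 \<le> m) s'"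
        unfolding k(3)
      proof (rule step[OF k(2) lt k(4)], goal_cases)
        case (1 t g)
        have "code_of s (child_of s g k) div 2 ^ Suc j = R + r"
          using 1(2,3) k(4) by (simp add: div_mult2_eq)
        moreover have "60 * (b - Suc j) + t + expr_cost ?c + 1 \<le> m" using 1(4) k(5) \<open>j < b\<close> by simp
        ultimately show ?case
          using 1(1) \<open>j < b\<close> by (intro exI[of _ "60 * (b - Suc j)"] conjI exI[of _ "Suc j"] exI[of _ "child_of s g k"] exI) auto
      qed
    next
      fix m t1 s1 assume I: "?I m s1" and c: "val s1 ?c = 0" and t1: "t1 + m \<le> 60 * b + expr_cost ?c + 1"
      then obtain j k x where k: "j \<le> b" "k < s 51" "s1 = s(43 := k, 47 := x)"
        "code_of s k div 2 ^ j = R + r" by blast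
      have ge: "R * 2 ^ b \<le> code_of s k" using c k(3) s6 by (auto simp: code_cell split: if_splits)
      have "j = b" using level_unique[OF ge code_less[OF f k(2)]] k(4) r(2) by simp
      have "code_of s k \<in> key ` K" using k(2) ge t by (auto simp: trie_def leaves_def)
      then obtain q v where qv: "(q, v) \<in> K" "code_of s k = key (q, v)" by auto
      then have "v < 2 ^ b" using t by (auto simp: trie_def)
      then have q: "q = r" using key_div_mod(1)[of v q] k(4) qv(2) \<open>j = b\<close> by simp
      have kv: "code_of s k = (R + r) * 2 ^ b + v" using qv(2) q by (simp add: key_def)
      then have lt: "(R + r) * 2 ^ b < W" "R + r < W"
        using code_less[OF f k(2)] R_b_le R_pos r(2) P_le R_le by linarith+
      have tr: "trie (s1(41 := v)) K" using t k(3) by (simp add: trie_def nodes_def leaves_def)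
      have kP: "k < P" using k(2) P by simp
      have "s1 (cell 4 k) = code_of s k" "s1 6 = R" "s1 40 = r" "s1 5 = 2 ^ b" "s1 43 = k"
        using k(3) s6 r(1) by (simp_all add: code_cell)
      then show "wp (41 :=\<^sub>v (Arr 4 (Var 43) \<ominus> (Var 6 \<oplus> Var 40) \<otimes> Var 5))
          (\<lambda>t'. Q (expr_cost (Var 40) + 2 + (t1 + t'))) s1"
        using lt kP kv qv(1) q tr t1
        by (intro wp_Var Q) (auto simp: k(3) trie_frame_def)
    qed
  qed
qed

end

section \<open>Level structures\<close>

text \<open>\<open>thr M i / M\<close> is the degree threshold of level \<open>i\<close>.\<close>

fun thr :: "nat \<Rightarrow> nat \<Rightarrow> nat" where
  "thr M 0 = M"
| "thr M (Suc i) = thr M i + thr M i div M"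

lemma thr_ge: "M \<le> thr M i"
  by (induction i) auto

lemma thr_mono: "i \<le> j \<Longrightarrow> thr M i \<le> thr M j"
  by (rule lift_Suc_mono_le) auto

lemma thr_upper: "0 < M \<Longrightarrow> real (thr M (i + k)) \<le> (1 + 1 / M) ^ k * thr M i"
proof (induction k)
  case (Suc k)
  have "real (thr M (i + Suc k)) \<le> thr M (i + k) + thr M (i + k) / M"
  proof -
    have "real M * real (thr M (i + k) div M) \<le> thr M (i + k)"
      by (metis of_nat_le_iff of_nat_mult times_div_less_eq_dividend)
    then show ?thesis using Suc.prems by (simp add: pos_le_divide_eq mult.commute)
  qed
  also have "\<dots> = (1 + 1 / M) * thr M (i + k)" by (simp add: field_simps)
  also have "\<dots> \<le> (1 + 1 / M) * ((1 + 1 / M) ^ k * thr M i)"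
    using Suc by (intro mult_left_mono) auto
  finally show ?case by simp
qed simp

text \<open>Rounding down loses at most half: as \<open>M \<le> thr M i\<close>, the quotient by
  \<open>M\<close> is at least 1. So every level adds at least a \<open>2 * M\<close>-th part of the
  value, and \<open>2 * M\<close> levels double it.\<close>

lemma thr_double: "0 < M \<Longrightarrow> M * 2 ^ k \<le> thr M (2 * M * k)"
proof (induction k)
  case (Suc k)
  have step: "2 * M * thr M i + j * thr M i \<le> 2 * M * thr M (i + j)" for i j
  proof (induction j)
    case (Suc j)
    have "thr M i \<le> 2 * (M * (thr M (i + j) div M))"
    proof -
      have "1 \<le> thr M (i + j) div M" using thr_ge[of M "i + j"] Suc.prems \<open>0 < M\<close>
        by (simp add: div_greater_zero_iff Suc_leI)
      moreover have "thr M (i + j) = M * (thr M (i + j) div M) + thr M (i + j) mod M" by simp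
      moreover have "thr M (i + j) mod M < M" using \<open>0 < M\<close> by simp
      ultimately have "thr M (i + j) \<le> 2 * (M * (thr M (i + j) div M))"
        by (metis add_le_mono le_refl less_imp_le mult.right_neutral mult_2 mult_le_mono2 order_trans)
      then show ?thesis using thr_mono[of i "i + j" M] by simp
    qed
    then show ?case using Suc by (simp add: algebra_simps)
  qed simp
  have "2 * M * (2 * thr M (2 * M * k)) \<le> 2 * M * thr M (2 * M * k + 2 * M)"
    using step[of "2 * M * k" "2 * M"] by simp
  then have "2 * thr M (2 * M * k) \<le> thr M (2 * M * k + 2 * M)" using \<open>0 < M\<close> by simp
  then show ?case using Suc by (simp add: algebra_simps)
qed simp

definition simple_edges :: "nat \<Rightarrow> nat set set \<Rightarrow> bool" where
  "simple_edges n E \<longleftrightarrow> (\<forall>e\<in>E. \<exists>u v. e = {u, v} \<and> u \<noteq> v \<and> u < n \<and> v < n)"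

lemma simple_edgesD:
  assumes "simple_edges n E" "{u, v} \<in> E"
  shows "u < n" "v < n" "u \<noteq> v"
  using assms unfolding simple_edges_def by (force simp: doubleton_eq_iff)+

lemma simple_edges_finite: "simple_edges n E \<Longrightarrow> finite E"
  by (rule finite_subset[of _ "Pow {..<n}"]) (auto simp: simple_edges_def)

definition upper :: "nat set set \<Rightarrow> (nat \<Rightarrow> nat) \<Rightarrow> nat \<Rightarrow> nat \<Rightarrow> nat set" where
  "upper E l j u = {v. {u, v} \<in> E \<and> j \<le> l v}"

definition N :: "nat set set \<Rightarrow> (nat \<Rightarrow> nat) \<Rightarrow> nat \<Rightarrow> nat \<Rightarrow> nat" where
  "N E l j u = card (upper E l j u)"

lemma upper_finite: "simple_edges n E \<Longrightarrow> finite (upper E l j u)"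
  by (rule finite_subset[of _ "{..<n}"]) (auto simp: upper_def dest: simple_edgesD)

lemma N_antimono: "simple_edges n E \<Longrightarrow> i \<le> j \<Longrightarrow> N E l j u \<le> N E l i u"
  unfolding N_def by (intro card_mono upper_finite) (auto simp: upper_def)

lemma N_less: "simple_edges n E \<Longrightarrow> u < n \<Longrightarrow> N E l j u < n"
proof -
  assume *: "simple_edges n E" "u < n"
  have "upper E l j u \<subset> {..<n}" using * by (auto simp: upper_def dest: simple_edgesD)
  then have "card (upper E l j u) < card {..<n}" by (intro psubset_card_mono) auto
  then show "N E l j u < n" by (simp add: N_def)
qed

text \<open>\<open>B\<close> is in the role of \<open>1 / \<epsilon>\<close>. As
  \<open>2 ^ b\<close> agrees with \<open>n\<close> up to a factor 2, \<open>b\<close> stands for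
  \<open>log n\<close>.\<close>

locale params =
  fixes n B b :: nat
  assumes n_pos: "1 \<le> n" and B_ge: "2 \<le> B" and b_ge: "1 \<le> b" and n_le: "n \<le> 2 ^ b" and le_n: "2 ^ b \<le> 2 * n"
begin

text \<open>\<open>B * (b + 1)\<close> is the number of levels in the pigeonhole argument of
  \<open>dense_level\<close>. This choice bounds the growth of the threshold over so many levels by
  \<open>exp (1 / B)\<close>.\<close>

definition M :: nat where "M = B * B * (b + 1)"
text \<open>\<open>2 * M\<close> levels double the threshold, so at level \<open>T\<close> it is at
  least \<open>M * 2 ^ (b + 1)\<close>, more than \<open>M\<close> times any degree; no vertex rises
  further.\<close>

definition T :: nat where "T = 2 * M * (b + 1)"

lemma M_ge: "4 \<le> M" "B \<le> M"
proof -
  have "2 * 2 * 1 \<le> B * B * (b + 1)" using B_ge by (intro mult_le_mono) auto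
  then show "4 \<le> M" by (simp add: M_def)
  have "B * 1 * 1 \<le> B * B * (b + 1)" using B_ge by (intro mult_le_mono) auto
  then show "B \<le> M" by (simp add: M_def)
qed

lemma thr_T: "M * n \<le> thr M T"
proof -
  have "M * n \<le> M * 2 ^ (b + 1)" using n_le by simp
  also have "\<dots> \<le> thr M T" unfolding T_def using M_ge by (intro thr_double) auto
  finally show ?thesis .
qed

text \<open>The rising threshold is \<open>(2 + 10 / B) * thr M (l u) / M\<close>. Denominators are
  cleared, which is also the form that the program evaluates.\<close>

definition up_ok :: "nat set set \<Rightarrow> (nat \<Rightarrow> nat) \<Rightarrow> nat \<Rightarrow> bool" where
  "up_ok E l u \<longleftrightarrow> N E l (l u) u * (M * B) \<le> (2 * B + 10) * thr M (l u)"

definition down_ok :: "nat set set \<Rightarrow> (nat \<Rightarrow> nat) \<Rightarrow> nat \<Rightarrow> bool" where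
  "down_ok E l u \<longleftrightarrow> l u = 0 \<or> thr M (l u - 1) \<le> N E l (l u - 1) u * M"

lemma up_ok_T:
  assumes "simple_edges n E" "u < n" "T \<le> l u"
  shows "up_ok E l u"
proof -
  have "N E l (l u) u * (M * B) \<le> n * (M * B)"
    using N_less[OF assms(1,2), of l "l u"] by (intro mult_le_mono1) simp
  also have "\<dots> = B * (M * n)" by simp
  also have "\<dots> \<le> (2 * B + 10) * thr M (l u)"
    using thr_T thr_mono[OF assms(3), of M] by (intro mult_le_mono) auto
  finally show ?thesis by (simp add: up_ok_def)
qed

subsection \<open>Approximation\<close>

lemma induced_edges_le:
  assumes E: "simple_edges n E" and "\<And>u. u < n \<Longrightarrow> up_ok E l u" and i: "\<And>u. u < n \<Longrightarrow> l u \<le> i" and S: "S \<subseteq> {..<n}"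
  shows "card (induced_edges E S) * (M * B) \<le> card S * ((2 * B + 10) * thr M i)"
proof -
  have fin: "finite S" using S by (rule finite_subset) auto
  have "induced_edges E S \<subseteq> (\<Union>u\<in>S. (\<lambda>v. {u, v}) ` upper E l (l u) u)"
  proof
    fix e assume e: "e \<in> induced_edges E S"
    then obtain x y where xy: "e = {x, y}" using E by (auto simp: induced_edges_def simple_edges_def)
    have *: "x \<in> S" "y \<in> S" "{x, y} \<in> E" using e xy by (auto simp: induced_edges_def)
    show "e \<in> (\<Union>u\<in>S. (\<lambda>v. {u, v}) ` upper E l (l u) u)"
    proof (cases "l x \<le> l y")
      case True
      then have "y \<in> upper E l (l x) x" using * by (simp add: upper_def)
      then show ?thesis using * xy by blast
    next
      case False
      then have "x \<in> upper E l (l y) y" using * by (simp add: upper_def insert_commute)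
      moreover have "e = {y, x}" using xy by blast
      ultimately show ?thesis using * by blast
    qed
  qed
  then have "card (induced_edges E S) \<le> card (\<Union>u\<in>S. (\<lambda>v. {u, v}) ` upper E l (l u) u)"
    using fin upper_finite[OF E] by (intro card_mono) auto
  also have "\<dots> \<le> (\<Sum>u\<in>S. card ((\<lambda>v. {u, v}) ` upper E l (l u) u))"
    by (rule card_UN_le[OF fin])
  also have "\<dots> \<le> (\<Sum>u\<in>S. N E l (l u) u)"
    unfolding N_def by (intro sum_mono card_image_le upper_finite[OF E])
  finally have "card (induced_edges E S) * (M * B) \<le> (\<Sum>u\<in>S. N E l (l u) u * (M * B))"
    by (simp add: sum_distrib_right[symmetric])
  also have "\<dots> \<le> (\<Sum>u\<in>S. (2 * B + 10) * thr M i)"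
  proof (intro sum_mono)
    fix u assume u: "u \<in> S"
    then have "N E l (l u) u * (M * B) \<le> (2 * B + 10) * thr M (l u)"
      using assms(2)[of u] S by (auto simp: up_ok_def)
    also have "\<dots> \<le> (2 * B + 10) * thr M i" using i[of u] u S by (auto intro!: thr_mono)
    finally show "N E l (l u) u * (M * B) \<le> (2 * B + 10) * thr M i" .
  qed
  finally show ?thesis by simp
qed

text \<open>A vertex of \<open>Z j\<close> may lie above level \<open>j\<close>, but passing from
  \<open>l u\<close> to \<open>j\<close> only lowers the threshold and enlarges the count. So it has
  at least \<open>thr M (j - 1) / M\<close> neighbours in \<open>Z (j - 1)\<close>, and counting
  incidences meets every edge at most twice.\<close>

lemma induced_edges_ge:
  assumes E: "simple_edges n E" and ok: "\<And>u. u < n \<Longrightarrow> down_ok E l u" and j: "0 < j"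
  defines "Z \<equiv> \<lambda>k. {u. u < n \<and> k \<le> l u}"
  shows "card (Z j) * thr M (j - 1) \<le> 2 * M * card (induced_edges E (Z (j - 1)))"
proof -
  let ?F = "induced_edges E (Z (j - 1))"
  have finF: "finite ?F" using simple_edges_finite[OF E] by (simp add: induced_edges_def)
  have "card (Z j) * thr M (j - 1) = (\<Sum>u\<in>Z j. thr M (j - 1))" by simp
  also have "\<dots> \<le> (\<Sum>u\<in>Z j. card {e \<in> ?F. u \<in> e} * M)"
  proof (intro sum_mono)
    fix u assume u: "u \<in> Z j"
    then have "thr M (l u - 1) \<le> N E l (l u - 1) u * M"
      using ok[of u] j by (auto simp: Z_def down_ok_def)
    moreover have "thr M (j - 1) \<le> thr M (l u - 1)" using u by (intro thr_mono) (auto simp: Z_def)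
    moreover have "N E l (l u - 1) u \<le> N E l (j - 1) u" using u by (intro N_antimono[OF E]) (auto simp: Z_def)
    moreover have "N E l (j - 1) u \<le> card {e \<in> ?F. u \<in> e}"
    proof -
      have "(\<lambda>v. {u, v}) ` upper E l (j - 1) u \<subseteq> {e \<in> ?F. u \<in> e}"
        using u by (auto simp: upper_def induced_edges_def Z_def dest: simple_edgesD[OF E])
      moreover have "inj_on (\<lambda>v. {u, v}) (upper E l (j - 1) u)"
        by (auto simp: inj_on_def doubleton_eq_iff)
      ultimately show ?thesis
        unfolding N_def using finF by (intro card_inj_on_le) auto
    qed
    ultimately show "thr M (j - 1) \<le> card {e \<in> ?F. u \<in> e} * M"
      by (meson mult_le_mono1 order_trans)
  qed
  also have "\<dots> = (\<Sum>u\<in>Z j. \<Sum>e\<in>?F. if u \<in> e then M else 0)"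
    using finF by (intro sum.cong refl) (simp add: sum.If_cases Int_def)
  also have "\<dots> = (\<Sum>e\<in>?F. \<Sum>u\<in>Z j. if u \<in> e then M else 0)" by (rule sum.swap)
  also have "\<dots> \<le> (\<Sum>e\<in>?F. 2 * M)"
  proof (intro sum_mono)
    fix e assume "e \<in> ?F"
    then obtain x y where e: "e = {x, y}" using E by (auto simp: induced_edges_def simple_edges_def)
    have "(\<Sum>u\<in>Z j. if u \<in> e then M else 0) = card (Z j \<inter> e) * M"
      by (simp add: sum.If_cases Z_def)
    also have "card (Z j \<inter> e) \<le> card e" using e by (intro card_mono) auto
    also have "card e \<le> 2" using e by (simp add: card_insert_if)
    finally show "(\<Sum>u\<in>Z j. if u \<in> e then M else 0) \<le> 2 * M" by simp
  qed
  finally show ?thesis by (simp add: mult.commute)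
qed

text \<open>If the sets of vertices above a level grew by more than \<open>1 + 1 / B\<close> on each
  of \<open>B * (b + 1)\<close> successive levels, their size would reach
  \<open>2 ^ (b + 1)\<close>, which exceeds \<open>n\<close>.\<close>

lemma growth_2: "2 ^ k \<le> (1 + 1 / real B) ^ (B * k)"
proof -
  have "1 + real B * (1 / real B) \<le> (1 + 1 / real B) ^ B"
    by (rule Bernoulli_inequality) (rule order_trans[of _ 0], auto)
  then have "2 \<le> (1 + 1 / real B) ^ B" using B_ge by simp
  then have "2 ^ k \<le> ((1 + 1 / real B) ^ B) ^ k" by (intro power_mono) auto
  then show ?thesis by (simp add: power_mult)
qed

text \<open>The exponent is at most \<open>M / B\<close>, so the growth is at most
  \<open>exp (1 / B)\<close>, and this is at most \<open>1 + 1 / B + 1 / B ^ 2\<close>.\<close>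

lemma thr_close:
  assumes "k \<le> B * (b + 1)"
  shows "real (thr M (i + k)) \<le> (1 + 2 / B) * thr M i"
proof -
  have B: "0 < real B" "1 / real B \<le> 1" using B_ge by auto
  have "(1 + 1 / real M) ^ k \<le> exp (1 / real M) ^ k"
    by (intro power_mono) (auto simp: add_increasing)
  also have "\<dots> = exp (real k * (1 / real M))" by (simp only: exp_of_nat_mult)
  also have "\<dots> \<le> exp (1 / real B)"
  proof -
    have "real k \<le> real (B * (b + 1))" using assms by linarith
    then have "real k * (1 / real M) \<le> real (B * (b + 1)) * (1 / real M)" by (intro mult_right_mono) auto
    also have "\<dots> = 1 / real B"
    proof -
      have "real M = real B * real (B * (b + 1))" by (simp add: M_def algebra_simps)
      moreover have "0 < real (B * (b + 1))" using B_ge by (intro of_nat_0_less_iff[THEN iffD2]) simp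
      ultimately show ?thesis using B by (simp del: of_nat_mult)
    qed
    finally show ?thesis by simp
  qed
  also have "\<dots> \<le> 1 + 1 / real B + (1 / real B)\<^sup>2" using B by (intro exp_bound) auto
  also have "(1 / real B)\<^sup>2 \<le> 1 / real B" 
    using B mult_left_mono[of "1 / real B" 1 "1 / real B"] by (simp add: power2_eq_square)
  finally have "(1 + 1 / real M) ^ k \<le> 1 + 2 / B" by simp
  then have "(1 + 1 / real M) ^ k * thr M i \<le> (1 + 2 / B) * thr M i" by (intro mult_right_mono) auto
  then show ?thesis using thr_upper[of M i k] M_ge by simp
qed

lemma dense_level:
  assumes E: "simple_edges n E" "E \<noteq> {}" and ok: "\<And>u. u < n \<Longrightarrow> down_ok E l u"
    and i: "u\<^sub>0 < n" "l u\<^sub>0 = i"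
  shows "\<exists>S \<subseteq> {..<n}. S \<noteq> {} \<and> real (thr M i) \<le> 2 * M * ((1 + 1 / B) * (1 + 2 / B)) * density E S"
proof (cases "i < B * (b + 1)")
  case True
  obtain x y where e: "{x, y} \<in> E" "x \<noteq> y" "x < n" "y < n"
    using E by (auto simp: simple_edges_def) metis
  have "{x, y} \<in> induced_edges E {x, y}" using e by (simp add: induced_edges_def)
  then have "1 \<le> card (induced_edges E {x, y})"
    using simple_edges_finite[OF E(1)] by (simp add: Suc_le_eq card_gt_0_iff induced_edges_def) blast
  then have "1 / 2 \<le> density E {x, y}" using e by (simp add: density_def)
  then have d: "1 \<le> (1 + 1 / real B) * (2 * density E {x, y})"
    using mult_mono[of 1 "1 + 1 / real B" 1 "2 * density E {x, y}"] by simp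
  have "real (thr M i) \<le> (1 + 2 / B) * M" using thr_close[of i 0] True by simp
  also have "\<dots> \<le> ((1 + 2 / B) * M) * ((1 + 1 / B) * (2 * density E {x, y}))"
    using mult_left_mono[OF d, of "(1 + 2 / real B) * M"] by simp
  finally have "real (thr M i) \<le> 2 * M * ((1 + 1 / B) * (1 + 2 / B)) * density E {x, y}" by (simp add: ac_simps)
  then show ?thesis using e by (intro exI[of _ "{x, y}"]) auto
next
  case False
  define L where "L = B * (b + 1)"
  define Z where "Z k = {u. u < n \<and> k \<le> l u}" for k
  have Z0: "0 < card (Z k)" if "k \<le> i" for k
    using i that by (auto simp: Z_def card_gt_0_iff)
  have "\<exists>k<L. real (card (Z (i - Suc k))) \<le> (1 + 1 / real B) * card (Z (i - k))"
  proof (rule ccontr)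
    assume a: "\<not> ?thesis"
    have "k \<le> L \<Longrightarrow> (1 + 1 / real B) ^ k \<le> card (Z (i - k))" for k
    proof (induction k)
      case 0
      then show ?case using Z0[of i] by simp
    next
      case (Suc k)
      then have "(1 + 1 / real B) * (1 + 1 / real B) ^ k \<le> (1 + 1 / real B) * card (Z (i - k))"
        by (intro mult_left_mono) auto
      also have "\<dots> \<le> card (Z (i - Suc k))" using a Suc.prems by (meson Suc_le_lessD linorder_le_cases)
      finally show ?case by simp
    qed
    then have "(1 + 1 / real B) ^ L \<le> card (Z (i - L))" by simp
    also have "card (Z (i - L)) \<le> card {..<n}" by (intro card_mono) (auto simp: Z_def)
    also have "real (card {..<n}) \<le> 2 ^ b" using n_le by (simp add: of_nat_le_numeral_power_cancel_iff)
    also have "(2::real) ^ b < 2 ^ (b + 1)" by simp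
    also have "\<dots> \<le> (1 + 1 / real B) ^ L" unfolding L_def by (rule growth_2)
    finally show False by simp
  qed
  then obtain k where k: "k < L" "real (card (Z (i - Suc k))) \<le> (1 + 1 / real B) * card (Z (i - k))" by blast
  \<comment> \<open>\<open>Z j\<close> and \<open>Z (j - 1)\<close> are the two sets of almost equal
    size, and \<open>j - 1\<close> is at most \<open>L\<close> levels below
    \<open>i\<close>.\<close>
  define j where "j = i - k"
  have j: "0 < j" "i = (j - 1) + Suc k" "i - Suc k = j - 1" using k False by (auto simp: j_def L_def)
  have Zj: "0 < card (Z j)" "0 < card (Z (j - 1))" using Z0 by (auto simp: j_def)
  let ?e = "real (card (induced_edges E (Z (j - 1))))"
  have "real (card (Z j)) * thr M (j - 1) \<le> 2 * M * ?e"
  proof -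
    have "card (Z j) * thr M (j - 1) \<le> 2 * M * card (induced_edges E (Z (j - 1)))"
      using induced_edges_ge[OF E(1) ok j(1)] by (simp add: Z_def)
    then have "real (card (Z j) * thr M (j - 1)) \<le> real (2 * M * card (induced_edges E (Z (j - 1))))"
      by (rule of_nat_mono)
    then show ?thesis by simp
  qed
  also have "2 * M * ?e \<le> 2 * M * (density E (Z (j - 1)) * ((1 + 1 / real B) * card (Z j)))"
  proof (intro mult_left_mono)
    have "?e = density E (Z (j - 1)) * card (Z (j - 1))" using Zj by (simp add: density_def)
    also have "\<dots> \<le> density E (Z (j - 1)) * ((1 + 1 / real B) * card (Z j))"
    proof (rule mult_left_mono)
      show "real (card (Z (j - 1))) \<le> (1 + 1 / real B) * card (Z j)"
        using k(2) unfolding j(3) j_def[symmetric] .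
    qed (simp add: density_def)
    finally show "?e \<le> density E (Z (j - 1)) * ((1 + 1 / real B) * card (Z j))" .
  qed simp
  finally have "real (card (Z j)) * thr M (j - 1) \<le> 2 * M * (density E (Z (j - 1)) * ((1 + 1 / real B) * card (Z j)))" .
  then have "real (card (Z j)) * thr M (j - 1) \<le> real (card (Z j)) * (2 * M * ((1 + 1 / B) * density E (Z (j - 1))))"
    by (simp only: ac_simps)
  then have "thr M (j - 1) \<le> 2 * M * ((1 + 1 / B) * density E (Z (j - 1)))" using Zj by simp
  then have "(1 + 2 / B) * thr M (j - 1) \<le> (1 + 2 / B) * (2 * M * ((1 + 1 / B) * density E (Z (j - 1))))"
    by (intro mult_left_mono) auto
  moreover have "real (thr M i) \<le> (1 + 2 / B) * thr M (j - 1)"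
    unfolding j(2) using k(1) by (intro thr_close) (simp add: L_def)
  ultimately have "real (thr M i) \<le> 2 * M * ((1 + 1 / B) * (1 + 2 / B)) * density E (Z (j - 1))" by (simp add: ac_simps)
  moreover have "Z (j - 1) \<noteq> {}" using Zj(2) by force
  ultimately show ?thesis by (intro exI[of _ "Z (j - 1)"]) (auto simp: Z_def)
qed

text \<open>The reported value is \<open>thr M i / M\<close> divided by
  \<open>2 * (1 + 1 / B) * (1 + 2 / B)\<close>, written as a quotient of integers. The divisor is
  the factor lost in \<open>dense_level\<close>, so the value never exceeds the optimum; the upper
  bound on the optimum costs the further factor \<open>2 + 10 / B\<close>.\<close>

lemma estimate:
  assumes E: "simple_edges n E" "E \<noteq> {}" and ok: "\<And>u. u < n \<Longrightarrow> up_ok E l u \<and> down_ok E l u"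
    and i: "u\<^sub>0 < n" "l u\<^sub>0 = i" "\<And>u. u < n \<Longrightarrow> l u \<le> i"
  shows "approximates (4 + 140 / B) (max_density {..<n} E)
    (real (thr M i * (B * B)) / real (M * (2 * (B + 1) * (B + 2))))"
proof -
  let ?\<rho> = "max_density {..<n} E"
  let ?\<eta> = "real (thr M i * (B * B)) / real (M * (2 * (B + 1) * (B + 2)))"
  define x where "x = 1 / real B"
  have x: "0 < x" "x \<le> 1" using B_ge by (auto simp: x_def)
  have pos: "0 < real B" "0 < real M" "0 < real (thr M i)" using B_ge M_ge thr_ge[of M i] by auto
  have fin: "finite {S. S \<subseteq> {..<n} \<and> S \<noteq> {}}" by simp
  have ne: "{S. S \<subseteq> {..<n} \<and> S \<noteq> {}} \<noteq> {}" using i(1) by (auto intro!: exI[of _ "{u\<^sub>0}"])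
  have eta: "?\<eta> = thr M i / (2 * M * ((1 + 1 / B) * (1 + 2 / B)))"
    using pos by (simp add: field_simps)
  obtain S where S: "S \<subseteq> {..<n}" "S \<noteq> {}" "real (thr M i) \<le> 2 * M * ((1 + 1 / B) * (1 + 2 / B)) * density E S"
    using dense_level[where l = l, OF E _ i(1,2)] ok by blast
  have "density E S \<le> ?\<rho>" unfolding max_density_def using fin S by (intro Max_ge) auto
  moreover have "?\<eta> \<le> density E S"
    unfolding eta using S(3) pos by (subst pos_divide_le_eq) (auto simp: ac_simps intro!: mult_pos_pos add_pos_nonneg)
  ultimately have lower: "?\<eta> \<le> ?\<rho>" by linarith
  have up: "?\<rho> \<le> (2 + 10 / B) * (thr M i / M)"
    unfolding max_density_def
  proof (intro Max.boundedI)
    fix r assume "r \<in> density E ` {S. S \<subseteq> {..<n} \<and> S \<noteq> {}}"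
    then obtain S where S: "S \<subseteq> {..<n}" "S \<noteq> {}" "r = density E S" by auto
    then have c: "0 < real (card S)" using finite_subset[of S "{..<n}"] by (simp add: card_gt_0_iff)
    have "card (induced_edges E S) * (M * B) \<le> card S * ((2 * B + 10) * thr M i)"
      by (rule induced_edges_le[where l = l, OF E(1) _ i(3) S(1)]) (simp_all add: ok)
    then have "real (card (induced_edges E S) * (M * B)) \<le> real (card S * ((2 * B + 10) * thr M i))"
      by (rule of_nat_mono)
    then show "r \<le> (2 + 10 / B) * (thr M i / M)"
      using c pos by (simp add: S(3) density_def field_simps)
  qed (use fin ne in auto)
  \<comment> \<open>\<open>140 = 32 + 68 + 40\<close>, the sum of the coefficients of the powers of
    \<open>x\<close>, as \<open>x \<le> 1\<close>.\<close>
  have "(2 + 10 * x) * (2 * ((1 + x) * (1 + 2 * x))) \<le> 4 + 140 * x"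
  proof -
    have 1: "x * x \<le> x * 1" using x by (intro mult_left_mono) auto
    then have "x * x \<le> 1" using x by linarith
    then have 2: "x * (x * x) \<le> x * 1" using x by (intro mult_left_mono) auto
    have "(2 + 10 * x) * (2 * ((1 + x) * (1 + 2 * x))) = 4 + 32 * x + 68 * (x * x) + 40 * (x * (x * x))"
      by (simp add: algebra_simps)
    also have "\<dots> \<le> 4 + 140 * x" using 1 2 by linarith
    finally show ?thesis .
  qed
  then have k: "(2 + 10 / B) * (2 * ((1 + 1 / B) * (1 + 2 / B))) \<le> 4 + 140 / B" by (simp add: x_def)
  have "?\<rho> \<le> ((2 + 10 / B) * (2 * ((1 + 1 / B) * (1 + 2 / B)))) * ?\<eta>"
  proof -
    have "0 < 1 + 1 / real B" "0 < 1 + 2 / real B" using pos by (auto intro!: add_pos_nonneg)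
    then have "(2 + 10 / B) * (thr M i / M) = ((2 + 10 / B) * (2 * ((1 + 1 / B) * (1 + 2 / B)))) * ?\<eta>"
      unfolding eta by simp
    then show ?thesis using up by simp
  qed
  also have "\<dots> \<le> (4 + 140 / B) * ?\<eta>" by (rule mult_right_mono[OF k]) simp
  finally show ?thesis
    unfolding approximates_def using lower pos by (simp add: pos_divide_le_eq mult.commute add_pos_nonneg)
qed

subsection \<open>Potential\<close>

text \<open>The potential of a vertex pays for its future moves. The term \<open>(T + 1) deg u\<close> minus the
  last summand of \<open>cred\<close> summed over the levels below \<open>u\<close> counts the edges that a rise
  of \<open>u\<close> still has to pass; the first summand of \<open>cred\<close> is saved up for a descent.\<close>

definition cred :: "nat \<Rightarrow> nat \<Rightarrow> int" where
  "cred j x = max 0 (int ((2 * B + 10) * thr M j) - int (M * B * x)) - 4 * int x"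

definition pot1 :: "nat set set \<Rightarrow> (nat \<Rightarrow> nat) \<Rightarrow> nat \<Rightarrow> int" where
  "pot1 E l u = 4 * int (T + 1) * int (N E (\<lambda>_. 0) 0 u) + (\<Sum>j<l u. cred j (N E l j u))"

definition pot :: "nat set set \<Rightarrow> (nat \<Rightarrow> nat) \<Rightarrow> int" where
  "pot E l = (\<Sum>u<n. pot1 E l u)"

text \<open>For this reason a rise of one vertex or a new edge never increases the credit of the
  neighbours.\<close>

lemma cred_antimono: "x \<le> y \<Longrightarrow> cred j y \<le> cred j x"
proof -
  assume "x \<le> y"
  then have "int (M * B * x) \<le> int (M * B * y)" "int x \<le> int y"
    by (simp_all only: of_nat_le_iff mult_le_mono2)
  then show ?thesis unfolding cred_def by linarith
qed

text \<open>The loss of one neighbour costs at most \<open>M * B\<close> in the first summand and 4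
  in the second. This is the price, per level, of a fall next to a vertex and of a deletion.\<close>

lemma cred_pred: "cred j (x - 1) \<le> cred j x + int (M * B + 4)"
proof (cases x)
  case (Suc y)
  have "int (M * B * Suc y) = int (M * B * y) + int (M * B)" by simp
  then show ?thesis unfolding Suc cred_def by simp
qed simp

text \<open>Only the parts \<open>- 4 * int x\<close> are negative. On each of the at most
  \<open>T\<close> levels below \<open>u\<close> they amount to at most 4 times the degree, which
  the leading term of \<open>pot1\<close> covers.\<close>

lemma pot_nonneg:
  assumes E: "simple_edges n E" and l: "\<And>u. u < n \<Longrightarrow> l u \<le> T"
  shows "0 \<le> pot E l"
  unfolding pot_def
proof (intro sum_nonneg)
  fix u assume u: "u \<in> {..<n}"
  let ?d = "N E (\<lambda>_. 0) 0 u"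
  have "- (4 * int ?d) \<le> cred j (N E l j u)" for j
  proof -
    have "upper E l j u \<subseteq> upper E (\<lambda>_. 0) 0 u" by (auto simp: upper_def)
    then have "N E l j u \<le> ?d" unfolding N_def by (rule card_mono[OF upper_finite[OF E]])
    then show ?thesis unfolding cred_def by linarith
  qed
  then have "(\<Sum>j<l u. - (4 * int ?d)) \<le> (\<Sum>j<l u. cred j (N E l j u))" by (intro sum_mono)
  then have "- (int (l u) * (4 * int ?d)) \<le> (\<Sum>j<l u. cred j (N E l j u))" by simp
  moreover have "int (l u) * (4 * int ?d) \<le> int (T + 1) * (4 * int ?d)"
    using l[of u] u by (intro mult_right_mono) auto
  moreover have "4 * int (T + 1) * int ?d = int (T + 1) * (4 * int ?d)" by simp
  ultimately show "0 \<le> pot1 E l u" unfolding pot1_def by linarith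
qed

lemma pot_empty: "pot {} (\<lambda>_. 0) = 0"
  by (simp add: pot_def pot1_def N_def upper_def)

lemma N_self:
  assumes "simple_edges n E"
  shows "N E (l(u := i)) j u = N E l j u"
proof -
  have "{u} \<notin> E" using simple_edgesD(3)[OF assms, of u u] by auto
  then have "upper E (l(u := i)) j u = upper E l j u" by (auto simp: upper_def)
  then show ?thesis by (simp add: N_def)
qed

text \<open>A vertex that wants to rise has so many neighbours that the saved part of its new
  summand is 0 and only \<open>- 4 * N\<close> remains. All other vertices keep or lose
  credit.\<close>

lemma pot_rise:
  assumes E: "simple_edges n E" and u: "u < n" and up: "\<not> up_ok E l u"
  shows "pot E (l(u := l u + 1)) + 4 * int (N E l (l u) u) \<le> pot E l"
proof -
  let ?l = "l(u := l u + 1)"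
  have 1: "pot1 E ?l v \<le> pot1 E l v" if "v \<noteq> u" for v
  proof -
    have "upper E l j v \<subseteq> upper E ?l j v" for j by (auto simp: upper_def)
    then have "N E l j v \<le> N E ?l j v" for j unfolding N_def by (rule card_mono[OF upper_finite[OF E]])
    then have "(\<Sum>j<l v. cred j (N E ?l j v)) \<le> (\<Sum>j<l v. cred j (N E l j v))"
      by (intro sum_mono cred_antimono)
    then show ?thesis using that by (simp add: pot1_def)
  qed
  have "int ((2 * B + 10) * thr M (l u)) \<le> int (M * B * N E l (l u) u)"
    using up unfolding up_ok_def of_nat_le_iff by (simp add: mult.commute)
  then have "cred (l u) (N E l (l u) u) = - 4 * int (N E l (l u) u)"
    unfolding cred_def by linarith
  then have 2: "pot1 E ?l u = pot1 E l u - 4 * int (N E l (l u) u)"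
    using N_self[OF E] by (simp add: pot1_def)
  have "pot E ?l = pot1 E ?l u + (\<Sum>v\<in>{..<n} - {u}. pot1 E ?l v)"
    unfolding pot_def using u by (intro sum.remove) auto
  also have "(\<Sum>v\<in>{..<n} - {u}. pot1 E ?l v) \<le> (\<Sum>v\<in>{..<n} - {u}. pot1 E l v)"
    using 1 by (intro sum_mono) auto
  also have "pot1 E ?l u + (\<Sum>v\<in>{..<n} - {u}. pot1 E l v) = pot E l - 4 * int (N E l (l u) u)"
    unfolding pot_def using u 2 by (simp add: sum.remove)
  finally show ?thesis by simp
qed

text \<open>The factor 2 in \<open>up_ok\<close> is used here. With \<open>x\<close> the count on
  levels \<open>\<ge> l u - 1\<close>, each of the \<open>x\<close> neighbours is affected in at
  most one summand, at a cost of \<open>M * B + 4\<close>. The credit released by \<open>u\<close>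
  exceeds \<open>2 * M * B * x - M * B * x\<close>, which pays for all of them; the 10 in
  \<open>2 * B + 10\<close> supplies the surplus that pays for the work.\<close>

lemma pot_fall:
  assumes E: "simple_edges n E" and u: "u < n" and down: "\<not> down_ok E l u"
  shows "pot E (l(u := l u - 1)) + 2 * int (N E l (l u - 1) u) + 10 \<le> pot E l"
proof -
  define i where "i = l u - 1"
  define x where "x = N E l i u"
  let ?l = "l(u := i)"
  let ?m = "int (M * B + 4)"
  have i: "l u = Suc i" using down by (cases "l u") (auto simp: i_def down_ok_def)
  have x: "x * M < thr M i" using down by (simp add: down_ok_def i x_def)
  have 1: "pot1 E ?l v \<le> pot1 E l v + (if v \<in> upper E l i u then ?m else 0)" if v: "v \<noteq> u" for v
  proof -
    have eq: "N E ?l j v = N E l j v" if "j \<noteq> Suc i" for j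
    proof -
      have "upper E ?l j v = upper E l j v" using that i by (auto simp: upper_def)
      then show ?thesis by (simp add: N_def)
    qed
    have eq': "N E ?l j v = N E l j v" if "{u, v} \<notin> E" for j
    proof -
      have "upper E ?l j v = upper E l j v" using that by (auto simp: upper_def insert_commute)
      then show ?thesis by (simp add: N_def)
    qed
    have step: "N E l (Suc i) v - 1 \<le> N E ?l (Suc i) v"
    proof -
      have "upper E l (Suc i) v - {u} \<subseteq> upper E ?l (Suc i) v" by (auto simp: upper_def)
      then have "card (upper E l (Suc i) v - {u}) \<le> card (upper E ?l (Suc i) v)"
        using upper_finite[OF E] by (intro card_mono) auto
      moreover have "card (upper E l (Suc i) v) - 1 \<le> card (upper E l (Suc i) v - {u})"
        by (cases "u \<in> upper E l (Suc i) v") (auto simp: card_Diff_singleton_if)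
      ultimately show ?thesis by (simp add: N_def)
    qed
    show ?thesis
    proof (cases "{u, v} \<in> E \<and> Suc i < l v")
      case True
      have "(\<Sum>j<l v. cred j (N E ?l j v)) \<le> (\<Sum>j<l v. cred j (N E l j v) + (if j = Suc i then ?m else 0))"
      proof (intro sum_mono)
        fix j
        show "cred j (N E ?l j v) \<le> cred j (N E l j v) + (if j = Suc i then ?m else 0)"
          using eq[of j] cred_antimono[OF step, of j] cred_pred[of j "N E l (Suc i) v"] by auto
      qed
      also have "\<dots> = (\<Sum>j<l v. cred j (N E l j v)) + ?m"
        using True by (simp add: sum.distrib)
      finally show ?thesis using True v by (simp add: pot1_def upper_def)
    next
      case False
      then have "(\<Sum>j<l v. cred j (N E ?l j v)) = (\<Sum>j<l v. cred j (N E l j v))"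
        using eq eq' by (intro sum.cong refl) (metis lessThan_iff)
      then show ?thesis using v by (simp add: pot1_def)
    qed
  qed
  have 2: "pot1 E ?l u = pot1 E l u - cred i x"
    using N_self[OF E] i by (simp add: pot1_def x_def)
  have s1: "pot E ?l = pot1 E ?l u + (\<Sum>v\<in>{..<n} - {u}. pot1 E ?l v)"
    unfolding pot_def using u by (intro sum.remove) auto
  have s2: "(\<Sum>v\<in>{..<n} - {u}. pot1 E ?l v) \<le>
      (\<Sum>v\<in>{..<n} - {u}. pot1 E l v + (if v \<in> upper E l i u then ?m else 0))"
    by (rule sum_mono, rule 1) simp
  have s3: "(\<Sum>v\<in>{..<n} - {u}. pot1 E l v + (if v \<in> upper E l i u then ?m else 0)) \<le>
      (\<Sum>v\<in>{..<n} - {u}. pot1 E l v) + ?m * int x"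
  proof -
    have "(\<Sum>v\<in>{..<n} - {u}. if v \<in> upper E l i u then ?m else 0) =
        (\<Sum>v\<in>({..<n} - {u}) \<inter> upper E l i u. ?m)"
      by (rule sum.inter_restrict[symmetric]) simp
    also have "\<dots> = int (card (({..<n} - {u}) \<inter> upper E l i u)) * ?m" by simp
    also have "\<dots> \<le> int x * ?m"
      unfolding x_def N_def using upper_finite[OF E] by (intro mult_right_mono of_nat_mono card_mono) auto
    finally show ?thesis unfolding sum.distrib by (simp add: mult.commute)
  qed
  have s4: "pot E l = pot1 E l u + (\<Sum>v\<in>{..<n} - {u}. pot1 E l v)"
    unfolding pot_def using u by (intro sum.remove) auto
  have "pot E ?l \<le> pot E l - cred i x + ?m * int x" using s1 s2 s3 s4 2 by linarith
  moreover have "2 * int x + 10 + ?m * int x \<le> cred i x"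
  proof -
    \<comment> \<open>The unit yields the constant 10, and \<open>10 * (M * x) \<ge> 40 * x\<close>
      absorbs the remaining terms that are linear in \<open>x\<close>.\<close>
    have "M * x + 1 \<le> thr M i" using x by (simp add: mult.commute)
    then have "(2 * B + 10) * (M * x + 1) \<le> (2 * B + 10) * thr M i" by (rule mult_le_mono2)
    moreover have "4 * x \<le> M * x" using M_ge by simp
    moreover have "(2 * B + 10) * (M * x + 1) = 2 * (M * B * x) + 10 * (M * x) + (2 * B + 10)"
      by (simp add: algebra_simps)
    ultimately have "2 * (M * B * x) + 10 * (4 * x) + 10 \<le> (2 * B + 10) * thr M i" by linarith
    then have "2 * int (M * B * x) + 40 * int x + 10 \<le> int ((2 * B + 10) * thr M i)" by linarith
    moreover have "?m * int x = int (M * B * x) + 4 * int x" by (simp add: algebra_simps)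
    ultimately show ?thesis unfolding cred_def by linarith
  qed
  ultimately show ?thesis unfolding i_def x_def by simp
qed

text \<open>New neighbours can only lower \<open>cred\<close>. What grows is the leading term, by
  \<open>4 * (T + 1)\<close> at each end.\<close>

lemma pot_insert:
  assumes E: "simple_edges n E" and uv: "u < n" "v < n" "u \<noteq> v" "{u, v} \<notin> E"
  shows "pot (E \<union> {{u, v}}) l \<le> pot E l + 8 * int (T + 1)"
proof -
  let ?E = "E \<union> {{u, v}}"
  have E': "simple_edges n ?E" using E uv by (auto simp: simple_edges_def)
  have "pot1 ?E l x \<le> pot1 E l x + (if x \<in> {u, v} then 4 * int (T + 1) else 0)" for x
  proof -
    have "upper E l j x \<subseteq> upper ?E l j x" for j by (auto simp: upper_def)
    then have "N E l j x \<le> N ?E l j x" for j unfolding N_def by (rule card_mono[OF upper_finite[OF E']])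
    then have 1: "(\<Sum>j<l x. cred j (N ?E l j x)) \<le> (\<Sum>j<l x. cred j (N E l j x))"
      by (intro sum_mono cred_antimono)
    have "N ?E (\<lambda>_. 0) 0 x \<le> N E (\<lambda>_. 0) 0 x + (if x \<in> {u, v} then 1 else 0)"
    proof (cases "x \<in> {u, v}")
      case True
      define y where "y = (if x = u then v else u)"
      have "upper ?E (\<lambda>_. 0) 0 x \<subseteq> insert y (upper E (\<lambda>_. 0) 0 x)"
        by (auto simp: upper_def doubleton_eq_iff y_def)
      then have "card (upper ?E (\<lambda>_. 0) 0 x) \<le> card (insert y (upper E (\<lambda>_. 0) 0 x))"
        using upper_finite[OF E] by (intro card_mono) auto
      also have "\<dots> \<le> Suc (card (upper E (\<lambda>_. 0) 0 x))" by (rule card_insert_le_m1) auto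
      finally show ?thesis using True by (simp add: N_def)
    next
      case False
      then have "upper ?E (\<lambda>_. 0) 0 x = upper E (\<lambda>_. 0) 0 x" by (auto simp: upper_def doubleton_eq_iff)
      then show ?thesis by (simp add: N_def)
    qed
    then have "4 * int (T + 1) * int (N ?E (\<lambda>_. 0) 0 x) \<le> 4 * int (T + 1) * int (N E (\<lambda>_. 0) 0 x + (if x \<in> {u, v} then 1 else 0))"
      by (intro mult_left_mono of_nat_mono) auto
    also have "\<dots> = 4 * int (T + 1) * int (N E (\<lambda>_. 0) 0 x) + (if x \<in> {u, v} then 4 * int (T + 1) else 0)"
      by (simp add: distrib_left)
    finally show ?thesis using 1 unfolding pot1_def by linarith
  qed
  then have "pot ?E l \<le> (\<Sum>x<n. pot1 E l x + (if x \<in> {u, v} then 4 * int (T + 1) else 0))"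
    unfolding pot_def by (intro sum_mono)
  also have "\<dots> = pot E l + (\<Sum>x<n. if x \<in> {u, v} then 4 * int (T + 1) else 0)"
    by (simp add: sum.distrib pot_def)
  also have "(\<Sum>x<n. if x \<in> {u, v} then 4 * int (T + 1) else 0) = 8 * int (T + 1)"
  proof -
    have "(\<Sum>x<n. if x \<in> {u, v} then 4 * int (T + 1) else 0) = (\<Sum>x\<in>{..<n} \<inter> {u, v}. 4 * int (T + 1))"
      by (rule sum.inter_restrict[symmetric]) simp
    also have "{..<n} \<inter> {u, v} = {u, v}" using uv by auto
    finally show ?thesis using uv by simp
  qed
  finally show ?thesis .
qed

text \<open>Each endpoint loses one neighbour on at most \<open>T\<close> levels, each time at the
  price of \<open>cred_pred\<close>, and the leading term does not grow.\<close>

lemma pot_delete: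
  assumes E: "simple_edges n E" and uv: "{u, v} \<in> E" and l: "\<And>u. u < n \<Longrightarrow> l u \<le> T"
  shows "pot (E - {{u, v}}) l \<le> pot E l + 2 * int T * int (M * B + 4)"
proof -
  let ?E = "E - {{u, v}}"
  let ?m = "int (M * B + 4)"
  have E': "simple_edges n ?E" using E by (simp add: simple_edges_def)
  have uv': "u < n" "v < n" "u \<noteq> v" using simple_edgesD[OF E uv] by auto
  have "pot1 ?E l x \<le> pot1 E l x + (if x \<in> {u, v} then int T * ?m else 0)" if "x < n" for x
  proof (cases "x \<in> {u, v}")
    case True
    have "N E l j x - 1 \<le> N ?E l j x" for j
    proof -
      define y where "y = (if x = u then v else u)"
      have "upper E l j x - {y} \<subseteq> upper ?E l j x"
        using True by (auto simp: upper_def doubleton_eq_iff y_def split: if_splits)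
      then have "card (upper E l j x - {y}) \<le> card (upper ?E l j x)"
        using upper_finite[OF E'] by (intro card_mono)
      moreover have "card (upper E l j x) - 1 \<le> card (upper E l j x - {y})"
        by (cases "y \<in> upper E l j x") (auto simp: card_Diff_singleton_if)
      ultimately show ?thesis by (simp add: N_def)
    qed
    then have "(\<Sum>j<l x. cred j (N ?E l j x)) \<le> (\<Sum>j<l x. cred j (N E l j x) + ?m)"
      by (intro sum_mono) (rule order_trans[OF cred_antimono cred_pred])
    also have "\<dots> = (\<Sum>j<l x. cred j (N E l j x)) + int (l x) * ?m" by (simp add: sum.distrib)
    also have "int (l x) * ?m \<le> int T * ?m" using l[OF \<open>x < n\<close>] by (intro mult_right_mono) auto
    finally have 1: "(\<Sum>j<l x. cred j (N ?E l j x)) \<le> (\<Sum>j<l x. cred j (N E l j x)) + int T * ?m" by simp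
    have "upper ?E (\<lambda>_. 0) 0 x \<subseteq> upper E (\<lambda>_. 0) 0 x" by (auto simp: upper_def)
    then have "N ?E (\<lambda>_. 0) 0 x \<le> N E (\<lambda>_. 0) 0 x" unfolding N_def by (rule card_mono[OF upper_finite[OF E]])
    then have "4 * int (T + 1) * int (N ?E (\<lambda>_. 0) 0 x) \<le> 4 * int (T + 1) * int (N E (\<lambda>_. 0) 0 x)"
      by (intro mult_left_mono of_nat_mono) auto
    then show ?thesis using 1 True unfolding pot1_def by (simp only: if_True)
  next
    case False
    then have "upper ?E k j x = upper E k j x" for k j by (auto simp: upper_def doubleton_eq_iff)
    then show ?thesis using False by (simp add: pot1_def N_def)
  qed
  then have "pot ?E l \<le> (\<Sum>x<n. pot1 E l x + (if x \<in> {u, v} then int T * ?m else 0))"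
    unfolding pot_def by (intro sum_mono) auto
  also have "\<dots> = pot E l + (\<Sum>x<n. if x \<in> {u, v} then int T * ?m else 0)"
    by (simp add: sum.distrib pot_def)
  also have "(\<Sum>x<n. if x \<in> {u, v} then int T * ?m else 0) = 2 * int T * ?m"
  proof -
    have "(\<Sum>x<n. if x \<in> {u, v} then int T * ?m else 0) = (\<Sum>x\<in>{..<n} \<inter> {u, v}. int T * ?m)"
      by (rule sum.inter_restrict[symmetric]) simp
    also have "{..<n} \<inter> {u, v} = {u, v}" using uv' by auto
    finally show ?thesis using uv' by simp
  qed
  finally show ?thesis .
qed

end

section \<open>The dynamic algorithm\<close>

text \<open>Array 0 holds the levels, array 1 the row sizes, array 2 the number of vertices per
  level, array 3 the thresholds. An arc \<open>(u, v)\<close> labelled \<open>j\<close> is stored as the entry \<open>v\<close> of row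
  \<open>u (T + 2) + j\<close>; label \<open>T + 1\<close> is used temporarily. The last row holds the vertices
  still to be examined. Variables: 2 is \<open>n\<close>, 3 is \<open>T\<close>, 4 is \<open>M\<close>, 5 is \<open>2 ^ b\<close>, 6 is \<open>R\<close>,
  7 is \<open>R * 2 ^ b\<close>, 8 is \<open>T + 2\<close>, 9 is the number of edges, 10 is the highest level, 15 is \<open>T + 1\<close>.\<close>

definition add_arc :: "nat \<Rightarrow> nat \<Rightarrow> nat \<Rightarrow> com" where
  "add_arc kx ky kj = (40 :=\<^sub>v (Var kx \<otimes> Var 8 \<oplus> Var kj) ;; 41 :=\<^sub>v Var ky ;; t_insert ;;
     Store (Addr 1 (Var 40)) (Arr 1 (Var 40) \<oplus> Lit 1))"

definition del_arc :: "nat \<Rightarrow> nat \<Rightarrow> nat \<Rightarrow> com" where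
  "del_arc kx ky kj = (40 :=\<^sub>v (Var kx \<otimes> Var 8 \<oplus> Var kj) ;; 41 :=\<^sub>v Var ky ;; t_delete ;;
     Store (Addr 1 (Var 40)) (Arr 1 (Var 40) \<ominus> Lit 1))"

definition relabel :: "nat \<Rightarrow> nat \<Rightarrow> nat \<Rightarrow> nat \<Rightarrow> com" where
  "relabel kx ky kj kj' = (del_arc kx ky kj ;; add_arc kx ky kj')"

definition mark :: "nat \<Rightarrow> com" where
  "mark kx = (40 :=\<^sub>v (Var 6 \<ominus> Lit 1) ;; 41 :=\<^sub>v Var kx ;; t_insert)"

definition unmark :: "nat \<Rightarrow> com" where
  "unmark kx = (40 :=\<^sub>v (Var 6 \<ominus> Lit 1) ;; 41 :=\<^sub>v Var kx ;; t_delete)"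

text \<open>\<open>mcap\<close> bounds the edges during one operation. An edge contributes two arcs
  and a vertex at most one mark; the 3 leaves room for two more arcs and for the key being inserted.
  The bound \<open>word\<close> dominates the products evaluated in \<open>choose_level\<close> and
  in the query.\<close>

locale algorithm = params n B b + trie_machine w P W R b for n B b w P W R +
  fixes mcap :: nat
  assumes R_eq: "R = n * (T + 2) + 1"
    and cap: "R + b * (2 * mcap + n + 3) \<le> P"
    and word: "12 * B * B * thr M T < W"
begin

section \<open>The graph in memory\<close>

definition row :: "nat \<Rightarrow> nat \<Rightarrow> nat" where
  "row u j = u * (T + 2) + j"

lemma row_less:
  assumes "u < n" "j < T + 2"
  shows "row u j < R - Suc 0" "row u j < R" "row u j < P" "row u j < W"
proof -
  have "row u j < (u + 1) * (T + 2)" using assms by (simp add: row_def)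
  also have "\<dots> \<le> n * (T + 2)" using assms by (intro mult_le_mono1) simp
  finally show "row u j < R - Suc 0" by (simp add: R_eq)
  then show "row u j < R" "row u j < P" "row u j < W" using R_le P_le by linarith+
qed

lemma row_inject:
  assumes "j < T + 2" "j' < T + 2"
  shows "row u j = row u' j' \<longleftrightarrow> u = u' \<and> j = j'"
proof -
  have "row u j div (T + 2) = u" "row u j mod (T + 2) = j" if "j < T + 2" for u j
    using that by (simp_all add: row_def del: mult_Suc_right add_2_eq_Suc')
  then show ?thesis using assms by metis
qed

lemma index_bounds: "u < n \<Longrightarrow> u < R" "u < n \<Longrightarrow> u < P" "j \<le> T \<Longrightarrow> j < R" "j \<le> T \<Longrightarrow> j < P"
proof -
  have "n * 1 \<le> n * (T + 2)" "1 * (T + 2) \<le> n * (T + 2)" using n_pos by (intro mult_le_mono; simp)+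
  then show "u < n \<Longrightarrow> u < R" "j \<le> T \<Longrightarrow> j < R" by (simp_all add: R_eq)
  then show "u < n \<Longrightarrow> u < P" "j \<le> T \<Longrightarrow> j < P" using R_le by simp_all
qed

definition keys :: "(nat \<times> nat) set \<Rightarrow> (nat \<times> nat \<Rightarrow> nat) \<Rightarrow> nat set \<Rightarrow> (nat \<times> nat) set" where
  "keys A lab D = (\<lambda>(u, v). (row u (lab (u, v)), v)) ` A \<union> (\<lambda>v. (R - Suc 0, v)) ` D"

text \<open>The label of an arc is an arbitrary function rather than the minimum of two levels. So
  the states in the middle of a move, when the arcs are relabelled one by one, are covered too.
  \<open>D\<close> is the set of marked vertices.\<close>

definition repr :: "memory \<Rightarrow> (nat \<times> nat) set \<Rightarrow> (nat \<times> nat \<Rightarrow> nat) \<Rightarrow> nat set \<Rightarrow> (nat \<Rightarrow> nat) \<Rightarrow> bool" where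
  "repr s A lab D l \<longleftrightarrow>
     s 2 = n \<and> s 3 = T \<and> s 4 = M \<and> s 8 = T + 2 \<and> s 15 = T + 1 \<and>
     A \<subseteq> {..<n} \<times> {..<n} \<and> D \<subseteq> {..<n} \<and> (\<forall>a\<in>A. lab a < T + 2) \<and> (\<forall>u<n. l u \<le> T) \<and>
     trie s (keys A lab D) \<and>
     (\<forall>u<n. s (cell 0 u) = l u) \<and>
     (\<forall>u<n. \<forall>j<T + 2. s (cell 1 (row u j)) = card {v. (u, v) \<in> A \<and> lab (u, v) = j}) \<and>
     (\<forall>j\<le>T. s (cell 2 j) = card {u. u < n \<and> l u = j}) \<and>
     (\<forall>j\<le>T. s (cell 3 j) = thr M j)"

lemma reprD:
  assumes "repr s A lab D l"
  shows "s 2 = n" "s 3 = T" "s 4 = M" "s 8 = T + 2" "s 15 = T + 1" "A \<subseteq> {..<n} \<times> {..<n}" "D \<subseteq> {..<n}"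
    "\<And>a. a \<in> A \<Longrightarrow> lab a < T + 2" "\<And>u. u < n \<Longrightarrow> l u \<le> T" "trie s (keys A lab D)"
    "\<And>u. u < n \<Longrightarrow> s (cell 0 u) = l u"
    "\<And>u j. u < n \<Longrightarrow> j < T + 2 \<Longrightarrow> s (cell 1 (row u j)) = card {v. (u, v) \<in> A \<and> lab (u, v) = j}"
    "\<And>j. j \<le> T \<Longrightarrow> s (cell 2 j) = card {u. u < n \<and> l u = j}"
    "\<And>j. j \<le> T \<Longrightarrow> s (cell 3 j) = thr M j"
    "s 5 = 2 ^ b" "s 6 = R" "s 7 = R * 2 ^ b"
  using assms unfolding repr_def by (blast | simp add: trie_def nodes_def)+

lemma repr_cong:
  assumes "\<And>a. a \<in> A \<Longrightarrow> lab a = lab' a"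
  shows "repr s A lab D l \<longleftrightarrow> repr s A lab' D l"
proof -
  have 1: "keys A lab D = keys A lab' D"
    unfolding keys_def using assms by (intro arg_cong2[where f = "(\<union>)"] image_cong refl) auto
  have 2: "{v. (u, v) \<in> A \<and> lab (u, v) = j} = {v. (u, v) \<in> A \<and> lab' (u, v) = j}" for u j
    using assms by auto
  have 3: "(\<forall>a\<in>A. lab a < T + 2) \<longleftrightarrow> (\<forall>a\<in>A. lab' a < T + 2)" using assms by auto
  show ?thesis unfolding repr_def 1 2 3 ..
qed

lemma trie_header_update:
  "a < 64 \<Longrightarrow> a \<notin> {5, 6, 7, 51} \<Longrightarrow> trie (s(a := x)) K \<longleftrightarrow> trie s K"
  by (simp add: trie_def nodes_def leaves_def)

lemma trie_field_update:
  assumes "trie s K" "f < 4" "k < R"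
  shows "trie (s(cell f k := x)) K"
  using assms trie_roots_le[OF assms(1)] by (simp add: trie_def nodes_def leaves_def)

lemma repr_header_update [simp]:
  "a < 64 \<Longrightarrow> a \<notin> {2, 3, 4, 5, 6, 7, 8, 15, 51} \<Longrightarrow> repr (s(a := x)) A lab D l \<longleftrightarrow> repr s A lab D l"
  by (simp add: repr_def trie_header_update)

lemma finite_arcs: "repr s A lab D l \<Longrightarrow> finite A" "repr s A lab D l \<Longrightarrow> finite D"
  using finite_subset[OF reprD(6)] finite_subset[OF reprD(7)] by blast+

lemma card_keys:
  assumes "repr s A lab D l"
  shows "card (keys A lab D) \<le> card A + n"
proof -
  have "card (keys A lab D) \<le> card ((\<lambda>(u, v). (row u (lab (u, v)), v)) ` A) + card ((\<lambda>v. (R - Suc 0, v)) ` D)"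
    unfolding keys_def by (rule card_Un_le)
  also have "\<dots> \<le> card A + card D"
    using finite_arcs[OF assms] by (intro add_mono card_image_le)
  also have "card D \<le> card {..<n}" using reprD(7)[OF assms] by (intro card_mono) auto
  finally show ?thesis by simp
qed

lemma capacity:
  assumes "repr s A lab D l" "card A \<le> 2 * mcap + 2"
  shows "s 51 \<le> P" "R + b * (card (keys A lab D) + 1) \<le> P"
proof -
  have "b * (card (keys A lab D) + 1) \<le> b * (2 * mcap + n + 3)"
    using card_keys[OF assms(1)] assms(2) by (intro mult_le_mono2) simp
  then show "R + b * (card (keys A lab D) + 1) \<le> P" using cap by simp
  then show "s 51 \<le> P" using trie_nodes_le[OF reprD(10)[OF assms(1)]] by (simp add: algebra_simps)
qed

lemma repr_trie_frame:
  assumes "repr s A lab D l" "trie_frame s s'" "trie s' (keys A' lab' D')"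
    "A' \<subseteq> {..<n} \<times> {..<n}" "D' \<subseteq> {..<n}" "\<And>a. a \<in> A' \<Longrightarrow> lab' a < T + 2"
    "\<And>u j. u < n \<Longrightarrow> j < T + 2 \<Longrightarrow> card {v. (u, v) \<in> A' \<and> lab' (u, v) = j} = card {v. (u, v) \<in> A \<and> lab (u, v) = j}"
  shows "repr s' A' lab' D' l"
  using assms unfolding repr_def by (simp add: trie_frame_var trie_frame_field)

text \<open>Between the trie operation and the update of the row size \<open>repr\<close> fails, so
  both steps are bridged together.\<close>

lemma repr_row_update:
  assumes r: "repr s A lab D l" and s': "trie_frame s s'" "trie s' (keys A' lab' D)"
    and A': "A' \<subseteq> {..<n} \<times> {..<n}" "\<And>a. a \<in> A' \<Longrightarrow> lab' a < T + 2"
    and x: "x < n" "j < T + 2"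
    and eq: "\<And>u j'. (u, j') \<noteq> (x, j) \<Longrightarrow>
      card {v. (u, v) \<in> A' \<and> lab' (u, v) = j'} = card {v. (u, v) \<in> A \<and> lab (u, v) = j'}"
    and c: "c = card {v. (x, v) \<in> A' \<and> lab' (x, v) = j}"
  shows "repr (s'(cell 1 (row x j) := c)) A' lab' D l"
  unfolding repr_def
proof (intro conjI allI impI)
  let ?s = "s'(cell 1 (row x j) := c)"
  show "trie ?s (keys A' lab' D)"
    using trie_field_update[OF s'(2), of 1 "row x j"] row_less(2)[OF x] by simp
  fix u j' assume u: "u < n" "j' < T + 2"
  have cells: "cell 1 (row u j') = cell 1 (row x j) \<longleftrightarrow> (u, j') = (x, j)"
    using row_inject[OF u(2) x(2)] by (simp add: cell_inject)
  show "?s (cell 1 (row u j')) = card {v. (u, v) \<in> A' \<and> lab' (u, v) = j'}"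
  proof (cases "(u, j') = (x, j)")
    case True
    then show ?thesis using c by simp
  next
    case False
    then have "?s (cell 1 (row u j')) = s' (cell 1 (row u j'))"
      unfolding fun_upd_apply cells by (simp only: if_False)
    then show ?thesis
      using eq[OF False] reprD(12)[OF r u] trie_frame_field[OF s'(1), of 1 "row u j'"] by simp
  qed
qed (use r A' in \<open>simp_all add: repr_def trie_frame_var[OF s'(1)] trie_frame_field[OF s'(1)] cell_inject\<close>)

lemma row_entry:
  assumes r: "repr s A lab D l" and u: "u < n" "j < T + 2"
  shows "(row u j, v) \<in> keys A lab D \<longleftrightarrow> (u, v) \<in> A \<and> lab (u, v) = j"
proof
  assume "(row u j, v) \<in> keys A lab D"
  then obtain u' where *: "(u', v) \<in> A" "row u j = row u' (lab (u', v))"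
    using row_less(1)[OF u] by (auto simp: keys_def)
  then show "(u, v) \<in> A \<and> lab (u, v) = j"
    using row_inject[OF u(2) reprD(8)[OF r *(1)]] by simp
next
  assume "(u, v) \<in> A \<and> lab (u, v) = j"
  then show "(row u j, v) \<in> keys A lab D"
    unfolding keys_def by (intro UnI1 image_eqI[of _ _ "(u, v)"]) simp_all
qed

text \<open>Labels stay below \<open>T + 2\<close>, so no row of a vertex reaches the index
  \<open>R - 1\<close> of the marks.\<close>

lemma mark_entry:
  assumes r: "repr s A lab D l"
  shows "(R - Suc 0, v) \<in> keys A lab D \<longleftrightarrow> v \<in> D"
proof -
  have "row u (lab (u, v)) \<noteq> R - Suc 0" if "(u, v) \<in> A" for u v
    using row_less(1)[of u "lab (u, v)"] reprD(6)[OF r] reprD(8)[OF r that] that by auto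
  then show ?thesis unfolding keys_def by (auto dest: sym)
qed

lemma var_bounds: "k < 40 \<Longrightarrow> k < S" "k < 40 \<Longrightarrow> k < W" "k < 40 \<Longrightarrow> k \<noteq> 40 \<and> 40 \<noteq> k \<and> k \<noteq> 41 \<and> 41 \<noteq> k"
  using W_ge by (simp_all add: S_def)

lemma vertex_less: "v < n \<Longrightarrow> v < 2 ^ b"
  using n_le by simp

lemma mark_spec:
  assumes r: "repr s A lab D l" "card A \<le> 2 * mcap + 2" and x: "kx < 40" "s kx = x" "x < n"
    and Q: "\<And>t s'. repr s' A lab (insert x D) l \<Longrightarrow> (\<forall>a<40. s' a = s a) \<Longrightarrow> t \<le> 200 * (b + 1) \<Longrightarrow> Q t s'"
  shows "wp (mark kx) Q s"
proof -
  note [simp] = ok_Var cell_less var_bounds[OF x(1)]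
  let ?s = "s(40 := R - Suc 0, 41 := x)"
  have s: "repr ?s A lab D l" using r by simp
  have 1: "insert (R - Suc 0, x) (keys A lab D) = keys A lab (insert x D)" by (auto simp: keys_def)
  have [simp]: "s 6 = R" using reprD(16)[OF r(1)] .
  have ins: "wp t_insert Q' ?s" if Q': "\<And>t s'. repr s' A lab (insert x D) l \<Longrightarrow> (\<forall>a<40. s' a = s a) \<Longrightarrow>
      t \<le> 150 * (b + 1) \<Longrightarrow> Q' t s'" for Q'
  proof (rule t_insert_spec[OF reprD(10)[OF s], of "R - Suc 0" x], goal_cases)
    case (6 t s')
    have "repr s' A lab (insert x D) l"
      using repr_trie_frame[OF s 6(2) 6(1)[unfolded 1]] reprD(6,7,8)[OF r(1)] x(3) by simp
    then show ?case using 6(2,3) by (intro Q') (auto simp: trie_frame_def)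
  qed (use R_pos x capacity(2)[OF s r(2)] vertex_less in auto)
  show ?thesis
    unfolding mark_def
    apply (rule wp_steps; (simp add: x)?)+
    apply (rule ins)
    apply (rule Q)
      apply auto
    done
qed

lemma unmark_spec:
  assumes r: "repr s A lab D l" "card A \<le> 2 * mcap + 2" and x: "kx < 40" "s kx = x" "x \<in> D"
    and Q: "\<And>t s'. repr s' A lab (D - {x}) l \<Longrightarrow> (\<forall>a<40. s' a = s a) \<Longrightarrow> t \<le> 550 * (b + 1) \<Longrightarrow> Q t s'"
  shows "wp (unmark kx) Q s"
proof -
  note [simp] = ok_Var cell_less var_bounds[OF x(1)]
  let ?s = "s(40 := R - Suc 0, 41 := x)"
  have s: "repr ?s A lab D l" using r by simp
  have 1: "keys A lab D - {(R - Suc 0, x)} = keys A lab (D - {x})"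
  proof -
    have "(R - Suc 0, x) \<notin> keys A lab (D - {x})"
    proof
      assume "(R - Suc 0, x) \<in> keys A lab (D - {x})"
      then obtain u v where "(u, v) \<in> A" "R - Suc 0 = row u (lab (u, v))" by (auto simp: keys_def)
      then show False
        using row_less(1)[of u "lab (u, v)"] reprD(6)[OF r(1)] reprD(8)[OF r(1)] by fastforce
    qed
    then show ?thesis by (auto simp: keys_def)
  qed
  have [simp]: "s 6 = R" using reprD(16)[OF r(1)] .
  have del: "wp t_delete Q' ?s" if Q': "\<And>t s'. repr s' A lab (D - {x}) l \<Longrightarrow> (\<forall>a<40. s' a = s a) \<Longrightarrow>
      t \<le> 500 * (b + 1) \<Longrightarrow> Q' t s'" for Q'
  proof (rule t_delete_spec[OF reprD(10)[OF s], of "R - Suc 0" x], goal_cases)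
    case (5 t s')
    have "repr s' A lab (D - {x}) l"
      using repr_trie_frame[OF s 5(2) 5(1)[unfolded 1]] reprD(6,7,8)[OF r(1)] by auto
    then show ?case using 5(2,3) by (intro Q') (auto simp: trie_frame_def)
  qed (use x capacity(1)[OF r] mark_entry[OF r(1)] in auto)
  show ?thesis
    unfolding unmark_def
    apply (rule wp_steps; (simp add: x)?)+
    apply (rule del)
    apply (rule Q)
      apply auto
    done
qed

lemma row_sizes_insert:
  assumes "finite A" "(x, y) \<notin> A"
  shows "card {v. (u, v) \<in> insert (x, y) A \<and> (lab((x, y) := j)) (u, v) = j'} =
    card {v. (u, v) \<in> A \<and> lab (u, v) = j'} + (if u = x \<and> j' = j then 1 else 0)"
proof -
  have "finite {v. (u, v) \<in> A \<and> lab (u, v) = j'}"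
    by (rule finite_subset[OF _ finite_imageI[OF assms(1), of snd]]) force
  moreover have "{v. (u, v) \<in> insert (x, y) A \<and> (lab((x, y) := j)) (u, v) = j'} =
      (if u = x \<and> j' = j then insert y {v. (u, v) \<in> A \<and> lab (u, v) = j'} else {v. (u, v) \<in> A \<and> lab (u, v) = j'})"
    using assms(2) by auto
  ultimately show ?thesis using assms(2) by auto
qed

lemma row_sizes_delete:
  assumes "finite A" "(x, y) \<in> A" "lab (x, y) = j"
  shows "card {v. (u, v) \<in> A - {(x, y)} \<and> lab (u, v) = j'} =
    card {v. (u, v) \<in> A \<and> lab (u, v) = j'} - (if u = x \<and> j' = j then 1 else 0)"
proof -
  have "{v. (u, v) \<in> A - {(x, y)} \<and> lab (u, v) = j'} =
      (if u = x \<and> j' = j then {v. (u, v) \<in> A \<and> lab (u, v) = j'} - {y} else {v. (u, v) \<in> A \<and> lab (u, v) = j'})"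
    using assms(3) by auto
  then show ?thesis using assms(2,3) by (simp add: card_Diff_singleton_if)
qed

lemma add_arc_spec:
  assumes r: "repr s A lab D l" "card A \<le> 2 * mcap + 1"
    and k: "kx < 40" "ky < 40" "kj < 40" "s kx = x" "s ky = y" "s kj = j"
    and x: "x < n" "y < n" "j < T + 2" "(x, y) \<notin> A"
    and Q: "\<And>t s'. repr s' (insert (x, y) A) (lab((x, y) := j)) D l \<Longrightarrow> (\<forall>a<40. s' a = s a) \<Longrightarrow>
      t \<le> 250 * (b + 1) \<Longrightarrow> Q t s'"
  shows "wp (add_arc kx ky kj) Q s"
proof -
  let ?A = "insert (x, y) A"
  let ?lab = "lab((x, y) := j)"
  let ?s = "s(40 := row x j, 41 := y)"
  have s: "repr ?s A lab D l" using r by simp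
  have cA: "card A \<le> 2 * mcap + 2" using r(2) by simp
  have "(\<lambda>(u, v). (row u (?lab (u, v)), v)) ` A = (\<lambda>(u, v). (row u (lab (u, v)), v)) ` A"
    using x(4) by (intro image_cong refl) auto
  then have 1: "insert (row x j, y) (keys A lab D) = keys ?A ?lab D"
    by (simp add: keys_def)
  note [simp] = ok_Var cell_less var_bounds[OF k(1)] var_bounds[OF k(2)] var_bounds[OF k(3)]
  define wd where "wd = T + 2"
  have [simp]: "s 8 = wd" "s kx = x" "s ky = y" "s kj = j" using reprD(4)[OF r(1)] k by (auto simp: wd_def)
  have [simp]: "x * wd < W" "x * wd + j = row x j" "row x j < P" "row x j < W"
    using row_less[OF x(1,3)] by (auto simp: row_def wd_def)
  have rows: "card {v. (u, v) \<in> ?A \<and> ?lab (u, v) = j'} =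
      card {v. (u, v) \<in> A \<and> lab (u, v) = j'} + (if u = x \<and> j' = j then 1 else 0)" for u j'
    using row_sizes_insert[where lab = lab, OF finite_arcs(1)[OF r(1)] x(4)] .
  have A': "?A \<subseteq> {..<n} \<times> {..<n}" "\<And>a. a \<in> ?A \<Longrightarrow> ?lab a < T + 2"
    using reprD(6)[OF r(1)] reprD(8)[OF r(1)] x by auto
  have ins: "wp t_insert Q' ?s" if Q': "\<And>t s'. trie s' (keys ?A ?lab D) \<Longrightarrow> trie_frame ?s s' \<Longrightarrow>
      t \<le> 150 * (b + 1) \<Longrightarrow> Q' t s'" for Q'
  proof (rule t_insert_spec[OF reprD(10)[OF s], of "row x j" y], goal_cases)
    case (6 t s')
    then show ?case by (intro Q') (simp_all add: 1)
  qed (use row_less[OF x(1,3)] capacity(2)[OF s cA] vertex_less x in auto)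
  have store: "wp (Store (Addr (Suc 0) (Var 40)) (Arr (Suc 0) (Var 40) \<oplus> Lit (Suc 0))) Q' s'"
    if s': "trie s' (keys ?A ?lab D)" "trie_frame ?s s'"
      and Q': "\<And>t s''. repr s'' ?A ?lab D l \<Longrightarrow> (\<forall>a<40. s'' a = s a) \<Longrightarrow> t \<le> 30 \<Longrightarrow> Q' t s''"
    for Q' s'
  proof -
    define c where "c = card {v. (x, v) \<in> A \<and> lab (x, v) = j}"
    have [simp]: "s' 40 = row x j" using s'(2) by (simp add: trie_frame_def)
    have [simp]: "s' (cell (Suc 0) (row x j)) = c"
      using trie_frame_field[OF s'(2), of 1 "row x j"] reprD(12)[OF s x(1,3)] by (simp add: c_def)
    have "c \<le> card {..<n}"
      unfolding c_def using reprD(6)[OF r(1)] by (intro card_mono) auto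
    then have [simp]: "Suc c < W" using P_le index_bounds(2)[of "n - 1"] n_pos by simp
    have "repr (s'(cell 1 (row x j) := Suc c)) ?A ?lab D l"
    proof (rule repr_row_update[OF s s'(2,1) A' x(1,3)])
      show "Suc c = card {v. (x, v) \<in> ?A \<and> ?lab (x, v) = j}" unfolding rows c_def by simp
    qed (unfold rows, auto)
    then have fin: "repr (s'(cell (Suc 0) (row x j) := Suc c)) ?A ?lab D l" by simp
    show ?thesis
      apply (rule wp_steps; simp?)+
      apply (rule Q'[OF fin])
      using s' by (auto simp: trie_frame_def)
  qed
  show ?thesis
    unfolding add_arc_def
    apply (rule wp_steps; simp?)+
    apply (rule wp_Seq, rule ins)
    apply (rule store, assumption, assumption)
    apply (rule Q, assumption, assumption)
    apply simp
    done
qed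

lemma del_arc_spec:
  assumes r: "repr s A lab D l" "card A \<le> 2 * mcap + 2"
    and k: "kx < 40" "ky < 40" "kj < 40" "s kx = x" "s ky = y" "s kj = j"
    and x: "(x, y) \<in> A" "lab (x, y) = j"
    and Q: "\<And>t s'. repr s' (A - {(x, y)}) lab D l \<Longrightarrow> (\<forall>a<40. s' a = s a) \<Longrightarrow>
      t \<le> 600 * (b + 1) \<Longrightarrow> Q t s'"
  shows "wp (del_arc kx ky kj) Q s"
proof -
  let ?A = "A - {(x, y)}"
  let ?s = "s(40 := row x j, 41 := y)"
  have s: "repr ?s A lab D l" using r by simp
  have x': "x < n" "j < T + 2" using x reprD(6)[OF r(1)] reprD(8)[OF r(1) x(1)] by auto
  have 1: "keys A lab D - {(row x j, y)} = keys ?A lab D"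
  proof -
    have "(row x j, y) \<notin> keys ?A lab D"
    proof
      assume "(row x j, y) \<in> keys ?A lab D"
      then obtain u where u: "(u, y) \<in> ?A" "row x j = row u (lab (u, y))"
        using row_less(1)[OF x'] by (auto simp: keys_def)
      then have "lab (u, y) < T + 2" using reprD(8)[OF r(1)] by blast
      then have "x = u" using row_inject[OF x'(2)] u(2) by blast
      then show False using u(1) by simp
    qed
    then show ?thesis using x by (auto simp: keys_def)
  qed
  have mem: "(row x j, y) \<in> keys A lab D" using row_entry[OF r(1) x'] x by simp
  note [simp] = ok_Var cell_less var_bounds[OF k(1)] var_bounds[OF k(2)] var_bounds[OF k(3)]
  define wd where "wd = T + 2"
  have [simp]: "s 8 = wd" "s kx = x" "s ky = y" "s kj = j" using reprD(4)[OF r(1)] k by (auto simp: wd_def)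
  have [simp]: "x * wd < W" "x * wd + j = row x j" "row x j < P" "row x j < W"
    using row_less[OF x'] by (auto simp: row_def wd_def)
  have rows: "card {v. (u, v) \<in> ?A \<and> lab (u, v) = j'} =
      card {v. (u, v) \<in> A \<and> lab (u, v) = j'} - (if u = x \<and> j' = j then 1 else 0)" for u j'
    using row_sizes_delete[where lab = lab, OF finite_arcs(1)[OF r(1)] x] .
  have A': "?A \<subseteq> {..<n} \<times> {..<n}" "\<And>a. a \<in> ?A \<Longrightarrow> lab a < T + 2"
    using reprD(6)[OF r(1)] reprD(8)[OF r(1)] by auto
  have del: "wp t_delete Q' ?s" if Q': "\<And>t s'. trie s' (keys ?A lab D) \<Longrightarrow> trie_frame ?s s' \<Longrightarrow>
      t \<le> 500 * (b + 1) \<Longrightarrow> Q' t s'" for Q'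
  proof (rule t_delete_spec[OF reprD(10)[OF s], of "row x j" y], goal_cases)
    case (5 t s')
    then show ?case by (intro Q') (simp_all add: 1)
  qed (use mem capacity(1)[OF r] in auto)
  have store: "wp (Store (Addr (Suc 0) (Var 40)) (Arr (Suc 0) (Var 40) \<ominus> Lit (Suc 0))) Q' s'"
    if s': "trie s' (keys ?A lab D)" "trie_frame ?s s'"
      and Q': "\<And>t s''. repr s'' ?A lab D l \<Longrightarrow> (\<forall>a<40. s'' a = s a) \<Longrightarrow> t \<le> 30 \<Longrightarrow> Q' t s''"
    for Q' s'
  proof -
    define c where "c = card {v. (x, v) \<in> A \<and> lab (x, v) = j}"
    have [simp]: "s' 40 = row x j" using s'(2) by (simp add: trie_frame_def)
    have [simp]: "s' (cell (Suc 0) (row x j)) = c"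
      using trie_frame_field[OF s'(2), of 1 "row x j"] reprD(12)[OF s x'] by (simp add: c_def)
    have "repr (s'(cell 1 (row x j) := c - 1)) ?A lab D l"
    proof (rule repr_row_update[OF s s'(2,1) A' x'])
      show "c - 1 = card {v. (x, v) \<in> ?A \<and> lab (x, v) = j}" unfolding rows c_def by simp
    qed (unfold rows, auto)
    then have fin: "repr (s'(cell (Suc 0) (row x j) := c - Suc 0)) ?A lab D l" by simp
    show ?thesis
      apply (rule wp_steps; simp?)+
      apply (rule Q'[OF fin])
      using s' by (auto simp: trie_frame_def)
  qed
  show ?thesis
    unfolding del_arc_def
    apply (rule wp_steps; simp?)+
    apply (rule wp_Seq, rule del)
    apply (rule store, assumption, assumption)
    apply (rule Q, assumption, assumption)
    apply simp
    done
qed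

text \<open>Deleting the arc before inserting it again keeps the pool within its capacity.\<close>

lemma relabel_spec:
  assumes r: "repr s A lab D l" "card A \<le> 2 * mcap + 2"
    and k: "kx < 40" "ky < 40" "kj < 40" "kj' < 40" "s kx = x" "s ky = y" "s kj = j" "s kj' = j'"
    and x: "(x, y) \<in> A" "lab (x, y) = j" "j' < T + 2"
    and Q: "\<And>t s'. repr s' A (lab((x, y) := j')) D l \<Longrightarrow> (\<forall>a<40. s' a = s a) \<Longrightarrow>
      t \<le> 850 * (b + 1) \<Longrightarrow> Q t s'"
  shows "wp (relabel kx ky kj kj') Q s"
  unfolding relabel_def
proof (rule wp_Seq, rule del_arc_spec[OF r k(1,2,3,5,6,7) x(1,2)])
  fix t s' assume s': "repr s' (A - {(x, y)}) lab D l" "\<forall>a<40. s' a = s a" "t \<le> 600 * (b + 1)"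
  have "card (A - {(x, y)}) \<le> 2 * mcap + 1" using r(2) x(1) by (simp add: card_Diff_singleton_if)
  moreover have "x < n" "y < n" using x(1) reprD(6)[OF r(1)] by auto
  moreover have "insert (x, y) (A - {(x, y)}) = A" using x(1) by auto
  ultimately show "wp (add_arc kx ky kj') (\<lambda>t'. Q (t + t')) s'"
    using s'(2,3) k x(3)
    by (intro add_arc_spec[OF s'(1), where x = x and y = y and j = j'] Q) auto
qed

end

section \<open>Moving a vertex to an adjacent level\<close>

definition pick :: "nat \<Rightarrow> nat \<Rightarrow> com" where
  "pick kx kj = (40 :=\<^sub>v (Var kx \<otimes> Var 8 \<oplus> Var kj) ;; t_min ;; 14 :=\<^sub>v Var 41)"

definition row_index :: "nat \<Rightarrow> nat \<Rightarrow> expr" where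
  "row_index kx kj = Var kx \<otimes> Var 8 \<oplus> Var kj"

text \<open>Vertex \<open>u\<close> (variable 11) moves from level \<open>i\<close> (variable 12) to an adjacent level \<open>i'\<close>
  (variable 13).\<close>

definition move_step :: com where
  "move_step = (pick 11 12 ;;
     Cond (Arr 0 (Var 14) \<lless> Var 13) (relabel 11 14 12 15)
       (relabel 11 14 12 13 ;; relabel 14 11 12 13 ;; mark 14))"

text \<open>After a rise from \<open>i\<close>, the arcs from \<open>u\<close> to neighbours on
  level \<open>i\<close> keep the label \<open>i\<close>, but the first loop of \<open>move\<close>
  empties exactly this row. They are parked under the label \<open>T + 1\<close> meanwhile, and this
  step returns one of them.\<close>

definition back_step :: com where
  "back_step = (pick 11 15 ;; relabel 11 14 15 12)"

definition move :: com where
  "move = (Loop (row_test (row_index 11 12)) move_step ;; Loop (row_test (row_index 11 15)) back_step ;;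
     Store (Addr 2 (Var 12)) (Arr 2 (Var 12) \<ominus> Lit 1) ;;
     Store (Addr 2 (Var 13)) (Arr 2 (Var 13) \<oplus> Lit 1) ;;
     Store (Addr 0 (Var 11)) (Var 13))"

definition arcs :: "nat set set \<Rightarrow> (nat \<times> nat) set" where
  "arcs E = {(x, y). {x, y} \<in> E}"

definition min_level :: "(nat \<Rightarrow> nat) \<Rightarrow> nat \<times> nat \<Rightarrow> nat" where
  "min_level l = (\<lambda>(x, y). min (l x) (l y))"

context algorithm begin

lemma row_test_repr:
  assumes r: "repr s A lab D l" "card A \<le> 2 * mcap + 2"
    and k: "kx < 40" "kj < 40" "s kx = x" "s kj = j" and x: "x < n" "j < T + 2"
  shows "ok s (row_test (row_index kx kj))"
    "val s (row_test (row_index kx kj)) \<noteq> 0 \<longleftrightarrow> (\<exists>v. (x, v) \<in> A \<and> lab (x, v) = j)"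
proof -
  have 1: "x * (T + 2) < W" "x * (T + 2) + j < W" "x * (T + 2) + j = row x j"
    using row_less[OF x] by (auto simp: row_def)
  then have "ok s (row_index kx kj)"
    unfolding row_index_def using k var_bounds reprD(4)[OF r(1)] header_less W_ge
    by (simp only: safe.simps val.simps apply_binop.simps) (simp add: S_def)
  moreover have "val s (row_index kx kj) = row x j"
    using k reprD(4)[OF r(1)] by (simp add: row_index_def row_def)
  ultimately show "ok s (row_test (row_index kx kj))"
    "val s (row_test (row_index kx kj)) \<noteq> 0 \<longleftrightarrow> (\<exists>v. (x, v) \<in> A \<and> lab (x, v) = j)"
    using row_test[OF reprD(10)[OF r(1)] capacity(1)[OF r], of "row_index kx kj" "row x j"] row_less(2)[OF x]
      row_entry[OF r(1) x] by simp_all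
qed

lemma pick_spec:
  assumes r: "repr s A lab D l" "card A \<le> 2 * mcap + 2"
    and k: "kx < 40" "kj < 40" "s kx = x" "s kj = j" and x: "x < n" "j < T + 2"
    and ne: "\<exists>v. (x, v) \<in> A \<and> lab (x, v) = j"
    and Q: "\<And>t s' v. (x, v) \<in> A \<Longrightarrow> lab (x, v) = j \<Longrightarrow> repr s' A lab D l \<Longrightarrow> s' 14 = v \<Longrightarrow>
      (\<forall>a<40. a \<noteq> 14 \<longrightarrow> s' a = s a) \<Longrightarrow> t \<le> 120 * (b + 1) \<Longrightarrow> Q t s'"
  shows "wp (pick kx kj) Q s"
proof -
  let ?s = "s(40 := row x j)"
  have s: "repr ?s A lab D l" using r by simp
  note [simp] = ok_Var cell_less var_bounds[OF k(1)] var_bounds[OF k(2)]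
  define wd where "wd = T + 2"
  have [simp]: "s 8 = wd" "s kx = x" "s kj = j" using reprD(4)[OF r(1)] k by (auto simp: wd_def)
  have [simp]: "x * wd < W" "x * wd + j = row x j" "row x j < P" "row x j < W"
    using row_less[OF x] by (auto simp: row_def wd_def)
  have min: "wp t_min Q' ?s" if Q': "\<And>t s' v. (x, v) \<in> A \<Longrightarrow> lab (x, v) = j \<Longrightarrow> repr s' A lab D l \<Longrightarrow>
      s' 41 = v \<Longrightarrow> (\<forall>a<40. s' a = s a) \<Longrightarrow> t \<le> 100 * (b + 1) \<Longrightarrow> Q' t s'" for Q'
  proof (rule t_min_spec[OF reprD(10)[OF s], of "row x j"], goal_cases)
    case (5 t s' v)
    have sv: "repr (?s(41 := v)) A lab D l" using r by simp
    have "repr s' A lab D l"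
      using repr_trie_frame[OF sv 5(4,2)] reprD(6,7,8)[OF r(1)] by simp
    then show ?case using 5 row_entry[OF r(1) x] by (intro Q'[of v]) (auto simp: trie_frame_def)
  qed (use row_less[OF x] row_entry[OF r(1) x] ne capacity(1)[OF r] in simp_all)
  show ?thesis
    unfolding pick_def
    apply (rule wp_steps; simp?)+
    apply (rule wp_Seq, rule min)
    apply (rule wp_steps; simp?)+
    apply (rule Q)
    apply auto
    done
qed

context
  fixes E l u i i' mv X
  assumes E: "simple_edges n E" and u: "u < n" "l u = i" "i \<le> T" "i' \<le> T"
    and step: "i' = i + 1 \<or> (0 < i \<and> i' = i - 1)"
    and mc: "card (arcs E) \<le> 2 * mcap + 2"
  defines "X \<equiv> upper E l i u"
begin

text \<open>The labelling when the neighbours in \<open>Z\<close> have been treated by the first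
  loop. Only an arc leaving \<open>u\<close> is parked; the opposite arc keeps its label.\<close>

definition lab1 :: "nat set \<Rightarrow> nat \<times> nat \<Rightarrow> nat" where
  "lab1 Z = (\<lambda>(x, y). if x = u \<and> y \<in> Z then (if l y < i' then T + 1 else i')
     else if y = u \<and> x \<in> Z \<and> \<not> l x < i' then i' else min (l x) (l y))"

text \<open>The labelling for the new levels, with the arcs from \<open>u\<close> to
  \<open>Z\<close> still parked.\<close>

definition lab2 :: "nat set \<Rightarrow> nat \<times> nat \<Rightarrow> nat" where
  "lab2 Z = (\<lambda>(x, y). if x = u \<and> y \<in> Z then T + 1 else min ((l(u := i')) x) ((l(u := i')) y))"

lemma not_self: "(u, u) \<notin> arcs E" "u \<notin> X"
  using simple_edgesD(3)[OF E, of u u] by (auto simp: arcs_def X_def upper_def)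

lemma fin_X: "finite X" "X \<subseteq> {..<n}"
  using upper_finite[OF E] simple_edgesD[OF E] by (auto simp: X_def upper_def)

lemma arcs_X: "v \<in> X \<Longrightarrow> (u, v) \<in> arcs E" "v \<in> X \<Longrightarrow> (v, u) \<in> arcs E" "v \<in> X \<Longrightarrow> i \<le> l v"
  "(u, v) \<in> arcs E \<Longrightarrow> i \<le> l v \<Longrightarrow> v \<in> X"
  by (auto simp: arcs_def X_def upper_def insert_commute)

lemma i_neq: "i' \<noteq> i" "T + 1 \<noteq> i" "T + 1 \<noteq> i'"
  using u step by auto

text \<open>A treated arc has label \<open>i'\<close> or \<open>T + 1\<close>, both different from
  \<open>i\<close>, so emptiness of this row is the exit condition of the first loop.\<close>

lemma lab1_row:
  assumes "Z \<subseteq> X"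
  shows "(u, v) \<in> arcs E \<and> lab1 Z (u, v) = i \<longleftrightarrow> v \<in> X - Z"
proof (cases "v \<in> Z")
  case True
  then have "lab1 Z (u, v) \<noteq> i" using i_neq by (simp add: lab1_def)
  then show ?thesis using True by simp
next
  case False
  have "v \<noteq> u" "lab1 Z (u, v) = min i (l v)" if "(u, v) \<in> arcs E"
    using that False not_self(1) u by (auto simp: lab1_def)
  then show ?thesis using False arcs_X(1,3,4)[of v] by (metis DiffD1 DiffI min.absorb_iff1 min.commute)
qed

lemma lab2_row:
  assumes "Z \<subseteq> X"
  shows "(u, v) \<in> arcs E \<and> lab2 Z (u, v) = T + 1 \<longleftrightarrow> v \<in> Z"
proof (cases "v \<in> Z")
  case True
  then show ?thesis using arcs_X(1)[of v] assms by (auto simp: lab2_def)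
next
  case False
  then have "lab2 Z (u, v) \<le> i'" by (simp add: lab2_def)
  then show ?thesis using False u by auto
qed

text \<open>After the first loop only the parked arcs are out of place: a neighbour below level
  \<open>i\<close> is on a level at most \<open>i'\<close>, so its minimum with the level of
  \<open>u\<close> is unaffected by the move.\<close>

lemma lab1_X:
  assumes "(x, y) \<in> arcs E"
  shows "lab1 X (x, y) = lab2 {y \<in> X. l y < i'} (x, y)"
proof -
  have xy: "x \<noteq> y" using simple_edgesD(3)[OF E, of x y] assms by (auto simp: arcs_def)
  have side: "min i (l z) = min i' (l z)" if "l z < i" for z using that step by auto
  show ?thesis
  proof (cases "x = u")
    case True
    have "y \<in> X \<longleftrightarrow> i \<le> l y" using arcs_X(3,4)[of y] assms True by blast
    then show ?thesis using True xy u side[of y] by (auto simp: lab1_def lab2_def)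
  next
    case x: False
    show ?thesis
    proof (cases "y = u")
      case True
      have "(u, x) \<in> arcs E" using assms True by (simp add: arcs_def insert_commute)
      then have "x \<in> X \<longleftrightarrow> i \<le> l x" using arcs_X(3,4)[of x] by blast
      then show ?thesis using True x u step by (auto simp: lab1_def lab2_def min_def)
    next
      case False
      then show ?thesis using x by (simp add: lab1_def lab2_def)
    qed
  qed
qed

lemma move_step_spec:
  assumes r: "repr s (arcs E) (lab1 Z) D l" and Z: "Z \<subset> X" and s: "s 11 = u" "s 12 = i" "s 13 = i'"
    and Q: "\<And>t s' v. v \<in> X - Z \<Longrightarrow> repr s' (arcs E) (lab1 (insert v Z)) (D \<union> {y. y = v \<and> i' \<le> l y}) l \<Longrightarrow>
      (\<forall>a<40. a \<noteq> 14 \<longrightarrow> s' a = s a) \<Longrightarrow> t \<le> 2200 * (b + 1) \<Longrightarrow> Q t s'"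
  shows "wp move_step Q s"
  unfolding move_step_def
proof (rule wp_Seq, rule pick_spec[OF r mc, of 11 12 u i])
  show "\<exists>v. (u, v) \<in> arcs E \<and> lab1 Z (u, v) = i" using lab1_row[of Z] Z by blast
  fix t1 s1 v
  assume v: "(u, v) \<in> arcs E" "lab1 Z (u, v) = i" and s1: "repr s1 (arcs E) (lab1 Z) D l" "s1 14 = v"
    "\<forall>a<40. a \<noteq> 14 \<longrightarrow> s1 a = s a" "t1 \<le> 120 * (b + 1)"
  have vX: "v \<in> X - Z" using lab1_row[of Z v] v Z by blast
  then have vu: "v \<noteq> u" "u \<noteq> v" "v < n" "(v, u) \<in> arcs E" using not_self fin_X arcs_X by auto
  have regs: "s1 11 = u" "s1 12 = i" "s1 13 = i'" "s1 15 = T + 1" "s1 14 = v"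
    using s1 s reprD(5)[OF r] by simp_all
  have lv: "s1 (cell 0 v) = l v" using reprD(11)[OF s1(1)] vu by simp
  have vP: "v < P" using index_bounds(2) vu by simp
  note [simp] = ok_Var cell_less
  show "wp (Cond (Arr 0 (Var 14) \<lless> Var 13) (relabel 11 14 12 15)
       (relabel 11 14 12 13 ;; relabel 14 11 12 13 ;; mark 14)) (\<lambda>t'. Q (t1 + t')) s1"
  proof (rule wp_Cond)
    show "ok s1 (Arr 0 (Var 14) \<lless> Var 13)" using vP regs by simp
  next
    assume "val s1 (Arr 0 (Var 14) \<lless> Var 13) \<noteq> 0"
    then have less: "l v < i'" using lv regs by (simp split: if_splits)
    have eq: "(lab1 Z)((u, v) := T + 1) = lab1 (insert v Z)"
      using less vu not_self by (auto simp: lab1_def fun_eq_iff)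
    show "wp (relabel 11 14 12 15) (\<lambda>t. Q (t1 + (expr_cost (Arr 0 (Var 14) \<lless> Var 13) + 1 + t))) s1"
    proof (rule relabel_spec[OF s1(1) mc, where x = u and y = v and j = i and j' = "T + 1"], goal_cases)
      case (12 t s')
      moreover have "D \<union> {y. y = v \<and> i' \<le> l y} = D" using less by auto
      moreover have "repr s' (arcs E) (lab1 (insert v Z)) D l" using 12(1) unfolding eq .
      ultimately show ?case using s1 vX by (intro Q[of v]) simp_all
    qed (use regs v in simp_all)
  next
    assume "val s1 (Arr 0 (Var 14) \<lless> Var 13) = 0"
    then have ge: "\<not> l v < i'" using lv regs by (simp split: if_splits)
    have lv': "lab1 Z (v, u) = i" using vX vu u arcs_X(3)[of v] by (auto simp: lab1_def)
    have eq: "((lab1 Z)((u, v) := i'))((v, u) := i') = lab1 (insert v Z)"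
      using ge vu not_self by (auto simp: lab1_def fun_eq_iff)
    show "wp (relabel 11 14 12 13 ;; relabel 14 11 12 13 ;; mark 14)
        (\<lambda>t. Q (t1 + (expr_cost (Arr 0 (Var 14) \<lless> Var 13) + 1 + t))) s1"
    proof (rule wp_Seq, rule relabel_spec[OF s1(1) mc, where x = u and y = v and j = i and j' = i'], goal_cases)
      case (12 t2 s2)
      show ?case
      proof (rule wp_Seq, rule relabel_spec[OF 12(1) mc, where x = v and y = u and j = i and j' = i'], goal_cases)
        case (12 t3 s3)
        show ?case
        proof (rule mark_spec[OF 12(1)[unfolded eq] mc, where x = v], goal_cases)
          case (4 t4 s4)
          have "insert v D = D \<union> {y. y = v \<and> i' \<le> l y}" using ge by auto
          then show ?case
            using 4 12(2,3) \<open>\<forall>a<40. s2 a = s1 a\<close> \<open>t2 \<le> _\<close> s1 vX by (intro Q[of v]) simp_all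
        qed (use 12 \<open>\<forall>a<40. s2 a = s1 a\<close> regs vu in simp_all)
      qed (use 12 regs vu lv' u in simp_all)
    qed (use regs v u in simp_all)
  qed
qed (use s u in simp_all)

lemma back_step_spec:
  assumes r: "repr s (arcs E) (lab2 Z) D l" and Z: "Z \<subseteq> {y \<in> X. l y < i'}" "Z \<noteq> {}"
    and s: "s 11 = u" "s 12 = i"
    and Q: "\<And>t s' v. v \<in> Z \<Longrightarrow> repr s' (arcs E) (lab2 (Z - {v})) D l \<Longrightarrow>
      (\<forall>a<40. a \<noteq> 14 \<longrightarrow> s' a = s a) \<Longrightarrow> t \<le> 1000 * (b + 1) \<Longrightarrow> Q t s'"
  shows "wp back_step Q s"
  unfolding back_step_def
proof (rule wp_Seq, rule pick_spec[OF r mc, of 11 15 u "T + 1"])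
  show "\<exists>v. (u, v) \<in> arcs E \<and> lab2 Z (u, v) = T + 1" using lab2_row[of Z] Z by blast
  fix t1 s1 v
  assume v: "(u, v) \<in> arcs E" "lab2 Z (u, v) = T + 1" and s1: "repr s1 (arcs E) (lab2 Z) D l" "s1 14 = v"
    "\<forall>a<40. a \<noteq> 14 \<longrightarrow> s1 a = s a" "t1 \<le> 120 * (b + 1)"
  have vZ: "v \<in> Z" using lab2_row[of Z v] v Z by blast
  then have "min i' (l v) = i" "v \<noteq> u" using Z arcs_X(3)[of v] step not_self by auto
  then have eq: "(lab2 Z)((u, v) := i) = lab2 (Z - {v})"
    by (auto simp: lab2_def fun_eq_iff)
  show "wp (relabel 11 14 15 12) (\<lambda>t'. Q (t1 + t')) s1"
  proof (rule relabel_spec[OF s1(1) mc, where x = u and y = v and j = "T + 1" and j' = i], goal_cases)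
    case (12 t s')
    have "repr s' (arcs E) (lab2 (Z - {v})) D l" using 12(1) unfolding eq .
    then show ?case using s1 vZ 12 by (intro Q[of v]) simp_all
  qed (use s s1 v u reprD(5)[OF r] in simp_all)
qed (use s u reprD(5)[OF r] in simp_all)

end

lemma repr_level_update:
  assumes r: "repr s A lab D l" and u: "u < n" "l u = i" "i' \<le> T" "i \<noteq> i'"
  shows "repr (s(cell 2 i := s (cell 2 i) - 1, cell 2 i' := s (cell 2 i') + 1, cell 0 u := i')) A lab D (l(u := i'))"
    (is "repr ?s A lab D ?l")
proof -
  have i: "i \<le> T" using reprD(9)[OF r u(1)] u(2) by simp
  have fin: "finite {v. v < n \<and> l v = j}" for j by simp
  have 1: "card {v. v < n \<and> ?l v = i} = card {v. v < n \<and> l v = i} - 1"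
  proof -
    have "{v. v < n \<and> ?l v = i} = {v. v < n \<and> l v = i} - {u}" using u by auto
    then show ?thesis using u by (simp add: card_Diff_singleton_if)
  qed
  have 2: "card {v. v < n \<and> ?l v = i'} = card {v. v < n \<and> l v = i'} + 1"
  proof -
    have "{v. v < n \<and> ?l v = i'} = insert u {v. v < n \<and> l v = i'}" using u by auto
    then show ?thesis using u by simp
  qed
  have 3: "{v. v < n \<and> ?l v = j} = {v. v < n \<and> l v = j}" if "j \<noteq> i" "j \<noteq> i'" for j
    using u that by auto
  have "trie ?s (keys A lab D)"
    using reprD(10)[OF r] index_bounds(1)[OF u(1)] index_bounds(3)[OF i] index_bounds(3)[OF u(3)]
    by (intro trie_field_update) simp_all
  moreover have "?s (cell 2 j) = card {v. v < n \<and> ?l v = j}" if "j \<le> T" for j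
    using reprD(13)[OF r that] 1 2 3[of j] u(4) by (cases "j = i"; cases "j = i'") (simp_all add: cell_inject)
  moreover have "?s (cell 0 v) = ?l v" if "v < n" for v
    using reprD(11)[OF r that] by (simp add: cell_inject)
  ultimately show ?thesis
    using r u(3) unfolding repr_def by (simp add: cell_inject)
qed

text \<open>Each neighbour on a level \<open>\<ge> i\<close> is treated at most once per loop, in
  \<open>O(b)\<close> steps. The cost is thus proportional to what \<open>pot_rise\<close> and
  \<open>pot_fall\<close> release.\<close>

lemma move_spec:
  assumes E: "simple_edges n E" and u: "u < n" "l u = i" "i \<le> T" "i' \<le> T"
    and step: "i' = i + 1 \<or> (0 < i \<and> i' = i - 1)"
    and mc: "card (arcs E) \<le> 2 * mcap + 2"
    and r: "repr s (arcs E) (min_level l) D l" and s: "s 11 = u" "s 12 = i" "s 13 = i'"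
    and Q: "\<And>t s'. repr s' (arcs E) (min_level (l(u := i'))) (D \<union> {v \<in> upper E l i u. i' \<le> l v}) (l(u := i')) \<Longrightarrow>
      (\<forall>a<40. a \<noteq> 14 \<longrightarrow> s' a = s a) \<Longrightarrow> t \<le> 5000 * (b + 1) * (N E l i u + 1) \<Longrightarrow> Q t s'"
  shows "wp move Q s"
proof -
  let ?X = "upper E l i u"
  let ?Y = "{y \<in> ?X. l y < i'}"
  let ?D = "D \<union> {v \<in> ?X. i' \<le> l v}"
  note facts = E u step mc
  define L1 where "L1 = lab1 l u i'"
  define L2 where "L2 = lab2 l u i'"
  have L1: "min_level l = L1 {}" by (auto simp: L1_def lab1_def[where l = l, OF facts] min_level_def fun_eq_iff)
  have L2: "min_level (l(u := i')) = L2 {}" by (auto simp: L2_def lab2_def[where l = l, OF facts] min_level_def fun_eq_iff)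
  have finX: "finite ?X" using fin_X(1)[where l = l, OF facts] .
  define K where "K = b + 1"
  have K: "1 \<le> K" by (simp add: K_def)
  let ?I = "\<lambda>k s'. \<exists>Z\<subseteq>?X. repr s' (arcs E) (L1 Z) (D \<union> {v \<in> Z. i' \<le> l v}) l \<and> (\<forall>a<40. a \<noteq> 14 \<longrightarrow> s' a = s a) \<and>
    k = 2300 * K * (card ?X - card Z)"
  let ?J = "\<lambda>k s'. \<exists>Z\<subseteq>?Y. repr s' (arcs E) (L2 Z) ?D l \<and> (\<forall>a<40. a \<noteq> 14 \<longrightarrow> s' a = s a) \<and>
    k = 1100 * K * card Z"
  let ?c = "row_test (row_index 11 12)"
  let ?d = "row_test (row_index 11 15)"
  have iT: "i < T + 2" using u(3) by linarith
  have cost: "expr_cost ?c = 27" "expr_cost ?d = 27" by (simp_all add: row_index_def)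
  show ?thesis
    unfolding move_def
  proof (rule wp_Seq, rule wp_Loop[where I = ?I and k = "2300 * K * card ?X"])
    show "?I (2300 * K * card ?X) s" using r by (intro exI[of _ "{}"]) (simp add: L1)
  next
    fix k s' assume "?I k s'"
    then obtain Z where Z: "Z \<subseteq> ?X" "repr s' (arcs E) (L1 Z) (D \<union> {v \<in> Z. i' \<le> l v}) l"
      "\<forall>a<40. a \<noteq> 14 \<longrightarrow> s' a = s a" by blast
    show "ok s' ?c" using Z s u iT by (intro row_test_repr(1)[OF Z(2) mc, of 11 12 u i]) simp_all
  next
    fix k s' assume "?I k s'" and c: "val s' ?c \<noteq> 0"
    then obtain Z where Z: "Z \<subseteq> ?X" "repr s' (arcs E) (L1 Z) (D \<union> {v \<in> Z. i' \<le> l v}) l"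
      "\<forall>a<40. a \<noteq> 14 \<longrightarrow> s' a = s a" "k = 2300 * K * (card ?X - card Z)" by blast
    have "\<exists>v. (u, v) \<in> arcs E \<and> L1 Z (u, v) = i"
      using row_test_repr(2)[OF Z(2) mc, of 11 12 u i] c Z(3) s u iT by simp
    then have "Z \<subset> ?X" using lab1_row[where l = l, OF facts Z(1)] Z(1) unfolding L1_def by blast
    then show "wp move_step (\<lambda>t s'. \<exists>k'. ?I k' s' \<and> k' + t + expr_cost ?c + 1 \<le> k) s'"
    proof (rule move_step_spec[where l = l, OF facts Z(2)[unfolded L1_def]], goal_cases)
      case (4 t s'' v)
      have 1: "(D \<union> {v \<in> Z. i' \<le> l v}) \<union> {y. y = v \<and> i' \<le> l y} = D \<union> {y \<in> insert v Z. i' \<le> l y}" by auto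
      have "card (insert v Z) = Suc (card Z)" using 4(1) finite_subset[OF Z(1) finX] by simp
      moreover have "card (insert v Z) \<le> card ?X" using 4(1) Z(1) finX by (intro card_mono) auto
      ultimately have "card ?X - card Z = Suc (card ?X - card (insert v Z))" by simp
      then have "2300 * K * (card ?X - card (insert v Z)) + t + expr_cost ?c + 1 \<le> k"
        using 4(4) K unfolding Z(4) cost K_def[symmetric] by simp
      then show ?case
        using 4(1,2,3) Z(1,3) unfolding 1 L1_def
        by (intro exI[of _ "2300 * K * (card ?X - card (insert v Z))"] conjI exI[of _ "insert v Z"]) auto
    qed (use Z(3) s in simp_all)
  next
    fix k1 t1 s1 assume "?I k1 s1" and c: "val s1 ?c = 0" and t1: "t1 + k1 \<le> 2300 * K * card ?X + expr_cost ?c + 1"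
    then obtain Z where Z: "Z \<subseteq> ?X" "repr s1 (arcs E) (L1 Z) (D \<union> {v \<in> Z. i' \<le> l v}) l"
      "\<forall>a<40. a \<noteq> 14 \<longrightarrow> s1 a = s a" by blast
    have "\<not> (\<exists>v. (u, v) \<in> arcs E \<and> L1 Z (u, v) = i)"
      using row_test_repr(2)[OF Z(2) mc, of 11 12 u i] c Z(3) s u iT by simp
    then have ZX: "Z = ?X" using lab1_row[where l = l, OF facts Z(1)] Z(1) unfolding L1_def by blast
    have "L1 ?X a = L2 ?Y a" if "a \<in> arcs E" for a
      using lab1_X[where l = l, OF facts, of "fst a" "snd a"] that by (simp add: L1_def L2_def)
    then have r1: "repr s1 (arcs E) (L2 ?Y) ?D l"
      using Z(2) repr_cong[of "arcs E" "L1 ?X" "L2 ?Y"] unfolding ZX by blast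
    show "wp (Loop ?d back_step ;; Store (Addr 2 (Var 12)) (Arr 2 (Var 12) \<ominus> Lit 1) ;;
       Store (Addr 2 (Var 13)) (Arr 2 (Var 13) \<oplus> Lit 1) ;; Store (Addr 0 (Var 11)) (Var 13)) (\<lambda>t'. Q (t1 + t')) s1"
    proof (rule wp_Seq, rule wp_Loop[where I = ?J and k = "1100 * K * card ?Y"])
      show "?J (1100 * K * card ?Y) s1" using r1 Z(3) by (intro exI[of _ ?Y]) simp
    next
      fix k s' assume "?J k s'"
      then obtain Z where Z: "Z \<subseteq> ?Y" "repr s' (arcs E) (L2 Z) ?D l"
        "\<forall>a<40. a \<noteq> 14 \<longrightarrow> s' a = s a" by blast
      show "ok s' ?d" using Z s u reprD(5)[OF Z(2)] by (intro row_test_repr(1)[OF Z(2) mc, of 11 15 u "T + 1"]) simp_all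
    next
      fix k s' assume "?J k s'" and c: "val s' ?d \<noteq> 0"
      then obtain Z where Z: "Z \<subseteq> ?Y" "repr s' (arcs E) (L2 Z) ?D l"
        "\<forall>a<40. a \<noteq> 14 \<longrightarrow> s' a = s a" "k = 1100 * K * card Z" by blast
      have ZX: "Z \<subseteq> ?X" using Z(1) by blast
      have "\<exists>v. (u, v) \<in> arcs E \<and> L2 Z (u, v) = T + 1"
        using row_test_repr(2)[OF Z(2) mc, of 11 15 u "T + 1"] c Z(3) s u reprD(5)[OF Z(2)] by simp
      then have "Z \<noteq> {}" using lab2_row[where l = l, OF facts ZX] unfolding L2_def by blast
      then show "wp back_step (\<lambda>t s'. \<exists>k'. ?J k' s' \<and> k' + t + expr_cost ?d + 1 \<le> k) s'"
      proof (rule back_step_spec[where l = l, OF facts Z(2)[unfolded L2_def] Z(1)], goal_cases)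
        case (3 t s'' v)
        have "finite Z" using finite_subset[OF ZX finX] .
        then have "card Z = Suc (card (Z - {v}))" using card_Suc_Diff1 3(1) by metis
        then have "1100 * K * card (Z - {v}) + t + expr_cost ?d + 1 \<le> k"
          using 3(4) K unfolding Z(4) cost K_def[symmetric] by simp
        then show ?case
          using 3(1,2,3) Z(1,3) unfolding L2_def
          by (intro exI[of _ "1100 * K * card (Z - {v})"] conjI exI[of _ "Z - {v}"]) auto
      qed (use Z(3) s in simp_all)
    next
      fix k2 t2 s2 assume "?J k2 s2" and c: "val s2 ?d = 0" and t2: "t2 + k2 \<le> 1100 * K * card ?Y + expr_cost ?d + 1"
      then obtain Z where Z: "Z \<subseteq> ?Y" "repr s2 (arcs E) (L2 Z) ?D l"
        "\<forall>a<40. a \<noteq> 14 \<longrightarrow> s2 a = s a" by blast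
      have ZX: "Z \<subseteq> ?X" using Z(1) by blast
      have "\<not> (\<exists>v. (u, v) \<in> arcs E \<and> L2 Z (u, v) = T + 1)"
        using row_test_repr(2)[OF Z(2) mc, of 11 15 u "T + 1"] c Z(3) s u reprD(5)[OF Z(2)] by simp
      then have "Z = {}" using lab2_row[where l = l, OF facts ZX] unfolding L2_def by blast
      then have r2: "repr s2 (arcs E) (min_level (l(u := i'))) ?D l" using Z(2) by (simp add: L2)
      have ne: "i \<noteq> i'" using step by auto
      note r3 = repr_level_update[OF r2 u(1,2,4) ne]
      have card_less: "card {v. v < n \<and> l v = i'} < P" 
      proof -
        have "card {v. v < n \<and> l v = i'} \<le> card ({..<n} - {u})" using u ne by (intro card_mono) auto
        also have "\<dots> < n" using u(1) by simp
        finally show ?thesis using index_bounds(2) by simp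
      qed
      note [simp] = ok_Var cell_less
      have [simp]: "s2 11 = u" "s2 12 = i" "s2 13 = i'" using Z(3) s by simp_all
      have [simp]: "i < P" "i' < P" "u < P" using index_bounds u by auto
      have [simp]: "Suc (s2 (cell 2 i')) < W" using reprD(13)[OF r2 u(4)] card_less P_le by simp
      have [simp]: "cell 2 i' \<noteq> cell 2 i" using ne by (simp add: cell_inject)
      have Ycard: "card ?Y \<le> card ?X" using finX by (intro card_mono) auto
      have frame: "\<forall>a<40. a \<noteq> 14 \<longrightarrow> (s2(cell 2 i := s2 (cell 2 i) - 1, cell 2 i' := s2 (cell 2 i') + 1, cell 0 u := i')) a = s a"
        using Z(3) by simp
      have time: "t1 + (t2 + t) \<le> 5000 * (b + 1) * (N E l i u + 1)" if "t \<le> 60" for t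
      proof -
        have "1100 * K * card ?Y \<le> 1100 * K * card ?X" by (rule mult_le_mono2[OF Ycard])
        then have "t1 + (t2 + t) \<le> 3400 * K * card ?X + 120"
          using t1 t2 that unfolding cost by linarith
        also have "\<dots> \<le> 5000 * K * (card ?X + 1)" using K by (simp add: algebra_simps)
        finally show ?thesis by (simp add: N_def K_def)
      qed
      show "wp (Store (Addr 2 (Var 12)) (Arr 2 (Var 12) \<ominus> Lit 1) ;;
         Store (Addr 2 (Var 13)) (Arr 2 (Var 13) \<oplus> Lit 1) ;; Store (Addr 0 (Var 11)) (Var 13))
         (\<lambda>t'. Q (t1 + (t2 + t'))) s2"
        apply (rule wp_steps; simp?)+
        apply (rule Q)
        subgoal using r3 by simp
        subgoal using frame by simp
        subgoal by (rule time) simp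
        done
    qed
  qed
qed

end

section \<open>Settling the marked vertices\<close>

definition choose_level :: "nat \<Rightarrow> com" where
  "choose_level B = (12 :=\<^sub>v Arr 0 (Var 11) ;; 13 :=\<^sub>v Var 12 ;; 16 :=\<^sub>v (Var 11 \<otimes> Var 8 \<oplus> Var 12) ;;
     Cond (Lit (2 * B + 10) \<otimes> Arr 3 (Var 12) \<lless> Arr 1 (Var 16) \<otimes> (Var 4 \<otimes> Lit B))
       (13 :=\<^sub>v (Var 12 \<oplus> Lit 1))
       (Cond (Lit 0 \<lless> Var 12)
         (Cond ((Arr 1 (Var 16) \<oplus> Arr 1 (Var 16 \<ominus> Lit 1)) \<otimes> Var 4 \<lless> Arr 3 (Var 12 \<ominus> Lit 1))
           (13 :=\<^sub>v (Var 12 \<ominus> Lit 1)) Skip) Skip))"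

definition pick_marked :: com where
  "pick_marked = (40 :=\<^sub>v (Var 6 \<ominus> Lit 1) ;; t_min ;; 11 :=\<^sub>v Var 41)"

definition settle_step :: "nat \<Rightarrow> com" where
  "settle_step B = (pick_marked ;; choose_level B ;; Cond (Var 12 \<doteq> Var 13) (unmark 11) move)"

definition settle :: "nat \<Rightarrow> com" where
  "settle B = Loop (row_test (Var 6 \<ominus> Lit 1)) (settle_step B)"

definition find_top :: com where
  "find_top = (10 :=\<^sub>v Var 3 ;; Loop (Arr 2 (Var 10) \<doteq> Lit 0) (10 :=\<^sub>v (Var 10 \<ominus> Lit 1)))"

context algorithm begin

definition target :: "nat set set \<Rightarrow> (nat \<Rightarrow> nat) \<Rightarrow> nat \<Rightarrow> nat" where
  "target E l u = (if \<not> up_ok E l u then l u + 1 else if \<not> down_ok E l u then l u - 1 else l u)"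

text \<open>Everything is compared with the threshold of level \<open>T\<close>, which is at least
  \<open>M * n\<close>; the single bound \<open>word\<close> is enough because
  \<open>2 * B + 10 \<le> 12 * B * B\<close>.\<close>

lemma word_bounds:
  "j \<le> T \<Longrightarrow> (2 * B + 10) * thr M j < W" "2 * B + 10 < W" "x \<le> n \<Longrightarrow> x * (M * B) < W" "M * B < W" "B < W"
  "x \<le> n \<Longrightarrow> x * M < W" "x \<le> n \<Longrightarrow> x < W"
proof -
  have B2: "2 * B + 10 \<le> 12 * B * B"
  proof -
    have "2 * B + 10 \<le> 12 * B" using B_ge by simp
    also have "12 * B * 1 \<le> 12 * B * B" using B_ge by (intro mult_le_mono) auto
    finally show ?thesis by simp
  qed
  show 1: "(2 * B + 10) * thr M j < W" if "j \<le> T" for j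
  proof -
    have "(2 * B + 10) * thr M j \<le> 12 * B * B * thr M T"
      using B2 thr_mono[OF that] by (intro mult_le_mono)
    then show ?thesis using word by simp
  qed
  have "(2 * B + 10) * 1 \<le> (2 * B + 10) * thr M 0" using M_ge by (intro mult_le_mono2) auto
  then show "2 * B + 10 < W" using le_less_trans[OF _ 1[of 0]] by simp
  then show "B < W" by simp
  have MB: "n * (M * B) < W"
  proof -
    have "n * (M * B) = B * (M * n)" by simp
    also have "\<dots> \<le> (2 * B + 10) * thr M T" using thr_T by (intro mult_le_mono) auto
    finally show ?thesis using 1[of T] by simp
  qed
  show 3: "x * (M * B) < W" if "x \<le> n" for x
  proof -
    have "x * (M * B) \<le> n * (M * B)" using that by (rule mult_le_mono1)
    then show ?thesis using MB by (rule le_less_trans)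
  qed
  show "M * B < W" using 3[of 1] n_pos by simp
  show "x * M < W" if "x \<le> n" for x
  proof -
    have "x * M * 1 \<le> x * M * B" using B_ge by (intro mult_le_mono) auto
    also have "x * M * B < W" using 3[OF that] by (simp only: mult.assoc)
    finally show ?thesis by simp
  qed
  show "x < W" if "x \<le> n" for x
  proof -
    have "x * 1 \<le> x * (M * B)" using B_ge M_ge by (intro mult_le_mono) auto
    also have "\<dots> < W" by (rule 3[OF that])
    finally show ?thesis by simp
  qed
qed

text \<open>Neighbours on levels at least \<open>l u\<close> give arcs with label
  \<open>l u\<close>, those on level \<open>l u - 1\<close> give arcs with label
  \<open>l u - 1\<close>. Two stored row sizes thus decide \<open>up_ok\<close> and
  \<open>down_ok\<close> without visiting an edge.\<close>

lemma row_count: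
  assumes r: "repr s (arcs E) (min_level l) D l" and E: "simple_edges n E" and u: "u < n"
  shows "s (cell 1 (row u (l u))) = N E l (l u) u"
    "0 < l u \<Longrightarrow> s (cell 1 (row u (l u))) + s (cell 1 (row u (l u - 1))) = N E l (l u - 1) u"
proof -
  have lu: "l u \<le> T" using reprD(9)[OF r u] .
  have "{v. (u, v) \<in> arcs E \<and> min_level l (u, v) = l u} = upper E l (l u) u"
    by (auto simp: arcs_def min_level_def upper_def)
  then show 1: "s (cell 1 (row u (l u))) = N E l (l u) u"
    using reprD(12)[OF r u, of "l u"] lu by (simp add: N_def)
  assume pos: "0 < l u"
  let ?Y = "{v. (u, v) \<in> arcs E \<and> min_level l (u, v) = l u - 1}"
  have "upper E l (l u - 1) u = upper E l (l u) u \<union> ?Y" "upper E l (l u) u \<inter> ?Y = {}"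
    using pos by (auto simp: arcs_def min_level_def upper_def min_def split: if_splits)
  then have "N E l (l u - 1) u = N E l (l u) u + card ?Y"
    unfolding N_def using upper_finite[OF E, of l "l u - 1" u] by (simp add: card_Un_disjoint)
  then show "s (cell 1 (row u (l u))) + s (cell 1 (row u (l u - 1))) = N E l (l u - 1) u"
    using 1 reprD(12)[OF r u, of "l u - 1"] lu by simp
qed

lemma choose_level_spec:
  assumes r: "repr s (arcs E) (min_level l) D l" and E: "simple_edges n E" and u: "s 11 = u" "u < n"
    and Q: "\<And>t. t \<le> 150 \<Longrightarrow> Q t (s(12 := l u, 13 := target E l u, 16 := row u (l u)))"
  shows "wp (choose_level B) Q s"
proof -
  define i where "i = l u"
  define c where "c = N E l i u"
  have i: "i \<le> T" "i < T + 2" using reprD(9)[OF r u(2)] by (simp_all add: i_def)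
  have cn: "c \<le> n" "N E l (i - 1) u \<le> n" using N_less[OF E u(2)] less_imp_le by (auto simp: c_def)
  define wd where "wd = T + 2"
  define ri where "ri = row u i"
  have [simp]: "s 8 = wd" "s 11 = u" "s 4 = M" using reprD(3,4)[OF r] u by (auto simp: wd_def)
  have [simp]: "u * wd < W" "u * wd + i = ri" "ri < P" "ri < W" "ri - Suc 0 < P" "u < P" "i < P" "i - Suc 0 < P" "Suc i < W"
    using row_less[OF u(2) i(2)] index_bounds(2)[OF u(2)] index_bounds(4)[OF i(1)] P_le by (auto simp: row_def wd_def ri_def)
  have [simp]: "s (cell 0 u) = i" using reprD(11)[OF r u(2)] by (simp add: i_def)
  have [simp]: "s (cell (Suc 0) ri) = c"
    using row_count(1)[OF r E u(2)] by (simp add: ri_def i_def c_def)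
  have [simp]: "s (cell 3 i) = thr M i" "s (cell 3 (i - Suc 0)) = thr M (i - Suc 0)"
    using reprD(14)[OF r] i(1) by simp_all
  have [simp]: "c + s (cell (Suc 0) (ri - Suc 0)) = N E l (i - Suc 0) u" if "0 < i"
  proof -
    have "ri - Suc 0 = row u (i - 1)" using that by (simp add: ri_def row_def)
    then show ?thesis using row_count[OF r E u(2)] that by (simp add: i_def c_def ri_def)
  qed
  note [simp] = ok_Var cell_less
  have [simp]: "(2 * B + 10) * thr M i < W" "2 * B + 10 < W" "c * (M * B) < W" "M * B < W" "B < W"
    "N E l (i - Suc 0) u * M < W" "N E l (i - Suc 0) u < W"
    using word_bounds(1)[OF i(1)] word_bounds(2,4,5) word_bounds(3)[OF cn(1)] word_bounds(6,7)[OF cn(2)]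
    by simp_all
  have tup: "target E l u = i + 1" if "(2 * B + 10) * thr M i < c * (M * B)"
    using that by (simp add: target_def up_ok_def i_def c_def)
  have tdn: "target E l u = i - 1" if "\<not> (2 * B + 10) * thr M i < c * (M * B)" "0 < i" "N E l (i - Suc 0) u * M < thr M (i - Suc 0)"
    using that by (simp add: target_def up_ok_def down_ok_def i_def c_def)
  have tno: "target E l u = i" if "\<not> (2 * B + 10) * thr M i < c * (M * B)" "i = 0 \<or> \<not> N E l (i - Suc 0) u * M < thr M (i - Suc 0)"
    using that by (auto simp: target_def up_ok_def down_ok_def i_def c_def)
  have Q': "Q t (s(12 := i, 13 := j, 16 := ri))" if "t \<le> 150" "target E l u = j" for t j
    using Q[OF that(1)] that(2) by (simp add: i_def ri_def)
  have Q'': "Q t (s(12 := i, 16 := ri, 13 := j))" if "t \<le> 150" "target E l u = j" for t j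
    using Q'[OF that] by (simp add: fun_upd_twist)
  show ?thesis
  proof (cases "i = 0")
    case True
    have [simp]: "\<not> 0 < i" using True by simp
    show ?thesis
      unfolding choose_level_def
      apply (rule wp_steps; (simp split del: if_split del: add_mult_distrib distrib_right mult_Suc)?)+
      subgoal using Q''[of 52 "Suc i"] tup by (simp split: if_split_asm)
      apply (rule wp_steps; (simp split del: if_split del: add_mult_distrib distrib_right mult_Suc)?)+
      subgoal using Q'[of 52 i] tno True by (simp split: if_split_asm)
      done
  next
    case False
    then have [simp]: "0 < i" by simp
    show ?thesis
      unfolding choose_level_def
      apply (rule wp_steps; (simp split del: if_split del: add_mult_distrib distrib_right mult_Suc)?)+
      subgoal using Q''[of 52 "Suc i"] tup by (simp split: if_split_asm)
      apply (rule wp_steps; (simp split del: if_split del: add_mult_distrib distrib_right mult_Suc)?)+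
      subgoal by (rule Q'') (use tdn in \<open>simp_all split: if_split_asm\<close>)
      apply (rule wp_steps; (simp split del: if_split del: add_mult_distrib distrib_right mult_Suc)?)+
      subgoal by (rule Q') (use tno in \<open>simp_all split: if_split_asm\<close>)
      done
  qed
qed

lemma pick_marked_spec:
  assumes r: "repr s A lab D l" "card A \<le> 2 * mcap + 2" and ne: "D \<noteq> {}"
    and Q: "\<And>t s' v. v \<in> D \<Longrightarrow> repr s' A lab D l \<Longrightarrow> s' 11 = v \<Longrightarrow>
      (\<forall>a<40. a \<noteq> 11 \<longrightarrow> s' a = s a) \<Longrightarrow> t \<le> 120 * (b + 1) \<Longrightarrow> Q t s'"
  shows "wp pick_marked Q s"
proof -
  let ?s = "s(40 := R - Suc 0)"
  have s: "repr ?s A lab D l" using r by simp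
  note [simp] = ok_Var cell_less
  have [simp]: "s 6 = R" using reprD(16)[OF r(1)] .
  have min: "wp t_min Q' ?s" if Q': "\<And>t s' v. v \<in> D \<Longrightarrow> repr s' A lab D l \<Longrightarrow>
      s' 41 = v \<Longrightarrow> (\<forall>a<40. s' a = s a) \<Longrightarrow> t \<le> 100 * (b + 1) \<Longrightarrow> Q' t s'" for Q'
  proof (rule t_min_spec[OF reprD(10)[OF s], of "R - Suc 0"], goal_cases)
    case (5 t s' v)
    have sv: "repr (?s(41 := v)) A lab D l" using r by simp
    have "repr s' A lab D l"
      using repr_trie_frame[OF sv 5(4,2)] reprD(6,7,8)[OF r(1)] by simp
    then show ?case using 5 mark_entry[OF r(1)] by (intro Q'[of v]) (auto simp: trie_frame_def)
  qed (use R_pos mark_entry[OF r(1)] ne capacity(1)[OF r] in auto)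
  show ?thesis
    unfolding pick_marked_def
    apply (rule wp_steps; simp?)+
    apply (rule wp_Seq, rule min)
    apply (rule wp_steps; simp?)+
    apply (rule Q)
    apply auto
    done
qed

lemma marked_test:
  assumes r: "repr s A lab D l" "card A \<le> 2 * mcap + 2"
  shows "ok s (row_test (Var 6 \<ominus> Lit 1))" "val s (row_test (Var 6 \<ominus> Lit 1)) \<noteq> 0 \<longleftrightarrow> D \<noteq> {}"
  using row_test[OF reprD(10)[OF r(1)] capacity(1)[OF r], of "Var 6 \<ominus> Lit 1" "R - Suc 0"]
    reprD(16)[OF r(1)] R_pos mark_entry[OF r(1)] by (auto simp: ok_Var)

lemma N_mono:
  assumes "simple_edges n E" "\<And>w. {v, w} \<in> E \<Longrightarrow> j \<le> l w \<Longrightarrow> j \<le> l' w"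
  shows "N E l j v \<le> N E l' j v"
proof -
  have "upper E l j v \<subseteq> upper E l' j v" using assms(2) by (auto simp: upper_def)
  then show ?thesis unfolding N_def by (rule card_mono[OF upper_finite[OF assms(1)]])
qed

text \<open>An unmarked neighbour \<open>v\<close> lies on a level at most \<open>l u\<close> and at
  most \<open>i'\<close>. Hence \<open>u\<close> is counted by \<open>v\<close> on the levels
  \<open>l v\<close> and \<open>l v - 1\<close> both before and after the move.\<close>

lemma ok_after_move:
  assumes E: "simple_edges n E" and v: "v \<noteq> u" "up_ok E l v" "down_ok E l v"
    and i': "i' = l u + 1 \<or> (0 < l u \<and> i' = l u - 1)"
    and far: "v \<notin> {v \<in> upper E l (l u) u. i' \<le> l v}"
  shows "up_ok E (l(u := i')) v \<and> down_ok E (l(u := i')) v"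
proof -
  let ?l = "l(u := i')"
  have far': "l v < l u \<or> l v < i'" if "{v, u} \<in> E"
    using far that by (auto simp: upper_def insert_commute)
  have lv: "?l v = l v" using v(1) by simp
  have "N E ?l (l v) v \<le> N E l (l v) v"
  proof (rule N_mono[OF E])
    fix w assume w: "{v, w} \<in> E" "l v \<le> ?l w"
    then show "l v \<le> l w" using i' far' by (cases "w = u") auto
  qed
  then have "N E ?l (l v) v * (M * B) \<le> N E l (l v) v * (M * B)" by (rule mult_le_mono1)
  also have "\<dots> \<le> (2 * B + 10) * thr M (l v)" using v(2) by (simp only: up_ok_def)
  finally have 1: "up_ok E ?l v" unfolding up_ok_def lv .
  have "N E l (l v - 1) v \<le> N E ?l (l v - 1) v"
  proof (rule N_mono[OF E])
    fix w assume w: "{v, w} \<in> E" "l v - 1 \<le> l w"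
    then show "l v - 1 \<le> ?l w" using i' far' by (cases "w = u") auto
  qed
  then have "N E l (l v - 1) v * M \<le> N E ?l (l v - 1) v * M" by (rule mult_le_mono1)
  then have 2: "down_ok E ?l v"
    using v(3) unfolding down_ok_def lv by linarith
  show ?thesis using 1 2 by simp
qed

text \<open>A vertex that violates \<open>up_ok\<close> has a nonzero count \<open>N\<close>, so
  \<open>4 * N\<close> covers \<open>2 * N + 1\<close>. For a fall, the count on level
  \<open>l u - 1\<close> dominates the one on level \<open>l u\<close>. The levels stay within
  \<open>T\<close> by \<open>up_ok_T\<close>.\<close>

lemma target_pot:
  assumes E: "simple_edges n E" and u: "u < n" and l: "\<And>u. u < n \<Longrightarrow> l u \<le> T" and ne: "target E l u \<noteq> l u"
  shows "target E l u \<le> T" "target E l u = l u + 1 \<or> (0 < l u \<and> target E l u = l u - 1)"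
    "pot E (l(u := target E l u)) + 2 * int (N E l (l u) u) + 1 \<le> pot E l"
proof -
  have "target E l u \<le> T \<and> (target E l u = l u + 1 \<or> (0 < l u \<and> target E l u = l u - 1)) \<and>
    pot E (l(u := target E l u)) + 2 * int (N E l (l u) u) + 1 \<le> pot E l"
  proof (cases "up_ok E l u")
    case False
    then have t: "target E l u = l u + 1" by (simp add: target_def)
    have "l u < T" using up_ok_T[OF E u, of l] False by force
    moreover have "N E l (l u) u \<noteq> 0" using False unfolding up_ok_def by (metis mult_0 zero_le)
    then have "1 \<le> int (N E l (l u) u)" by simp
    ultimately show ?thesis using pot_rise[OF E u False] unfolding t by auto
  next
    case True
    then have d: "\<not> down_ok E l u" using ne by (auto simp: target_def)
    then have t: "target E l u = l u - 1" using True by (simp add: target_def)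
    have "0 < l u" using d by (auto simp: down_ok_def)
    moreover have "N E l (l u) u \<le> N E l (l u - 1) u" by (rule N_antimono[OF E]) simp
    then have "int (N E l (l u) u) \<le> int (N E l (l u - 1) u)" by simp
    ultimately show ?thesis using pot_fall[OF E u d] l[OF u] unfolding t by auto
  qed
  then show "target E l u \<le> T" "target E l u = l u + 1 \<or> (0 < l u \<and> target E l u = l u - 1)"
    "pot E (l(u := target E l u)) + 2 * int (N E l (l u) u) + 1 \<le> pot E l" by blast+
qed

definition settled :: "nat set set \<Rightarrow> nat set \<Rightarrow> (nat \<Rightarrow> nat) \<Rightarrow> bool" where
  "settled E D l \<longleftrightarrow> (\<forall>v<n. v \<notin> D \<longrightarrow> up_ok E l v \<and> down_ok E l v)"

text \<open>A unit of potential and a mark are each worth \<open>6000 * (b + 1)\<close> steps.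
  Unmarking spends one mark. A move releases at least \<open>2 * N + 1\<close> units and creates at
  most \<open>N\<close> marks, so \<open>N + 1\<close> units remain for its
  \<open>5000 * (b + 1) * (N + 1)\<close> steps and the overhead.\<close>

lemma settle_step_spec:
  assumes r: "repr s (arcs E) (min_level l) D l" and mc: "card (arcs E) \<le> 2 * mcap + 2"
    and E: "simple_edges n E" and D: "D \<noteq> {}" "settled E D l"
    and Q: "\<And>t s' l' D'. repr s' (arcs E) (min_level l') D' l' \<Longrightarrow> settled E D' l' \<Longrightarrow> s' 9 = s 9 \<Longrightarrow>
      int t + 6000 * int (b + 1) * (pot E l' + int (card D')) + 100 \<le> 6000 * int (b + 1) * (pot E l + int (card D)) \<Longrightarrow> Q t s'"
  shows "wp (settle_step B) Q s"
  unfolding settle_step_def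
proof (rule wp_Seq, rule pick_marked_spec[OF r mc D(1)])
  define K where "K = int (b + 1)"
  have K: "2 \<le> K" using b_ge by (simp add: K_def)
  fix t1 s1 u
  assume u: "u \<in> D" and s1: "repr s1 (arcs E) (min_level l) D l" "s1 11 = u"
    "\<forall>a<40. a \<noteq> 11 \<longrightarrow> s1 a = s a" "t1 \<le> 120 * (b + 1)"
  have un: "u < n" using u reprD(7)[OF r] by auto
  have l: "l v \<le> T" if "v < n" for v using reprD(9)[OF r that] .
  have finD: "finite D" using finite_arcs(2)[OF r] .
  have t1: "int t1 \<le> 120 * K" using s1(4) unfolding K_def by linarith
  show "wp (choose_level B ;; Cond (Var 12 \<doteq> Var 13) (unmark 11) move) (\<lambda>t'. Q (t1 + t')) s1"
  proof (rule wp_Seq, rule choose_level_spec[OF s1(1) E s1(2) un])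
    fix t2 :: nat assume t2: "t2 \<le> 150"
    define i where "i = l u"
    define i' where "i' = target E l u"
    let ?s = "s1(12 := l u, 13 := target E l u, 16 := row u (l u))"
    have s2: "repr ?s (arcs E) (min_level l) D l" "?s 11 = u" "?s 12 = i" "?s 13 = i'" "?s 9 = s 9"
      using s1 by (simp_all add: i_def i'_def)
    show "wp (Cond (Var 12 \<doteq> Var 13) (unmark 11) move) (\<lambda>t'. Q (t1 + (t2 + t'))) ?s"
    proof (rule wp_Cond)
      show "ok ?s (Var 12 \<doteq> Var 13)" by (simp add: ok_Var)
    next
      assume "val ?s (Var 12 \<doteq> Var 13) \<noteq> 0"
      then have eq: "target E l u = l u" by (simp split: if_splits)
      then have uok: "up_ok E l u \<and> down_ok E l u"
        by (auto simp: target_def down_ok_def split: if_splits)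
      show "wp (unmark 11) (\<lambda>t. Q (t1 + (t2 + (expr_cost (Var 12 \<doteq> Var 13) + 1 + t)))) ?s"
      proof (rule unmark_spec[OF s2(1) mc _ s2(2) u])
        fix t s' assume s': "repr s' (arcs E) (min_level l) (D - {u}) l" "\<forall>a<40. s' a = ?s a" "t \<le> 550 * (b + 1)"
        have "settled E (D - {u}) l" using D(2) uok by (auto simp: settled_def)
        moreover have "card D = Suc (card (D - {u}))" using finD u by (metis card_Suc_Diff1)
        then have "int (card D) = int (card (D - {u})) + 1" by simp
        moreover have "int t \<le> 550 * K" using s'(3) unfolding K_def by linarith
        moreover have "6000 * K * (pot E l + (int (card (D - {u})) + 1)) = 6000 * K * (pot E l + int (card (D - {u}))) + 6000 * K"
          by (simp only: add.assoc[symmetric] distrib_left mult_1_right)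
        ultimately have "int (t1 + (t2 + (expr_cost (Var 12 \<doteq> Var 13) + 1 + t))) +
            6000 * K * (pot E l + int (card (D - {u}))) + 100 \<le> 6000 * K * (pot E l + int (card D))"
          using t1 t2 K by simp
        then show "Q (t1 + (t2 + (expr_cost (Var 12 \<doteq> Var 13) + 1 + t))) s'"
          using s'(1,2) s2(5) \<open>settled E (D - {u}) l\<close> unfolding K_def
          by (intro Q[of _ l "D - {u}"]) simp_all
      qed simp
    next
      assume "val ?s (Var 12 \<doteq> Var 13) = 0"
      then have ne: "target E l u \<noteq> l u" by (simp split: if_splits)
      note tp = target_pot[OF E un l ne]
      let ?D = "D \<union> {v \<in> upper E l i u. i' \<le> l v}"
      let ?l = "l(u := i')"
      have iT: "i \<le> T" using l[OF un] by (simp add: i_def)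
      show "wp move (\<lambda>t. Q (t1 + (t2 + (expr_cost (Var 12 \<doteq> Var 13) + 1 + t)))) ?s"
      proof (rule move_spec[OF E un _ iT _ _ mc s2(1,2,3,4)])
        show "l u = i" "i' \<le> T" "i' = i + 1 \<or> (0 < i \<and> i' = i - 1)" using tp by (simp_all add: i_def i'_def)
        fix t s' assume s': "repr s' (arcs E) (min_level ?l) ?D ?l" "\<forall>a<40. a \<noteq> 14 \<longrightarrow> s' a = ?s a"
          "t \<le> 5000 * (b + 1) * (N E l i u + 1)"
        have "settled E ?D ?l"
          unfolding settled_def
        proof (intro allI impI)
          fix v assume v: "v < n" "v \<notin> ?D"
          then have "v \<noteq> u" "up_ok E l v" "down_ok E l v" using u D(2) by (auto simp: settled_def)
          then show "up_ok E ?l v \<and> down_ok E ?l v"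
            using ok_after_move[where l = l and u = u, OF E _ _ _ tp(2)] v(2) by (simp add: i_def i'_def)
        qed
        moreover have "card ?D \<le> card D + N E l i u"
        proof -
          have "card ?D \<le> card D + card {v \<in> upper E l i u. i' \<le> l v}" by (rule card_Un_le)
          also have "card {v \<in> upper E l i u. i' \<le> l v} \<le> N E l i u"
            unfolding N_def using upper_finite[OF E] by (intro card_mono) auto
          finally show ?thesis by simp
        qed
        then have "pot E ?l + int (card ?D) + int (N E l i u + 1) \<le> pot E l + int (card D)"
          using tp(3) by (simp add: i_def i'_def)
        then have "6000 * K * (pot E ?l + int (card ?D) + int (N E l i u + 1)) \<le> 6000 * K * (pot E l + int (card D))"
          using K by (intro mult_left_mono) auto
        then have "6000 * K * (pot E ?l + int (card ?D)) + 6000 * K * int (N E l i u + 1) \<le> 6000 * K * (pot E l + int (card D))"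
          by (simp only: distrib_left)
        moreover have "int t \<le> 5000 * K * int (N E l i u + 1)"
          using s'(3) unfolding K_def by (metis of_nat_le_iff of_nat_mult of_nat_numeral)
        moreover have "1000 * K * 1 \<le> 1000 * K * int (N E l i u + 1)" using K by (intro mult_left_mono) auto
        ultimately have "int (t1 + (t2 + (expr_cost (Var 12 \<doteq> Var 13) + 1 + t))) +
            6000 * K * (pot E ?l + int (card ?D)) + 100 \<le> 6000 * K * (pot E l + int (card D))"
          using t1 t2 K by (simp only: expr_cost.simps of_nat_add)
        then show "Q (t1 + (t2 + (expr_cost (Var 12 \<doteq> Var 13) + 1 + t))) s'"
          using s'(1,2) s2(5) \<open>settled E ?D ?l\<close> unfolding K_def
          by (intro Q[of _ ?l ?D]) simp_all
      qed
    qed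
  qed
qed

text \<open>The joint worth of potential and marks is the budget in \<open>wp_Loop\<close>, so
  termination of the settling process comes with the amortized bound.\<close>

lemma settle_spec:
  assumes r: "repr s (arcs E) (min_level l) D l" and mc: "card (arcs E) \<le> 2 * mcap + 2"
    and E: "simple_edges n E" and D: "settled E D l"
    and Q: "\<And>t s' l'. repr s' (arcs E) (min_level l') {} l' \<Longrightarrow> settled E {} l' \<Longrightarrow> s' 9 = s 9 \<Longrightarrow>
      int t + 6000 * int (b + 1) * pot E l' \<le> 6000 * int (b + 1) * (pot E l + int (card D)) + 50 \<Longrightarrow> Q t s'"
  shows "wp (settle B) Q s"
proof -
  define F where "F l D = 6000 * int (b + 1) * (pot E l + int (card D))" for l and D :: "nat set"
  let ?c = "row_test (Var 6 \<ominus> Lit 1)"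
  let ?I = "\<lambda>k s'. \<exists>l' D'. repr s' (arcs E) (min_level l') D' l' \<and> settled E D' l' \<and> s' 9 = s 9 \<and> int k = F l' D'"
  have F: "0 \<le> F l' D'" if "repr s' (arcs E) (min_level l') D' l'" for s' l' D'
    using pot_nonneg[OF E reprD(9)[OF that]] by (simp add: F_def)
  show ?thesis
    unfolding settle_def
  proof (rule wp_Loop[where I = ?I and k = "nat (F l D)"])
    show "?I (nat (F l D)) s" using r D F[OF r] by (intro exI[of _ l] exI[of _ D]) simp
  next
    fix k s' assume "?I k s'"
    then show "ok s' ?c" using marked_test(1)[OF _ mc] by blast
  next
    fix k s' assume I: "?I k s'" and c: "val s' ?c \<noteq> 0"
    then obtain l' D' where *: "repr s' (arcs E) (min_level l') D' l'" "settled E D' l'" "s' 9 = s 9" "int k = F l' D'" by blast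
    have "D' \<noteq> {}" using marked_test(2)[OF *(1) mc] c by blast
    then show "wp (settle_step B) (\<lambda>t s'. \<exists>k'. ?I k' s' \<and> k' + t + expr_cost ?c + 1 \<le> k) s'"
    proof (rule settle_step_spec[OF *(1) mc E _ *(2)], goal_cases)
      case (1 t s'' l'' D'')
      have "int t + F l'' D'' + 100 \<le> F l' D'" using 1(4) by (simp add: F_def)
      then have "nat (F l'' D'') + t + expr_cost ?c + 1 \<le> k" using *(4) F[OF 1(1)] by simp
      then show ?case
        using 1(1,2,3) *(3) F[OF 1(1)]
        by (intro exI[of _ "nat (F l'' D'')"] conjI exI[of _ l''] exI[of _ D'']) simp_all
    qed
  next
    fix k t s' assume I: "?I k s'" and c: "val s' ?c = 0" and t: "t + k \<le> nat (F l D) + expr_cost ?c + 1"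
    then obtain l' D' where *: "repr s' (arcs E) (min_level l') D' l'" "settled E D' l'" "s' 9 = s 9" "int k = F l' D'" by blast
    have D': "D' = {}" using marked_test(2)[OF *(1) mc] c by blast
    have "int t + F l' {} \<le> F l D + 50" using t *(4) F[OF r] D' by simp
    then show "Q t s'" using * unfolding D' by (intro Q[of _ l']) (simp_all add: F_def)
  qed
qed

text \<open>The downward scan stops because \<open>n \<ge> 1\<close> makes some level
  nonempty.\<close>

lemma find_top_spec:
  assumes r: "repr s A lab D l" and Q: "\<And>t i. i \<le> T \<Longrightarrow> \<exists>u<n. l u = i \<Longrightarrow> \<forall>u<n. l u \<le> i \<Longrightarrow> t \<le> 30 * (T + 1) \<Longrightarrow> Q t (s(10 := i))"
  shows "wp find_top Q s"
proof -
  let ?c = "Arr 2 (Var 10) \<doteq> Lit 0"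
  let ?I = "\<lambda>k s'. \<exists>i\<le>T. s' = s(10 := i) \<and> (\<forall>u<n. l u \<le> i) \<and> k = 20 * i"
  note [simp] = ok_Var cell_less
  have [simp]: "s 3 = T" using reprD(2)[OF r] .
  have l: "\<forall>u<n. l u \<le> T" using reprD(9)[OF r] by simp
  have empty: "s (cell 2 i) = 0 \<longleftrightarrow> \<not> (\<exists>u<n. l u = i)" if "i \<le> T" for i
    using reprD(13)[OF r that] by auto
  show ?thesis
    unfolding find_top_def
  proof (rule wp_Seq, rule wp_Var)
    show "(10::nat) < 64" "ok s (Var 3)" by simp_all
    show "wp (Loop ?c (10 :=\<^sub>v (Var 10 \<ominus> Lit 1))) (\<lambda>t'. Q (expr_cost (Var 3) + 2 + t')) (s(10 := val s (Var 3)))"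
    proof (rule wp_Loop[where I = ?I and k = "20 * T"])
      show "?I (20 * T) (s(10 := val s (Var 3)))" using l by (intro exI[of _ T]) simp
    next
      fix k s' assume "?I k s'"
      then show "ok s' ?c" using index_bounds(4) by auto
    next
      fix k s' assume I: "?I k s'" and c: "val s' ?c \<noteq> 0"
      then obtain i where i: "i \<le> T" "s' = s(10 := i)" "\<forall>u<n. l u \<le> i" "k = 20 * i" by blast
      have "\<not> (\<exists>u<n. l u = i)" using c i(2) empty[OF i(1)] by (simp split: if_splits)
      then have less: "\<forall>u<n. l u < i" using i(3) le_neq_implies_less by blast
      then have "0 < i" using n_pos by (metis gr0I less_nat_zero_code less_one linorder_neqE_nat not_le)
      then show "wp (10 :=\<^sub>v (Var 10 \<ominus> Lit 1)) (\<lambda>t s'. \<exists>k'. ?I k' s' \<and> k' + t + expr_cost ?c + 1 \<le> k) s'"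
        using less i(1,4) unfolding i(2)
        by (intro wp_Var exI[of _ "20 * (i - 1)"] conjI exI[of _ "i - 1"]) auto
    next
      fix k t s' assume I: "?I k s'" and c: "val s' ?c = 0" and t: "t + k \<le> 20 * T + expr_cost ?c + 1"
      then obtain i where i: "i \<le> T" "s' = s(10 := i)" "\<forall>u<n. l u \<le> i" by blast
      have "\<exists>u<n. l u = i" using c i(2) empty[OF i(1)] by (simp split: if_splits)
      then show "Q (expr_cost (Var 3) + 2 + t) s'"
        using i t unfolding i(2) by (intro Q) simp_all
    qed
  qed
qed

end

section \<open>Updates and queries\<close>

definition lower_level :: com where
  "lower_level = Cond (Arr 0 (Var 0) \<lless> Arr 0 (Var 1)) (12 :=\<^sub>v Arr 0 (Var 0)) (12 :=\<^sub>v Arr 0 (Var 1))"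

definition finish_update :: "nat \<Rightarrow> com" where
  "finish_update B = (mark 0 ;; mark 1 ;; settle B ;; find_top)"

definition insert_program :: "nat \<Rightarrow> com" where
  "insert_program B = (lower_level ;; add_arc 0 1 12 ;; add_arc 1 0 12 ;;
     9 :=\<^sub>v (Var 9 \<oplus> Lit 1) ;; finish_update B)"

definition delete_program :: "nat \<Rightarrow> com" where
  "delete_program B = (lower_level ;; del_arc 0 1 12 ;; del_arc 1 0 12 ;;
     9 :=\<^sub>v (Var 9 \<ominus> Lit 1) ;; finish_update B)"

text \<open>The empty graph is treated separately: its optimum is 0, whereas the fraction computed
  from the highest level is positive.\<close>

definition query_program :: "nat \<Rightarrow> com" where
  "query_program B = Cond (Var 9)
     (0 :=\<^sub>v (Arr 3 (Var 10) \<otimes> Lit (B * B)) ;; 1 :=\<^sub>v (Var 4 \<otimes> Lit (2 * (B + 1) * (B + 2))))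
     (0 :=\<^sub>v Lit 0 ;; 1 :=\<^sub>v Lit 1)"

lemma arcs_insert: "arcs (E \<union> {{u, v}}) = insert (v, u) (insert (u, v) (arcs E))"
  by (auto simp: arcs_def doubleton_eq_iff)

lemma arcs_delete: "arcs (E - {{u, v}}) = arcs E - {(u, v)} - {(v, u)}"
  by (auto simp: arcs_def doubleton_eq_iff)

lemma finite_arcs_simple: "simple_edges n E \<Longrightarrow> finite (arcs E)"
  by (rule finite_subset[of _ "{..<n} \<times> {..<n}"]) (auto simp: arcs_def dest: simple_edgesD)

lemma card_arcs:
  assumes "simple_edges n E"
  shows "card (arcs E) = 2 * card E"
  using simple_edges_finite[OF assms] assms
proof (induction E rule: finite_induct)
  case (insert e E)
  have E: "simple_edges n E" using insert.prems by (simp add: simple_edges_def)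
  obtain u v where e: "e = {u, v}" "u \<noteq> v" using insert.prems by (auto simp: simple_edges_def)
  have "(u, v) \<notin> arcs E" "(v, u) \<notin> arcs E" using insert.hyps e by (auto simp: arcs_def insert_commute)
  then have "card (arcs (E \<union> {{u, v}})) = card (arcs E) + 2"
    unfolding arcs_insert using e finite_arcs_simple[OF E] by simp
  then show ?case using insert.IH[OF E] insert.hyps e by simp
qed (simp add: arcs_def)

context algorithm begin

text \<open>Neither \<open>P\<close> nor \<open>W\<close> nor \<open>mcap\<close> occurs, so the
  invariant passes from one instance of the locale to the next although the capacity changes with
  the number of edges.\<close>

definition good :: "memory \<Rightarrow> nat set set \<Rightarrow> (nat \<Rightarrow> nat) \<Rightarrow> bool" where
  "good s E l \<longleftrightarrow> simple_edges n E \<and> repr s (arcs E) (min_level l) {} l \<and> settled E {} l \<and> s 9 = card E \<and>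
     (\<exists>u<n. l u = s 10) \<and> (\<forall>u<n. l u \<le> s 10)"

text \<open>It dominates the increase of the potential under insertion and under deletion, together
  with \<open>T + 5\<close> units for the scan, the marks and the work on the tries.\<close>

definition upd :: int where
  "upd = 2 * int T * int (M * B + 4) + 9 * int (T + 1) + 6"

lemma lower_level_spec:
  assumes r: "repr s A lab D l" and uv: "s 0 = u" "s 1 = v" "u < n" "v < n"
    and Q: "\<And>t. t \<le> 50 \<Longrightarrow> Q t (s(12 := min (l u) (l v)))"
  shows "wp lower_level Q s"
proof -
  note [simp] = ok_Var cell_less
  have [simp]: "s (cell 0 u) = l u" "s (cell 0 v) = l v" using reprD(11)[OF r] uv by auto
  have [simp]: "s 0 = u" "s (Suc 0) = v" "u < P" "v < P" using uv index_bounds by auto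
  have Q1: "Q t (s(12 := l u))" if "t \<le> 50" "l u < l v" for t using Q[OF that(1)] that(2) by simp
  have Q2: "Q t (s(12 := l v))" if "t \<le> 50" "\<not> l u < l v" for t using Q[OF that(1)] that(2) by (simp add: min.absorb2)
  show ?thesis
    unfolding lower_level_def
    apply (rule wp_Cond)
    subgoal by simp
    subgoal
      apply (rule wp_steps; simp?)+
      using Q1 by (simp split: if_split_asm)
    subgoal
      apply (rule wp_steps; simp?)+
      using Q2 by (simp split: if_split_asm)
    done
qed

text \<open>Of the additional \<open>T + 4\<close> units, \<open>T\<close> pay for the scan in
  \<open>find_top\<close>; the others cover the worth of two marks, setting them, and the loop
  overhead.\<close>

lemma finish_update_spec:
  assumes r: "repr s (arcs E) (min_level l) {} l" and mc: "card E \<le> mcap"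
    and E: "simple_edges n E" and D: "settled E {u, v} l" and uv: "s 0 = u" "s 1 = v" "u < n" "v < n"
    and m: "s 9 = card E"
    and Q: "\<And>t s' l'. good s' E l' \<Longrightarrow>
      int t + 6000 * int (b + 1) * pot E l' \<le> 6000 * int (b + 1) * (pot E l + int T + 4) \<Longrightarrow> Q t s'"
  shows "wp (finish_update B) Q s"
  unfolding finish_update_def
proof (rule wp_Seq)
  define K where "K = int (b + 1)"
  have mc': "card (arcs E) \<le> 2 * mcap + 2" using mc card_arcs[OF E] by simp
  show "wp (mark 0) (\<lambda>t s'. wp (mark 1 ;; settle B ;; find_top) (\<lambda>t'. Q (t + t')) s') s"
  proof (rule mark_spec[OF r mc' _ uv(1,3)])
    fix t1 s1 assume s1: "repr s1 (arcs E) (min_level l) (insert u {}) l" "\<forall>a<40. s1 a = s a" "t1 \<le> 200 * (b + 1)"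
    show "wp (mark 1 ;; settle B ;; find_top) (\<lambda>t'. Q (t1 + t')) s1"
    proof (rule wp_Seq, rule mark_spec[OF s1(1) mc' _ _ uv(4)])
      show "(1::nat) < 40" "s1 1 = v" using s1(2) uv(2) by simp_all
      fix t2 s2 assume s2: "repr s2 (arcs E) (min_level l) (insert v (insert u {})) l" "\<forall>a<40. s2 a = s1 a" "t2 \<le> 200 * (b + 1)"
      have D': "settled E (insert v (insert u {})) l" using D by (simp add: settled_def insert_commute)
      have "card (insert v (insert u {})) \<le> 2" by (simp add: card_insert_if)
      then have cD: "6000 * K * int (card (insert v (insert u {}))) \<le> 6000 * K * 2"
        by (intro mult_left_mono) (auto simp: K_def)
      show "wp (settle B ;; find_top) (\<lambda>t'. Q (t1 + (t2 + t'))) s2"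
      proof (rule wp_Seq, rule settle_spec[OF s2(1) mc' E D'])
        fix t3 s3 l' assume s3: "repr s3 (arcs E) (min_level l') {} l'" "settled E {} l'" "s3 9 = s2 9"
          "int t3 + 6000 * int (b + 1) * pot E l' \<le> 6000 * int (b + 1) * (pot E l + int (card (insert v (insert u {})))) + 50"
        show "wp find_top (\<lambda>t'. Q (t1 + (t2 + (t3 + t')))) s3"
        proof (rule find_top_spec[OF s3(1)])
          fix t4 i assume i: "i \<le> T" "\<exists>u<n. l' u = i" "\<forall>u<n. l' u \<le> i" "t4 \<le> 30 * (T + 1)"
          have "good (s3(10 := i)) E l'"
            using s3(1,2,3) i(2,3) s2(2) s1(2) m E by (simp add: good_def)
          moreover have "int (t1 + (t2 + (t3 + t4))) + 6000 * K * pot E l' \<le> 6000 * K * (pot E l + int T + 4)"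
          proof -
            have "int t3 + 6000 * K * pot E l' \<le> 6000 * K * pot E l + 6000 * K * 2 + 50"
              using s3(4) cD unfolding K_def distrib_left by linarith
            moreover have "int t1 \<le> 200 * K" "int t2 \<le> 200 * K"
              using s1(3) s2(3) unfolding K_def by linarith+
            moreover have "int t4 \<le> 6000 * K * int T + 30"
            proof -
              have "30 * int T \<le> 6000 * K * int T" by (intro mult_right_mono) (auto simp: K_def)
              moreover have "int t4 \<le> 30 * int T + 30" using of_nat_mono[OF i(4), where ?'a = int] by simp
              ultimately show ?thesis by (rule order_trans[rotated, OF add_right_mono])
            qed
            moreover have "1 \<le> K" by (simp add: K_def)
            ultimately show ?thesis unfolding distrib_left of_nat_add by linarith
          qed
          ultimately show "Q (t1 + (t2 + (t3 + t4))) (s3(10 := i))" unfolding K_def by (rule Q)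
        qed
      qed
    qed
  qed simp
qed

text \<open>Only the endpoints of the changed edge have a different neighbourhood, so marking these
  two restores the invariant of \<open>settle\<close>.\<close>

lemma settled_change:
  assumes "settled E {} l" and "\<And>w x. w \<notin> {u, v} \<Longrightarrow> {w, x} \<in> E' \<longleftrightarrow> {w, x} \<in> E"
  shows "settled E' {u, v} l"
proof -
  have "N E' l j w = N E l j w" if "w \<notin> {u, v}" for j w
    using assms(2)[OF that] by (simp add: N_def upper_def)
  then show ?thesis using assms(1) by (auto simp: settled_def up_ok_def down_ok_def)
qed

lemma mcap_less: "mcap < P" 
proof -
  have "1 * (2 * mcap + n + 3) \<le> b * (2 * mcap + n + 3)" using b_ge by (intro mult_le_mono1)
  then have "2 * mcap + n + 3 \<le> P" using cap by (metis add_leD2 le_trans mult_1)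
  then show ?thesis by linarith
qed

lemma time_unit: "int x \<le> 2000 * int (b + 1) \<Longrightarrow> int t + 6000 * int (b + 1) * p' \<le> 6000 * int (b + 1) * (p + int T + 4) \<Longrightarrow>
    p \<le> p0 + q \<Longrightarrow> q + int T + 5 \<le> upd \<Longrightarrow> int (x + t) + 6000 * int (b + 1) * p' \<le> 6000 * int (b + 1) * (p0 + upd)"
proof -
  assume a: "int x \<le> 2000 * int (b + 1)" "int t + 6000 * int (b + 1) * p' \<le> 6000 * int (b + 1) * (p + int T + 4)"
    "p \<le> p0 + q" "q + int T + 5 \<le> upd"
  have "6000 * int (b + 1) * (p + int T + 5) \<le> 6000 * int (b + 1) * (p0 + upd)"
    using a(3,4) by (intro mult_left_mono) auto
  moreover have "6000 * int (b + 1) * (p + int T + 5) = 6000 * int (b + 1) * (p + int T + 4) + 6000 * int (b + 1)"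
    by (simp add: algebra_simps)
  ultimately show ?thesis using a(1,2) unfolding of_nat_add by linarith
qed

lemma insert_spec:
  assumes g: "good s E l" and can: "can_insert n E u v" and mc: "card E + 1 \<le> mcap"
    and Q: "\<And>t s' l'. good s' (E \<union> {{u, v}}) l' \<Longrightarrow>
      int t + 6000 * int (b + 1) * pot (E \<union> {{u, v}}) l' \<le> 6000 * int (b + 1) * (pot E l + upd) \<Longrightarrow> Q t s'"
  shows "wp (insert_program B) Q (with_operands s u v)"
proof -
  let ?E = "E \<union> {{u, v}}"
  have uv: "u < n" "v < n" "u \<noteq> v" "{u, v} \<notin> E" using can by (auto simp: can_insert_def)
  have E: "simple_edges n E" and r: "repr s (arcs E) (min_level l) {} l" and st: "settled E {} l" and m: "s 9 = card E"
    using g by (auto simp: good_def)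
  have E': "simple_edges n ?E" using E uv by (auto simp: simple_edges_def)
  have cE: "card ?E = card E + 1" using uv(4) simple_edges_finite[OF E] by simp
  let ?s = "with_operands s u v"
  have s: "repr ?s (arcs E) (min_level l) {} l" "?s 0 = u" "?s 1 = v" "?s 9 = card E"
    using r m by (simp_all add: with_operands_def)
  define j where "j = min (l u) (l v)"
  have j: "j < T + 2" using reprD(9)[OF r uv(1)] by (simp add: j_def)
  have cA: "card (arcs E) \<le> 2 * mcap + 1" "card (insert (u, v) (arcs E)) \<le> 2 * mcap + 1"
    using card_arcs[OF E] mc finite_arcs_simple[OF E] by (simp_all add: card_insert_if)
  have na: "(u, v) \<notin> arcs E" "(v, u) \<notin> insert (u, v) (arcs E)" using uv by (auto simp: arcs_def insert_commute)
  have lab: "(min_level l)((u, v) := j) = min_level l" "(min_level l)((v, u) := j) = min_level l"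
    by (auto simp: min_level_def j_def fun_eq_iff min.commute)
  have st': "settled ?E {u, v} l" by (rule settled_change[OF st]) (auto simp: doubleton_eq_iff)
  have pot: "pot ?E l \<le> pot E l + 8 * int (T + 1)" by (rule pot_insert[OF E uv])
  have upd: "8 * int (T + 1) + int T + 5 \<le> upd" by (simp add: upd_def)
  show ?thesis
    unfolding insert_program_def
  proof (rule wp_Seq, rule lower_level_spec[OF s(1,2,3) uv(1,2)], rule wp_Seq)
    fix t0 :: nat assume t0: "t0 \<le> 50"
    let ?s0 = "?s(12 := min (l u) (l v))"
    have s0: "repr ?s0 (arcs E) (min_level l) {} l" using s(1) by simp
    show "wp (add_arc 0 1 12) (\<lambda>t s'. wp (add_arc 1 0 12 ;; 9 :=\<^sub>v (Var 9 \<oplus> Lit 1) ;; finish_update B) (\<lambda>t'. Q (t0 + (t + t'))) s') ?s0"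
    proof (rule add_arc_spec[OF s0 cA(1), where x = u and y = v and j = j])
      fix t1 s1 assume s1': "repr s1 (insert (u, v) (arcs E)) ((min_level l)((u, v) := j)) {} l" "\<forall>a<40. s1 a = ?s0 a" "t1 \<le> 250 * (b + 1)"
      note s1 = s1'(1)[unfolded lab]
      have regs: "s1 0 = u" "s1 1 = v" "s1 12 = j" "s1 9 = card E" using s1'(2) s(2,3,4) by (simp_all add: j_def)
      show "wp (add_arc 1 0 12 ;; 9 :=\<^sub>v (Var 9 \<oplus> Lit 1) ;; finish_update B) (\<lambda>t'. Q (t0 + (t1 + t'))) s1"
      proof (rule wp_Seq, rule add_arc_spec[OF s1 cA(2), where x = v and y = u and j = j])
        fix t2 s2 assume s2': "repr s2 (insert (v, u) (insert (u, v) (arcs E))) ((min_level l)((v, u) := j)) {} l"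
          "\<forall>a<40. s2 a = s1 a" "t2 \<le> 250 * (b + 1)"
        have s2: "repr s2 (arcs ?E) (min_level l) {} l" using s2'(1) by (simp only: lab arcs_insert)
        have regs2: "s2 0 = u" "s2 1 = v" "s2 9 = card E" using s2'(2) regs by simp_all
        show "wp (9 :=\<^sub>v (Var 9 \<oplus> Lit 1) ;; finish_update B) (\<lambda>t'. Q (t0 + (t1 + (t2 + t')))) s2"
        proof (rule wp_Seq, rule wp_Var)
          show "(9::nat) < 64" by simp
          show "ok s2 (Var 9 \<oplus> Lit 1)" using regs2 mcap_less mc P_le by (simp add: ok_Var)
          let ?s3 = "s2(9 := val s2 (Var 9 \<oplus> Lit 1))"
          have s3: "repr ?s3 (arcs ?E) (min_level l) {} l" "?s3 0 = u" "?s3 1 = v" "?s3 9 = card ?E"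
            using s2 regs2 cE by simp_all
          show "wp (finish_update B) (\<lambda>t'. Q (t0 + (t1 + (t2 + (expr_cost (Var 9 \<oplus> Lit 1) + 2 + t'))))) ?s3"
          proof (rule finish_update_spec[OF s3(1) _ E' st' s3(2,3) uv(1,2) s3(4)])
            show "card ?E \<le> mcap" using cE mc by simp
            fix t s' l' assume *: "good s' ?E l'"
              "int t + 6000 * int (b + 1) * pot ?E l' \<le> 6000 * int (b + 1) * (pot ?E l + int T + 4)"
            have "int (t0 + (t1 + (t2 + (expr_cost (Var 9 \<oplus> Lit 1) + 2)))) \<le> 2000 * int (b + 1)"
              using t0 s1'(3) s2'(3) by simp
            from Q[OF *(1) time_unit[OF this *(2) pot upd]]
            show "Q (t0 + (t1 + (t2 + (expr_cost (Var 9 \<oplus> Lit 1) + 2 + t)))) s'" by (simp only: add.assoc)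
          qed
        qed
      qed (use regs uv j na in simp_all)
    qed (use s(2,3) uv j na in \<open>simp_all add: j_def\<close>)
  qed
qed

lemma delete_spec:
  assumes g: "good s E l" and can: "can_delete E u v" and mc: "card E \<le> mcap"
    and Q: "\<And>t s' l'. good s' (E - {{u, v}}) l' \<Longrightarrow>
      int t + 6000 * int (b + 1) * pot (E - {{u, v}}) l' \<le> 6000 * int (b + 1) * (pot E l + upd) \<Longrightarrow> Q t s'"
  shows "wp (delete_program B) Q (with_operands s u v)"
proof -
  let ?E = "E - {{u, v}}"
  have E: "simple_edges n E" and r: "repr s (arcs E) (min_level l) {} l" and st: "settled E {} l" and m: "s 9 = card E"
    using g by (auto simp: good_def)
  have uvE: "{u, v} \<in> E" using can by (simp add: can_delete_def)
  note uv = simple_edgesD[OF E uvE]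
  have E': "simple_edges n ?E" using E by (simp add: simple_edges_def)
  have cE: "card ?E = card E - 1" "card E > 0" using uvE simple_edges_finite[OF E] by (auto simp: card_gt_0_iff)
  let ?s = "with_operands s u v"
  have s: "repr ?s (arcs E) (min_level l) {} l" "?s 0 = u" "?s 1 = v" "?s 9 = card E"
    using r m by (simp_all add: with_operands_def)
  define j where "j = min (l u) (l v)"
  have cA: "card (arcs E) \<le> 2 * mcap + 2" "card (arcs E - {(u, v)}) \<le> 2 * mcap + 2"
    using card_arcs[OF E] mc card_Diff1_le[of "arcs E" "(u, v)"] by linarith+
  have na: "(u, v) \<in> arcs E" "(v, u) \<in> arcs E - {(u, v)}" using uv uvE by (auto simp: arcs_def insert_commute)
  have lab: "min_level l (u, v) = j" "min_level l (v, u) = j"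
    by (auto simp: min_level_def j_def)
  have st': "settled ?E {u, v} l" by (rule settled_change[OF st]) (auto simp: doubleton_eq_iff)
  have pot: "pot ?E l \<le> pot E l + 2 * int T * int (M * B + 4)" by (rule pot_delete[OF E uvE reprD(9)[OF r]])
  have upd: "2 * int T * int (M * B + 4) + int T + 5 \<le> upd" by (simp add: upd_def)
  show ?thesis
    unfolding delete_program_def
  proof (rule wp_Seq, rule lower_level_spec[OF s(1,2,3) uv(1,2)], rule wp_Seq)
    fix t0 :: nat assume t0: "t0 \<le> 50"
    let ?s0 = "?s(12 := min (l u) (l v))"
    have s0: "repr ?s0 (arcs E) (min_level l) {} l" using s(1) by simp
    show "wp (del_arc 0 1 12) (\<lambda>t s'. wp (del_arc 1 0 12 ;; 9 :=\<^sub>v (Var 9 \<ominus> Lit 1) ;; finish_update B) (\<lambda>t'. Q (t0 + (t + t'))) s') ?s0"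
    proof (rule del_arc_spec[OF s0 cA(1), where x = u and y = v and j = j])
      fix t1 s1 assume s1: "repr s1 (arcs E - {(u, v)}) (min_level l) {} l" "\<forall>a<40. s1 a = ?s0 a" "t1 \<le> 600 * (b + 1)"
      have regs: "s1 0 = u" "s1 1 = v" "s1 12 = j" "s1 9 = card E" using s1(2) s(2,3,4) by (simp_all add: j_def)
      show "wp (del_arc 1 0 12 ;; 9 :=\<^sub>v (Var 9 \<ominus> Lit 1) ;; finish_update B) (\<lambda>t'. Q (t0 + (t1 + t'))) s1"
      proof (rule wp_Seq, rule del_arc_spec[OF s1(1) cA(2), where x = v and y = u and j = j])
        fix t2 s2 assume s2': "repr s2 (arcs E - {(u, v)} - {(v, u)}) (min_level l) {} l"
          "\<forall>a<40. s2 a = s1 a" "t2 \<le> 600 * (b + 1)"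
        have s2: "repr s2 (arcs ?E) (min_level l) {} l" using s2'(1) by (simp only: arcs_delete)
        have regs2: "s2 0 = u" "s2 1 = v" "s2 9 = card E" using s2'(2) regs by simp_all
        show "wp (9 :=\<^sub>v (Var 9 \<ominus> Lit 1) ;; finish_update B) (\<lambda>t'. Q (t0 + (t1 + (t2 + t')))) s2"
        proof (rule wp_Seq, rule wp_Var)
          show "(9::nat) < 64" by simp
          show "ok s2 (Var 9 \<ominus> Lit 1)" by (simp add: ok_Var)
          let ?s3 = "s2(9 := val s2 (Var 9 \<ominus> Lit 1))"
          have s3: "repr ?s3 (arcs ?E) (min_level l) {} l" "?s3 0 = u" "?s3 1 = v" "?s3 9 = card ?E"
            using s2 regs2 cE by simp_all
          show "wp (finish_update B) (\<lambda>t'. Q (t0 + (t1 + (t2 + (expr_cost (Var 9 \<ominus> Lit 1) + 2 + t'))))) ?s3"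
          proof (rule finish_update_spec[OF s3(1) _ E' st' s3(2,3) uv(1,2) s3(4)])
            show "card ?E \<le> mcap" using cE mc by simp
            fix t s' l' assume *: "good s' ?E l'"
              "int t + 6000 * int (b + 1) * pot ?E l' \<le> 6000 * int (b + 1) * (pot ?E l + int T + 4)"
            have "int (t0 + (t1 + (t2 + (expr_cost (Var 9 \<ominus> Lit 1) + 2)))) \<le> 2000 * int (b + 1)"
              using t0 s1(3) s2'(3) by simp
            from Q[OF *(1) time_unit[OF this *(2) pot upd]]
            show "Q (t0 + (t1 + (t2 + (expr_cost (Var 9 \<ominus> Lit 1) + 2 + t)))) s'" by (simp only: add.assoc)
          qed
        qed
      qed (use regs uv na lab in simp_all)
    qed (use s(2,3) uv na lab in \<open>simp_all add: j_def\<close>)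
  qed
qed

lemma query_spec:
  assumes g: "good s E l"
    and Q: "\<And>t s'. good s' E l \<Longrightarrow> t \<le> 40 \<Longrightarrow> s' 1 \<noteq> 0 \<Longrightarrow>
      approximates (4 + 140 / B) (max_density {..<n} E) (real (s' 0) / real (s' 1)) \<Longrightarrow> Q t s'"
  shows "wp (query_program B) Q s"
proof -
  have E: "simple_edges n E" and r: "repr s (arcs E) (min_level l) {} l" and st: "settled E {} l" and m: "s 9 = card E"
    and top: "\<exists>u<n. l u = s 10" "\<forall>u<n. l u \<le> s 10"
    using g by (auto simp: good_def)
  have g': "good (s(0 := x, Suc 0 := y)) E l" for x y using g by (simp add: good_def)
  define i where "i = s 10"
  obtain u where u: "u < n" "l u = i" using top(1) by (auto simp: i_def)
  have i: "i \<le> T" using reprD(9)[OF r u(1)] u(2) by simp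
  show ?thesis
  proof (cases "E = {}")
    case True
    then have [simp]: "s 9 = 0" using m by simp
    have "density {} S = 0" for S :: "nat set" by (simp add: density_def induced_edges_def)
    then have "density {} ` {S. S \<subseteq> {..<n} \<and> S \<noteq> {}} = {0}"
      using u(1) by (auto intro!: image_eqI[of 0 _ "{u}"])
    then have "max_density {..<n} E = 0" unfolding max_density_def True by simp
    then have Q0: "Q t (s(0 := 0, Suc 0 := Suc 0))" if "t \<le> 40" for t
      using that by (intro Q g') (simp_all add: approximates_def)
    note [simp] = ok_Var
    show ?thesis
      unfolding query_program_def
      apply (rule wp_Cond)
        apply simp
       apply simp
      apply (rule wp_steps; simp?)+
      using Q0 by simp
  next
    case False
    then have m0: "s 9 \<noteq> 0" using m simple_edges_finite[OF E] by simp
    have BB: "B * B \<le> 12 * B * B" "thr M T \<ge> 1" "1 \<le> B * B" using B_ge thr_ge[of M T] M_ge by (auto simp: Suc_le_eq)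
    have b1: "thr M i * (B * B) < W"
    proof -
      have "thr M i * (B * B) \<le> thr M T * (12 * B * B)" using thr_mono[OF i] BB(1) by (rule mult_le_mono)
      then show ?thesis using word by (simp only: mult.commute)
    qed
    have b2: "M * (2 * (B + 1) * (B + 2)) < W" "2 * (B + 1) * (B + 2) < W" "B * B < W"
    proof -
      have "(B + 1) * (B + 2) \<le> (2 * B) * (2 * B)" using B_ge by (intro mult_le_mono) auto
      then have *: "2 * (B + 1) * (B + 2) \<le> 12 * B * B" by simp
      then have "M * (2 * (B + 1) * (B + 2)) \<le> thr M T * (12 * B * B)" by (rule mult_le_mono[OF thr_ge])
      then show 1: "M * (2 * (B + 1) * (B + 2)) < W" using word by (simp only: mult.commute)
      have "1 * (2 * (B + 1) * (B + 2)) \<le> M * (2 * (B + 1) * (B + 2))" using M_ge by (intro mult_le_mono1) simp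
      then show 2: "2 * (B + 1) * (B + 2) < W" using 1 by linarith
      have "1 * (B * B) \<le> thr M T * (12 * B * B)" using BB by (intro mult_le_mono) auto
      then show "B * B < W" using word by (simp only: mult.commute mult_1_left)
    qed
    have est: "approximates (4 + 140 / B) (max_density {..<n} E)
        (real (thr M i * (B * B)) / real (M * (2 * (B + 1) * (B + 2))))"
      using estimate[where l = l, OF E False _ u] st top(2) by (auto simp: settled_def i_def)
    define X where "X = B * B"
    define Y where "Y = 2 * (B + 1) * (B + 2)"
    have [simp]: "thr M i * X < W" "M * Y < W" "X < W" "Y < W" using b1 b2 by (simp_all only: X_def Y_def)
    have Y0: "0 < M * Y" using M_ge by (simp add: Y_def)
    have est': "approximates (4 + 140 / B) (max_density {..<n} E) (real (thr M i * X) / real (M * Y))"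
      using est by (simp only: X_def Y_def)
    have Q1: "Q t (s(0 := thr M i * X, Suc 0 := M * Y))" if "t \<le> 40" for t
    proof (rule Q[OF g' that])
      show "(s(0 := thr M i * X, Suc 0 := M * Y)) 1 \<noteq> 0" using Y0 by simp
      show "approximates (4 + 140 / B) (max_density {..<n} E)
        (real ((s(0 := thr M i * X, Suc 0 := M * Y)) 0) / real ((s(0 := thr M i * X, Suc 0 := M * Y)) 1))"
        using est' by simp
    qed
    note [simp] = ok_Var cell_less
    have [simp]: "s 10 = i" "s 4 = M" "s (cell 3 i) = thr M i" "i < P"
      using reprD(3)[OF r] reprD(14)[OF r i] index_bounds(4)[OF i] by (simp_all add: i_def)
    show ?thesis
      unfolding query_program_def X_def[symmetric] Y_def[symmetric]
      apply (rule wp_Cond)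
        apply simp
       apply (rule wp_steps; simp?)+
       apply (rule Q1)
       apply simp
      using m0 by simp
  qed
qed

end

section \<open>Preprocessing\<close>

definition bits_loop :: com where
  "bits_loop = Loop (Var 5 \<lless> Var 2) (5 :=\<^sub>v (Var 5 \<otimes> Lit 2) ;; 19 :=\<^sub>v (Var 19 \<oplus> Lit 1))"

definition constants :: "nat \<Rightarrow> com" where
  "constants B = (19 :=\<^sub>v (Var 19 \<oplus> Lit 1) ;; 4 :=\<^sub>v (Lit (B * B) \<otimes> Var 19) ;;
     3 :=\<^sub>v (Lit 2 \<otimes> Var 4 \<otimes> Var 19) ;; 8 :=\<^sub>v (Var 3 \<oplus> Lit 2) ;; 15 :=\<^sub>v (Var 3 \<oplus> Lit 1) ;;
     6 :=\<^sub>v (Var 2 \<otimes> Var 8 \<oplus> Lit 1) ;; 7 :=\<^sub>v (Var 6 \<otimes> Var 5) ;; 51 :=\<^sub>v Var 6 ;;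
     Store (Addr 3 (Lit 0)) (Var 4) ;; Store (Addr 2 (Lit 0)) (Var 2) ;; 11 :=\<^sub>v Lit 0)"

definition thresholds_loop :: com where
  "thresholds_loop = Loop (Var 11 \<lless> Var 3)
     (Store (Addr 3 (Var 11 \<oplus> Lit 1)) (Arr 3 (Var 11) \<oplus> Arr 3 (Var 11) \<oslash> Var 4) ;; 11 :=\<^sub>v (Var 11 \<oplus> Lit 1))"

definition roots_loop :: com where
  "roots_loop = Loop (Var 11 \<lless> Var 6) (Store (Addr 4 (Var 11)) (Var 6 \<oplus> Var 11) ;; 11 :=\<^sub>v (Var 11 \<oplus> Lit 1))"

definition preprocess_program :: "nat \<Rightarrow> com" where
  "preprocess_program B = (2 :=\<^sub>v Var 0 ;; 5 :=\<^sub>v Lit 2 ;; 19 :=\<^sub>v Lit 1 ;; bits_loop ;;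
     constants B ;; thresholds_loop ;; 11 :=\<^sub>v Lit 0 ;; roots_loop)"

context algorithm begin

text \<open>The assumption on \<open>b\<close> excludes smaller positive exponents, so the doubling
  loop stops exactly at \<open>b\<close>.\<close>

lemma bits_loop_spec:
  assumes b: "b = 1 \<or> 2 ^ (b - 1) < n" and s: "s 2 = n" "s 5 = 2" "s 19 = 1"
    and Q: "\<And>t. t \<le> 40 * (b + 1) \<Longrightarrow> Q t (s(5 := 2 ^ b, 19 := b))"
  shows "wp bits_loop Q s"
proof -
  let ?c = "Var 5 \<lless> Var 2"
  let ?I = "\<lambda>k s'. \<exists>j. 1 \<le> j \<and> j \<le> b \<and> s' = s(5 := 2 ^ j, 19 := j) \<and> k = 30 * (b - j)"
  have bW: "2 * 2 ^ j < W" "j + 1 < W" if "j < b" for j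
  proof -
    have "(2::nat) ^ (j + 1) \<le> 2 ^ b" using that by (intro power_increasing) auto
    moreover have "1 * (2 * 2 ^ b) \<le> R * (2 * 2 ^ b)" using R_pos by (intro mult_le_mono1) simp
    moreover have "R * (2 * 2 ^ b) \<le> W" using R_b_le by (simp add: ac_simps)
    ultimately have *: "2 * (2 * 2 ^ j) \<le> W" unfolding power_add power_one_right by linarith
    then show "2 * 2 ^ j < W" using W_ge by linarith
    have "j < 2 ^ j" by simp
    then show "j + 1 < W" using * by linarith
  qed
  show ?thesis
    unfolding bits_loop_def
  proof (rule wp_Loop[where I = ?I and k = "30 * (b - 1)"])
    have "s = s(5 := 2 ^ 1, 19 := 1)" using s by (simp add: fun_eq_iff)
    then show "?I (30 * (b - 1)) s" using b_ge by (intro exI[of _ 1]) simp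
  next
    fix k s' show "ok s' ?c" by (simp add: ok_Var)
  next
    fix k s' assume I: "?I k s'" and c: "val s' ?c \<noteq> 0"
    then obtain j where j: "1 \<le> j" "j \<le> b" "s' = s(5 := 2 ^ j, 19 := j)" "k = 30 * (b - j)" by blast
    have less: "2 ^ j < n" using c j(3) s by (simp split: if_splits)
    have "j < b" using less n_le j(2) by (cases "j = b") auto
    note [simp] = ok_Var
    define post where "post = (\<lambda>t s'. \<exists>k'. ?I k' s' \<and> k' + t + expr_cost ?c + 1 \<le> k)"
    have post: "post t (s(5 := 2 ^ Suc j, 19 := Suc j))" if "t \<le> 20" for t
      unfolding post_def using that \<open>j < b\<close> j(4)
      by (intro exI[of _ "30 * (b - Suc j)"] conjI exI[of _ "Suc j"]) auto
    have [simp]: "s' 5 = 2 ^ j" "s' 19 = j" using j(3) by simp_all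
    have s': "s'(5 := 2 ^ j * 2, 19 := Suc j) = s(5 := 2 ^ Suc j, 19 := Suc j)"
      unfolding j(3) by (simp add: fun_eq_iff)
    have [simp]: "2 ^ j * 2 < W" "Suc j < W" using bW[OF \<open>j < b\<close>] by simp_all
    have "wp (5 :=\<^sub>v (Var 5 \<otimes> Lit 2) ;; 19 :=\<^sub>v (Var 19 \<oplus> Lit 1)) post s'"
      apply (rule wp_steps; simp?)+
      apply (subst s')
      apply (rule post)
      apply simp
      done
    then show "wp (5 :=\<^sub>v (Var 5 \<otimes> Lit 2) ;; 19 :=\<^sub>v (Var 19 \<oplus> Lit 1))
        (\<lambda>t s'. \<exists>k'. ?I k' s' \<and> k' + t + expr_cost ?c + 1 \<le> k) s'"
      unfolding post_def .
  next
    fix k t s' assume I: "?I k s'" and c: "val s' ?c = 0" and t: "t + k \<le> 30 * (b - 1) + expr_cost ?c + 1"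
    then obtain j where j: "1 \<le> j" "j \<le> b" "s' = s(5 := 2 ^ j, 19 := j)" by blast
    have ge: "n \<le> 2 ^ j" using c j(3) s by (simp split: if_splits)
    have "j = b"
    proof (rule ccontr)
      assume "j \<noteq> b"
      then have "(2::nat) ^ j \<le> 2 ^ (b - 1)" using j(2) by (intro power_increasing) auto
      moreover have "2 ^ (b - 1) < n" using b j(1,2) \<open>j \<noteq> b\<close> by auto
      ultimately show False using ge by linarith
    qed
    then show "Q t s'" using t j(3) by (auto intro!: Q)
  qed
qed

lemma thresholds_loop_spec:
  assumes s: "s 11 = 0" "s 3 = T" "s 4 = M" "s (cell 3 0) = M"
    and Q: "\<And>t s'. (\<forall>j\<le>T. s' (cell 3 j) = thr M j) \<Longrightarrow> (\<forall>a. a \<noteq> 11 \<longrightarrow> (\<forall>j\<le>T. a \<noteq> cell 3 j) \<longrightarrow> s' a = s a) \<Longrightarrow>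
      t \<le> 70 * (T + 1) \<Longrightarrow> Q t s'"
  shows "wp thresholds_loop Q s"
proof -
  let ?c = "Var 11 \<lless> Var 3"
  let ?I = "\<lambda>k s'. \<exists>i\<le>T. s' 11 = i \<and> (\<forall>j\<le>i. s' (cell 3 j) = thr M j) \<and>
    (\<forall>a. a \<noteq> 11 \<longrightarrow> (\<forall>j\<le>T. a \<noteq> cell 3 j) \<longrightarrow> s' a = s a) \<and> k = 60 * (T - i)"
  note [simp] = ok_Var cell_less
  show ?thesis
    unfolding thresholds_loop_def
  proof (rule wp_Loop[where I = ?I and k = "60 * T"])
    show "?I (60 * T) s" using s by (intro exI[of _ 0]) simp
  next
    fix k s' show "ok s' ?c" by simp
  next
    fix k s' assume I: "?I k s'" and c: "val s' ?c \<noteq> 0"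
    then obtain i where i: "i \<le> T" "s' 11 = i" "\<forall>j\<le>i. s' (cell 3 j) = thr M j"
      "\<forall>a. a \<noteq> 11 \<longrightarrow> (\<forall>j\<le>T. a \<noteq> cell 3 j) \<longrightarrow> s' a = s a" "k = 60 * (T - i)" by blast
    have less: "i < T" using c i(2,4) s by (simp split: if_splits)
    have [simp]: "s' 11 = i" "s' 4 = M" "s' (cell 3 i) = thr M i" using i s by auto
    have "i + 1 < P" using index_bounds(4)[of "i + 1"] less by simp
    then have [simp]: "Suc i < P" "i < P" "Suc i < W" using P_le by auto
    have "1 * thr M (Suc i) \<le> (2 * B + 10) * thr M (Suc i)" by (intro mult_le_mono1) simp
    then have "thr M (Suc i) < W"
      using word_bounds(1)[of "Suc i"] less by (simp only: mult_1_left Suc_le_eq le_less_trans)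
    then have [simp]: "thr M i + thr M i div M < W" by simp
    show "wp (Store (Addr 3 (Var 11 \<oplus> Lit 1)) (Arr 3 (Var 11) \<oplus> Arr 3 (Var 11) \<oslash> Var 4) ;; 11 :=\<^sub>v (Var 11 \<oplus> Lit 1))
        (\<lambda>t s'. \<exists>k'. ?I k' s' \<and> k' + t + expr_cost ?c + 1 \<le> k) s'"
      apply (rule wp_steps; (simp del: ex_simps)?)+
      using i less
      apply (intro exI[of _ "60 * (T - Suc i)"] conjI exI[of _ "Suc i"])
      apply (auto simp: cell_inject le_Suc_eq dest: spec[of _ "Suc i"])
      done
  next
    fix k t s' assume I: "?I k s'" and c: "val s' ?c = 0" and t: "t + k \<le> 60 * T + expr_cost ?c + 1"
    then obtain i where i: "i \<le> T" "s' 11 = i" "\<forall>j\<le>i. s' (cell 3 j) = thr M j"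
      "\<forall>a. a \<noteq> 11 \<longrightarrow> (\<forall>j\<le>T. a \<noteq> cell 3 j) \<longrightarrow> s' a = s a" by blast
    have "s' 3 = T" using i(4) s by simp
    then have "i = T" using c i(1,2) by (simp split: if_splits)
    then show "Q t s'" using i t by (intro Q) auto
  qed
qed

lemma roots_loop_spec:
  assumes s: "s 11 = 0" "s 6 = R"
    and Q: "\<And>t s'. (\<forall>j<R. s' (cell 4 j) = R + j) \<Longrightarrow> (\<forall>a. a \<noteq> 11 \<longrightarrow> (\<forall>j<R. a \<noteq> cell 4 j) \<longrightarrow> s' a = s a) \<Longrightarrow>
      t \<le> 60 * (R + 1) \<Longrightarrow> Q t s'"
  shows "wp roots_loop Q s"
proof -
  let ?c = "Var 11 \<lless> Var 6"
  let ?I = "\<lambda>k s'. \<exists>i\<le>R. s' 11 = i \<and> (\<forall>j<i. s' (cell 4 j) = R + j) \<and>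
    (\<forall>a. a \<noteq> 11 \<longrightarrow> (\<forall>j<R. a \<noteq> cell 4 j) \<longrightarrow> s' a = s a) \<and> k = 50 * (R - i)"
  note [simp] = ok_Var cell_less
  show ?thesis
    unfolding roots_loop_def
  proof (rule wp_Loop[where I = ?I and k = "50 * R"])
    show "?I (50 * R) s" using s by (intro exI[of _ 0]) simp
  next
    fix k s' show "ok s' ?c" by simp
  next
    fix k s' assume I: "?I k s'" and c: "val s' ?c \<noteq> 0"
    then obtain i where i: "i \<le> R" "s' 11 = i" "\<forall>j<i. s' (cell 4 j) = R + j"
      "\<forall>a. a \<noteq> 11 \<longrightarrow> (\<forall>j<R. a \<noteq> cell 4 j) \<longrightarrow> s' a = s a" "k = 50 * (R - i)" by blast
    have less: "i < R" using c i(2,4) s by (simp split: if_splits)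
    have [simp]: "s' 11 = i" "s' 6 = R" using i s by auto
    have [simp]: "i < P" "Suc i < W" "R + i < W" using less R_le P_le by auto
    show "wp (Store (Addr 4 (Var 11)) (Var 6 \<oplus> Var 11) ;; 11 :=\<^sub>v (Var 11 \<oplus> Lit 1))
        (\<lambda>t s'. \<exists>k'. ?I k' s' \<and> k' + t + expr_cost ?c + 1 \<le> k) s'"
      apply (rule wp_steps; (simp del: ex_simps)?)+
      using i less
      apply (intro exI[of _ "50 * (R - Suc i)"] conjI exI[of _ "Suc i"])
      apply (auto simp: cell_inject less_Suc_eq)
      done
  next
    fix k t s' assume I: "?I k s'" and c: "val s' ?c = 0" and t: "t + k \<le> 50 * R + expr_cost ?c + 1"
    then obtain i where i: "i \<le> R" "s' 11 = i" "\<forall>j<i. s' (cell 4 j) = R + j"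
      "\<forall>a. a \<noteq> 11 \<longrightarrow> (\<forall>j<R. a \<noteq> cell 4 j) \<longrightarrow> s' a = s a" by blast
    have "s' 6 = R" using i(4) s by simp
    then have "i = R" using c i(1,2) by (simp split: if_splits)
    then show "Q t s'" using i t by (intro Q) auto
  qed
qed

lemma initial_trie:
  assumes s: "s 5 = 2 ^ b" "s 6 = R" "s 7 = R * 2 ^ b" "s 51 = R" "\<And>j. j < R \<Longrightarrow> s (cell 4 j) = R + j"
    and z: "\<And>a. 64 \<le> a \<Longrightarrow> (\<forall>f<5. \<forall>j<R. a \<noteq> cell f j) \<Longrightarrow> s a = 0"
  shows "trie s {}"
proof -
  have zc: "s (cell f j) = 0" if "f < 8" "5 \<le> f \<or> R \<le> j" for f j
  proof (rule z)
    show "64 \<le> cell f j" by (simp add: cell_def)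
  qed (use that in \<open>auto simp: cell_inject\<close>)
  have ch: "child_of s c k = 0" for c k using zc[of "5 + c" k] by (simp add: child_of_def)
  have code: "code_of s k = R + k" if "k < R" for k using s(5)[OF that] by (simp add: code_of_def)
  have R2: "2 * R \<le> R * 2 ^ b" using b_pos by (cases b) auto
  have "clear_from R s"
    unfolding clear_from_def
  proof (intro allI impI)
    fix a assume a: "cell 0 R \<le> a"
    then have "64 \<le> a" "\<forall>f<5. \<forall>j<R. a \<noteq> cell f j" by (auto simp: cell_def)
    then show "s a = 0" by (rule z)
  qed
  moreover have "low_clear R s" using zc by (simp add: low_clear_def)
  moreover have "forest R b (code_of s) (child_of s) (par_of s) R 0"
  proof -
    have "R + k < 2 * R * 2 ^ b" if "k < R" for k using that R2 by linarith
    then show ?thesis unfolding forest_def using code ch by (auto simp: inj_on_def)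
  qed
  ultimately have "nodes s 0" using s by (simp add: nodes_def)
  moreover have "leaves s = {}"
  proof -
    have "\<not> R * 2 ^ b \<le> R + k" if "k < R" for k using that R2 by linarith
    then show ?thesis unfolding leaves_def s(4) using code by auto
  qed
  ultimately show ?thesis by (simp add: trie_def)
qed

text \<open>With every vertex on level 0 and no edge, zeroed memory already holds the right levels
  and row sizes. What has to be written are the constants, the thresholds, the population of level 0
  and the codes of the roots.\<close>

lemma preprocess_spec:
  assumes b: "b = 1 \<or> 2 ^ (b - 1) < n"
    and Q: "\<And>t s'. good s' {} (\<lambda>_. 0) \<Longrightarrow> t \<le> 200 * (R + T + b + 3) \<Longrightarrow> Q t s'"
  shows "wp (preprocess_program B) Q (initial_memory n)"
proof -
  note [simp] = ok_Var cell_less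
  define s0 where "s0 = (initial_memory n)(2 := n, 5 := 2, 19 := 1)"
  have s0: "s0 2 = n" "s0 5 = 2" "s0 19 = 1" by (simp_all add: s0_def)
  define s1 where "s1 = s0(5 := 2 ^ b, 19 := b)"
  define s2 where "s2 = s1(19 := b + 1, 4 := M, 3 := T, 8 := T + 2, 15 := T + 1, 6 := R, 7 := R * 2 ^ b, 51 := R,
    cell 3 0 := M, cell 2 0 := n, 11 := 0)"
  have con: "wp (constants B) Q' s1" if Q': "\<And>t. t \<le> 100 \<Longrightarrow> Q' t s2" for Q'
  proof -
    define X where "X = B * B"
    have XM: "X * Suc b = M" by (simp add: X_def M_def)
    have "X * 1 \<le> X * Suc b" by (rule mult_le_mono2) simp
    then have XleM: "X \<le> M" using XM by simp
    have MW: "M < W" using word_bounds(6)[of 1] n_pos by simp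
    have TW: "T + 2 < W" "2 * M \<le> T"
    proof -
      have "n * (T + 2) < W" using R_le P_le by (simp add: R_eq)
      moreover have "1 * (T + 2) \<le> n * (T + 2)" using n_pos by (rule mult_le_mono1)
      ultimately show "T + 2 < W" by (simp only: mult_1_left le_less_trans)
      show "2 * M \<le> T" by (simp add: T_def)
    qed
    have "1 * Suc b \<le> X * Suc b" using B_ge by (intro mult_le_mono1) (simp add: X_def Suc_le_eq)
    then have "Suc b \<le> M" using XM by simp
    then have bW: "Suc b < W" using MW by linarith
    have RW: "R < W" "R * 2 ^ b < W" using R_le P_le R_b_le R_pos W_ge by (simp_all add: less_le_trans[of _ "2 * R * 2 ^ b"])
    define wd where "wd = T + 2"
    have nwd: "Suc (n * wd) = R" "n * wd < W" using R_eq RW by (simp_all add: wd_def)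
    have [simp]: "X < W" "M < W" "2 * M < W" "T < W" "wd < W" "Suc T < W" "Suc b < W" "R < W" "R * 2 ^ b < W"
      "n * wd < W" "X * Suc b = M" "2 * M * Suc b = T" "Suc (n * wd) = R" "Suc (Suc T) = wd" "0 < P" "X + X * b = M"
      "2 * M + 2 * M * b = T"
      using XleM MW TW bW RW nwd XM R_pos R_le by (auto simp: wd_def T_def X_def M_def algebra_simps)
    have [simp]: "s1 2 = n" "s1 19 = b" "s1 5 = 2 ^ b" by (simp_all add: s1_def s0_def)
    have s2_alt: "s1(19 := Suc b, 4 := M, 3 := T, 8 := wd, 15 := Suc T, 6 := R, 7 := R * 2 ^ b, 51 := R,
        cell 3 0 := M, cell 2 0 := n, 11 := 0) = s2"
      by (simp add: s2_def)
    show ?thesis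
      unfolding constants_def X_def[symmetric]
      apply (rule wp_steps; (simp del: mult_Suc_right mult_Suc add_mult_distrib2 distrib_left)?)+
      apply (simp only: s2_alt)
      apply (rule Q')
      apply simp
      done
  qed
  have z1: "s1 a = 0" if "64 \<le> a" for a using that by (simp add: s1_def s0_def initial_memory_def)
  have c2: "cell 3 0 \<noteq> cell 2 0" by (simp add: cell_inject)
  have s2: "s2 11 = 0" "s2 3 = T" "s2 4 = M" "s2 (cell 3 0) = M" "s2 6 = R" using c2 by (simp_all add: s2_def)
  have z2: "s2 a = 0" if "64 \<le> a" "a \<noteq> cell 3 0" "a \<noteq> cell 2 0" for a
    using that z1[OF that(1)] by (simp add: s2_def)
  have fin: "good s4 {} (\<lambda>_. 0)"
    if s3: "\<forall>j\<le>T. s3 (cell 3 j) = thr M j" "\<forall>a. a \<noteq> 11 \<longrightarrow> (\<forall>j\<le>T. a \<noteq> cell 3 j) \<longrightarrow> s3 a = s2 a"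
      and s4: "\<forall>j<R. s4 (cell 4 j) = R + j" "\<forall>a. a \<noteq> 11 \<longrightarrow> (\<forall>j<R. a \<noteq> cell 4 j) \<longrightarrow> s4 a = (s3(11 := 0)) a" for s3 s4
  proof -
    have hdr: "s4 a = s2 a" if "a < 64" "a \<noteq> 11" for a using that s3(2) s4(2) by simp
    have thr: "s4 (cell 3 j) = thr M j" if "j \<le> T" for j
      using that s3(1) s4(2) by (simp add: cell_inject)
    have zero: "s4 a = 0" if a: "64 \<le> a" "a \<noteq> cell 2 0" "\<forall>j\<le>T. a \<noteq> cell 3 j" "\<forall>j<R. a \<noteq> cell 4 j" for a
    proof -
      have "s4 a = s2 a" using a s3(2) s4(2) by simp
      then show ?thesis using z2[OF a(1)] a(2,3) by simp
    qed
    have pop: "s4 (cell 2 0) = n" using s3(2) s4(2) by (simp add: cell_inject s2_def)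
    have tr: "trie s4 {}"
    proof (rule initial_trie)
      show "s4 5 = 2 ^ b" "s4 6 = R" "s4 7 = R * 2 ^ b" "s4 51 = R"
        using hdr by (simp_all add: s2_def s1_def)
      show "s4 (cell 4 j) = R + j" if "j < R" for j using s4(1) that by simp
      fix a assume a: "64 \<le> a" "\<forall>f<5. \<forall>j<R. a \<noteq> cell f j"
      have "\<forall>j\<le>T. a \<noteq> cell 3 j" "\<forall>j<R. a \<noteq> cell 4 j" "a \<noteq> cell 2 0"
        using a(2) index_bounds(3) R_pos by auto
      then show "s4 a = 0" using zero a(1) by blast
    qed
    have "keys (arcs {}) (min_level (\<lambda>_. 0)) {} = {}" by (simp add: keys_def arcs_def)
    moreover have "s4 (cell 0 u) = 0" for u by (rule zero) (simp_all add: cell_inject, simp add: cell_def)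
    moreover have "s4 (cell 1 u) = 0" for u by (rule zero) (simp_all add: cell_inject, simp add: cell_def)
    moreover have "s4 (cell 2 j) = card {u. u < n \<and> 0 = j}" for j
    proof (cases "j = 0")
      case False
      then show ?thesis using zero[of "cell 2 j"] by (simp add: cell_inject) (simp add: cell_def)
    qed (use pop in simp)
    moreover have "s4 2 = n" "s4 3 = T" "s4 4 = M" "s4 8 = T + 2" "s4 15 = T + 1" "s4 9 = 0" "s4 10 = 0"
      using hdr by (simp_all add: s2_def s1_def s0_def initial_memory_def)
    ultimately have "repr s4 (arcs {}) (min_level (\<lambda>_. 0)) {} (\<lambda>_. 0)" "s4 9 = 0" "s4 10 = 0"
      using tr thr by (simp_all add: repr_def arcs_def)
    moreover have "settled {} {} (\<lambda>_. 0)" by (simp add: settled_def up_ok_def down_ok_def N_def upper_def)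
    moreover have "\<exists>u<n. 0 = (0::nat)" using n_pos by (intro exI[of _ 0]) simp
    ultimately show ?thesis by (simp add: good_def simple_edges_def)
  qed
  have rest: "wp (bits_loop ;; constants B ;; thresholds_loop ;; 11 :=\<^sub>v Lit 0 ;; roots_loop) Q' s0"
    if Q': "\<And>t s'. good s' {} (\<lambda>_. 0) \<Longrightarrow> t \<le> 150 * (R + T + b + 3) \<Longrightarrow> Q' t s'" for Q'
  proof (rule wp_Seq, rule bits_loop_spec[OF b s0], rule wp_Seq, fold s1_def, rule con, rule wp_Seq, rule thresholds_loop_spec[OF s2(1-4)])
    fix t1 t2 t3 :: nat and s3
    assume t: "t1 \<le> 40 * (b + 1)" "t2 \<le> 100" "t3 \<le> 70 * (T + 1)"
      and s3: "\<forall>j\<le>T. s3 (cell 3 j) = thr M j" "\<forall>a. a \<noteq> 11 \<longrightarrow> (\<forall>j\<le>T. a \<noteq> cell 3 j) \<longrightarrow> s3 a = s2 a"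
    have "s3 6 = R" using s3(2) s2(5) by simp
    then have s3': "(s3(11 := 0)) 11 = 0" "(s3(11 := 0)) 6 = R" by simp_all
    show "wp (11 :=\<^sub>v Lit 0 ;; roots_loop) (\<lambda>t'. Q' (t1 + (t2 + (t3 + t')))) s3"
    proof (rule wp_Seq, rule wp_Var, simp, simp, unfold val.simps, rule roots_loop_spec[OF s3'])
      fix t4 s4 assume s4: "\<forall>j<R. s4 (cell 4 j) = R + j"
        "\<forall>a. a \<noteq> 11 \<longrightarrow> (\<forall>j<R. a \<noteq> cell 4 j) \<longrightarrow> s4 a = (s3(11 := 0)) a" "t4 \<le> 60 * (R + 1)"
      show "Q' (t1 + (t2 + (t3 + (expr_cost (Lit 0) + 2 + t4)))) s4"
        using fin[OF s3 s4(1,2)] t s4(3) by (intro Q') simp_all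
    qed
  qed
  have [simp]: "initial_memory n 0 = n" by (simp add: initial_memory_def)
  have s0_alt: "(initial_memory n)(2 := n, 5 := 2, 19 := Suc 0) = s0" by (simp add: s0_def)
  show ?thesis
    unfolding preprocess_program_def
    apply (rule wp_steps; simp?)+
    apply (simp only: s0_alt)
    apply (rule rest)
    apply (rule Q, assumption)
    apply simp
    done
qed

end

section \<open>Bounds on space, word length and time\<close>

lemma card_simple_edges:
  assumes "simple_edges n E"
  shows "card E \<le> n * n"
proof -
  have "E \<subseteq> (\<lambda>(u, v). {u, v}) ` ({..<n} \<times> {..<n})"
  proof
    fix e assume "e \<in> E"
    then obtain u v where "e = {u, v}" "u < n" "v < n" using assms by (auto simp: simple_edges_def)
    then show "e \<in> (\<lambda>(u, v). {u, v}) ` ({..<n} \<times> {..<n})" by (intro image_eqI[of _ _ "(u, v)"]) auto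
  qed
  then have "card E \<le> card ({..<n} \<times> {..<n})" by (intro surj_card_le) auto
  then show ?thesis by (simp add: card_cartesian_product)
qed

context params
begin

text \<open>The common scale of all bounds, of order \<open>log n / \<epsilon>\<close>.\<close>

definition Y :: nat where "Y = (b + 1) * B"

definition rows :: nat where "rows = n * (T + 2) + 1"

text \<open>The capacity for \<open>mcap = m + 1\<close>: a deletion runs under the limit for the
  \<open>m\<close> remaining edges while the removed edge is still stored.\<close>

definition node_cap :: "nat \<Rightarrow> nat" where
  "node_cap m = rows + b * (2 * (m + 1) + n + 3)"

lemma Y_ge: "1 \<le> Y" "b + 1 \<le> Y" "B \<le> Y" "Y \<le> Y ^ 3" "Y ^ 3 \<le> Y ^ 6" "Y * Y ^ 6 = Y ^ 7"
proof -
  have "1 * 1 \<le> (b + 1) * B" using B_ge by (intro mult_le_mono) auto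
  then show 1: "1 \<le> Y" by (simp add: Y_def)
  have "(b + 1) * 1 \<le> (b + 1) * B" using B_ge by (intro mult_le_mono) auto
  then show "b + 1 \<le> Y" by (simp add: Y_def)
  have "1 * B \<le> (b + 1) * B" by (intro mult_le_mono) auto
  then show "B \<le> Y" by (simp add: Y_def)
  show "Y \<le> Y ^ 3" "Y ^ 3 \<le> Y ^ 6" using power_increasing[of 1 3 Y] power_increasing[of 3 6 Y] 1 by simp_all
  show "Y * Y ^ 6 = Y ^ 7" by (simp flip: power_Suc)
qed

lemma M_le: "M \<le> Y ^ 2" "M * B \<le> Y ^ 3" "T \<le> 2 * Y ^ 3"
proof -
  have e: "Y ^ 2 = (b + 1) * ((b + 1) * (B * B))" "Y ^ 3 = (b + 1) * ((b + 1) * ((b + 1) * (B * (B * B))))"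
  proof -
    have "(c * B) ^ 2 = c * (c * (B * B))" "(c * B) ^ 3 = c * (c * (c * (B * (B * B))))" for c
      by (simp_all add: power2_eq_square power3_eq_cube ac_simps)
    then show "Y ^ 2 = (b + 1) * ((b + 1) * (B * B))" "Y ^ 3 = (b + 1) * ((b + 1) * ((b + 1) * (B * (B * B))))"
      unfolding Y_def by blast+
  qed
  have "M = 1 * ((b + 1) * (B * B))" by (simp add: M_def)
  also have "\<dots> \<le> Y ^ 2" unfolding e by (rule mult_le_mono1) simp
  finally show "M \<le> Y ^ 2" .
  have "M * B = 1 * (1 * ((b + 1) * (B * (B * B))))" by (simp only: M_def mult_1_left ac_simps)
  also have "\<dots> \<le> Y ^ 3" unfolding e by (intro mult_le_mono) auto
  finally show "M * B \<le> Y ^ 3" .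
  have "(b + 1) * ((b + 1) * (1 * (1 * (B * B)))) \<le> Y ^ 3" unfolding e using B_ge by (intro mult_le_mono) auto
  moreover have "T = 2 * ((b + 1) * ((b + 1) * (1 * (1 * (B * B)))))" by (simp only: T_def M_def mult_1_left ac_simps)
  ultimately show "T \<le> 2 * Y ^ 3" by (simp only: mult_le_mono2)
qed

lemma rows_le: "rows \<le> 5 * (n * Y ^ 3)"
proof -
  define z where "z = n * Y ^ 3"
  have "1 * 1 \<le> n * Y ^ 3" using n_pos Y_ge by (intro mult_le_mono) auto
  then have 1: "1 \<le> z" by (simp only: z_def mult_1_left)
  have "T + 2 \<le> 4 * Y ^ 3" using M_le(3) Y_ge by linarith
  then have "n * (T + 2) \<le> n * (4 * Y ^ 3)" by (rule mult_le_mono2)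
  then have "n * (T + 2) \<le> 4 * z" by (simp only: z_def mult.left_commute)
  then have "rows \<le> 5 * z" unfolding rows_def using 1 by simp
  then show ?thesis by (simp only: z_def)
qed

lemma node_cap_le: "64 + 8 * node_cap m \<le> 200 * (Y ^ 3 * (m + n))"
proof -
  define z where "z = Y ^ 3 * (m + n)"
  have "1 * 1 \<le> Y ^ 3 * (m + n)" using n_pos Y_ge by (intro mult_le_mono) auto
  then have 1: "1 \<le> z" by (simp only: z_def mult_1_left)
  have "Y ^ 3 * n \<le> Y ^ 3 * (m + n)" by (intro mult_le_mono2) simp
  then have "n * Y ^ 3 \<le> z" by (simp only: z_def mult.commute)
  then have 2: "rows \<le> 5 * z" using rows_le by (meson le_trans mult_le_mono2)
  have "b \<le> Y ^ 3" using Y_ge by linarith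
  moreover have "2 * (m + 1) + n + 3 \<le> 6 * (m + n)" using n_pos by simp
  ultimately have "b * (2 * (m + 1) + n + 3) \<le> Y ^ 3 * (6 * (m + n))" by (rule mult_le_mono)
  then have 3: "b * (2 * (m + 1) + n + 3) \<le> 6 * z" by (simp only: z_def mult.left_commute)
  define c where "c = b * (2 * (m + 1) + n + 3)"
  have "64 + 8 * (rows + c) \<le> 200 * z" using 1 2 3[folded c_def] by simp
  then show ?thesis unfolding node_cap_def z_def c_def .
qed

lemma prep_le: "200 * (rows + T + b + 3) \<le> 2400 * (Y ^ 3 * n)"
proof -
  define z where "z = Y ^ 3 * n"
  have "Y ^ 3 * 1 \<le> Y ^ 3 * n" using n_pos by (rule mult_le_mono2)
  then have z: "Y ^ 3 \<le> z" by (simp only: z_def mult_1_right)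
  have "rows \<le> 5 * z" using rows_le by (simp only: z_def mult.commute)
  moreover have "T \<le> 2 * z" "b + 1 \<le> z" "1 \<le> z" using z M_le(3) Y_ge by linarith+
  ultimately have "200 * (rows + T + b + 3) \<le> 2400 * z" by simp
  then show ?thesis by (simp only: z_def)
qed

text \<open>\<open>T\<close> and \<open>M * B\<close> are of order \<open>Y ^ 3\<close>, and the
  factor \<open>b + 1\<close> for the depth of the tries is at most \<open>Y\<close>. This is the
  origin of the exponent 7.\<close>

lemma upd_le: "6000 * (b + 1) * (2 * T * (M * B + 4) + 9 * (T + 1) + 6) \<le> 318000 * Y ^ 7"
proof -
  define p where "p = M * B"
  define y where "y = Y ^ 3"
  have y: "1 \<le> y" "p \<le> y" "T \<le> 2 * y" "y \<le> Y ^ 6" using M_le Y_ge unfolding p_def y_def by linarith+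
  have "2 * T \<le> 4 * y" "p + 4 \<le> 5 * y" using y by linarith+
  then have "2 * T * (p + 4) \<le> (4 * y) * (5 * y)" by (rule mult_le_mono)
  also have "\<dots> = 20 * Y ^ 6" by (simp add: y_def power_add[symmetric])
  finally have "2 * T * (p + 4) \<le> 20 * Y ^ 6" .
  moreover have "9 * (T + 1) + 6 \<le> 33 * Y ^ 6" using y by simp
  ultimately have "2 * T * (p + 4) + 9 * (T + 1) + 6 \<le> 53 * Y ^ 6"
    unfolding add.assoc by (rule order_trans[OF add_mono]) simp
  with Y_ge(2) have "(b + 1) * (2 * T * (p + 4) + 9 * (T + 1) + 6) \<le> Y * (53 * Y ^ 6)"
    by (rule mult_le_mono)
  also have "\<dots> = 53 * Y ^ 7" using Y_ge(6) by simp
  finally have "6000 * ((b + 1) * (2 * T * (p + 4) + 9 * (T + 1) + 6)) \<le> 6000 * (53 * Y ^ 7)"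
    by (rule mult_le_mono2)
  then show ?thesis unfolding p_def mult.assoc[of 6000 "b + 1", symmetric] by (simp only: mult.assoc[of 6000 53, symmetric])
qed

text \<open>\<open>T = 2 * M * (b + 1)\<close> levels, each with growth at most
  \<open>1 + 1 / M\<close>, give \<open>exp 2 ^ (b + 1)\<close> in total. Bounding
  \<open>exp 2\<close> by 16 makes this the fourth power of \<open>2 * 2 ^ b\<close>, so thresholds
  are polynomial in \<open>n\<close> apart from the factor \<open>M\<close>.\<close>

lemma thr_T_le: "thr M T \<le> 256 * n ^ 4 * M"
proof -
  have "real (thr M T) \<le> (1 + 1 / M) ^ T * M"
    using thr_upper[of M 0 T] M_ge by simp
  also have "(1 + 1 / real M) ^ T \<le> 16 ^ (b + 1)"
  proof -
    have "(1 + 1 / real M) ^ T \<le> exp (1 / real M) ^ T"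
      by (intro power_mono) (auto simp: add_increasing)
    also have "\<dots> = exp (real T * (1 / real M))" by (simp only: exp_of_nat_mult)
    also have "real T * (1 / real M) = real (b + 1) * 2" 
    proof -
      have "real T = real M * (real (b + 1) * 2)" by (simp add: T_def algebra_simps)
      then show ?thesis using M_ge by simp
    qed
    also have "exp (real (b + 1) * 2) = exp 2 ^ (b + 1)" by (simp only: exp_of_nat_mult)
    also have "\<dots> \<le> 16 ^ (b + 1)"
    proof (intro power_mono)
      have "exp (2::real) = exp 1 * exp 1" by (simp flip: exp_add)
      also have "\<dots> \<le> 3 * 3" using exp_le by (intro mult_mono) auto
      finally show "exp (2::real) \<le> 16" by simp
    qed simp
    finally show ?thesis .
  qed
  also have "(16::real) ^ (b + 1) = (2 * 2 ^ b) ^ 4"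
    by (simp add: power_mult_distrib power_mult[symmetric] mult.commute[of b])
      (simp add: power_mult)
  also have "\<dots> \<le> (2 * (2 * real n)) ^ 4"
  proof (intro power_mono mult_left_mono)
    have "real (2 ^ b) \<le> real (2 * n)" using le_n by (rule of_nat_mono)
    then show "2 ^ b \<le> 2 * real n" by simp
  qed auto
  also have "\<dots> = 256 * real n ^ 4" by (simp add: power_mult_distrib)
  finally have "real (thr M T) \<le> real (256 * n ^ 4 * M)" by simp (simp add: mult_right_mono)
  then show ?thesis by (simp only: of_nat_le_iff)
qed

text \<open>\<open>x\<close> stands for \<open>(n + 1) / \<epsilon>\<close>. Numerical constants are
  absorbed into powers of 4 and these into powers of \<open>x\<close>; the exponent 17 leaves ample
  room for that.\<close>

lemma word_le:
  fixes x :: real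
  assumes x: "4 \<le> x" "real n \<le> x" "real B \<le> x" and m: "m \<le> n * n"
  shows "64 + 8 * node_cap m \<le> x ^ 17" "2 * real rows * 2 ^ b \<le> x ^ 17" "12 * real B * real B * real (thr M T) < x ^ 17" "1024 \<le> x ^ 17"
proof -
  have b: "real (b + 1) \<le> 2 * x"
  proof -
    have "b + 1 \<le> 2 * n" using le_n less_exp[of b] by linarith
    then have "real (b + 1) \<le> real (2 * n)" by (rule of_nat_mono)
    then show ?thesis using x(2) by simp
  qed
  have "real Y \<le> (2 * x) * x" unfolding Y_def of_nat_mult using b x by (intro mult_mono) auto
  then have Y: "real Y \<le> 2 * x ^ 2" by (simp add: power2_eq_square)
  have Y2: "real Y ^ 2 \<le> 4 * x ^ 4"
  proof -
    have "real Y ^ 2 \<le> (2 * x ^ 2) ^ 2" using Y by (intro power_mono) auto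
    then show ?thesis by (simp add: power_mult_distrib power_mult[symmetric])
  qed
  have Y3: "real Y ^ 3 \<le> 8 * x ^ 6"
  proof -
    have "real Y ^ 3 \<le> (2 * x ^ 2) ^ 3" using Y by (intro power_mono) auto
    then show ?thesis by (simp add: power_mult_distrib power_mult[symmetric])
  qed
  have k: "4 ^ j * x ^ i \<le> x ^ 17" if "i + j \<le> 17" for i j
  proof -
    have "4 ^ j * x ^ i \<le> x ^ j * x ^ i" using x by (intro mult_right_mono power_mono) auto
    also have "\<dots> = x ^ (i + j)" by (simp add: power_add)
    also have "\<dots> \<le> x ^ 17" using that x by (intro power_increasing) auto
    finally show ?thesis .
  qed
  have xp: "0 \<le> x ^ i" for i using x by simp
  have mn: "real (m + n) \<le> 2 * x ^ 2"
  proof -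
    have "real m \<le> real n * real n" using of_nat_mono[OF m, where ?'a = real] by simp
    also have "\<dots> \<le> x * x" using x by (intro mult_mono) auto
    finally have "real m \<le> x ^ 2" by (simp add: power2_eq_square)
    moreover have "x * 1 \<le> x * x" using x by (intro mult_left_mono) auto
    ultimately show ?thesis using x(2) by (simp add: power2_eq_square)
  qed
  have "real (64 + 8 * node_cap m) \<le> real (200 * (Y ^ 3 * (m + n)))" by (rule of_nat_mono[OF node_cap_le])
  also have "\<dots> = 200 * (real Y ^ 3 * real (m + n))" by simp
  also have "\<dots> \<le> 200 * ((8 * x ^ 6) * (2 * x ^ 2))"
    using Y3 mn xp by (intro mult_left_mono mult_mono) auto
  also have "\<dots> = 3200 * x ^ 8" by (simp add: power_add[symmetric])
  also have "\<dots> \<le> 4 ^ 6 * x ^ 8" using xp by (intro mult_right_mono) auto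
  also have "\<dots> \<le> x ^ 17" by (rule k) simp
  finally show "64 + 8 * node_cap m \<le> x ^ 17" by simp
  have "real rows \<le> real (5 * (n * Y ^ 3))" by (rule of_nat_mono[OF rows_le])
  also have "\<dots> = 5 * (real n * real Y ^ 3)" by simp
  also have "\<dots> \<le> 5 * (x * (8 * x ^ 6))" using Y3 x by (intro mult_left_mono mult_mono) auto
  also have "\<dots> = 40 * x ^ 7" by (simp flip: power_Suc)
  finally have r: "real rows \<le> 40 * x ^ 7" .
  have "(2::real) ^ b \<le> 2 * x" using of_nat_mono[OF le_n, where ?'a = real] x by simp
  then have "(2 * real rows) * 2 ^ b \<le> (2 * (40 * x ^ 7)) * (2 * x)"
    using r xp x by (intro mult_mono) auto
  also have "\<dots> = 160 * x ^ 8" by (simp flip: power_Suc2)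
  also have "\<dots> \<le> 4 ^ 4 * x ^ 8" using xp by (intro mult_right_mono) auto
  also have "\<dots> \<le> x ^ 17" by (rule k) simp
  finally show "2 * real rows * 2 ^ b \<le> x ^ 17" .
  have "real (thr M T) \<le> real (256 * n ^ 4 * M)" by (rule of_nat_mono[OF thr_T_le])
  also have "\<dots> = (256 * real n ^ 4) * real M" by simp
  also have "\<dots> \<le> (256 * x ^ 4) * (4 * x ^ 4)"
  proof (intro mult_mono power_mono)
    have "real M \<le> real Y ^ 2" using of_nat_mono[OF M_le(1), where ?'a = real] by (simp only: of_nat_power)
    then show "real M \<le> 4 * x ^ 4" using Y2 by linarith
  qed (use x in auto)
  also have "\<dots> = 1024 * x ^ 8" by (simp add: power_add[symmetric])
  finally have t: "real (thr M T) \<le> 1024 * x ^ 8" .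
  have "(12 * real B * real B) * real (thr M T) \<le> (12 * x * x) * (1024 * x ^ 8)"
    using t x xp by (intro mult_mono) auto
  also have "\<dots> = 12288 * x ^ 10" by (simp flip: power_Suc)
  also have "\<dots> < 4 ^ 7 * x ^ 10" using x by (intro mult_strict_right_mono) auto
  also have "\<dots> \<le> x ^ 17" by (rule k) simp
  finally show "12 * real B * real B * real (thr M T) < x ^ 17" .
  have "1024 \<le> 4 ^ 17 * x ^ 0" by simp
  also have "\<dots> \<le> x ^ 17" by (rule k) simp
  finally show "1024 \<le> x ^ 17" .
qed

end

context algorithm begin

lemma good_clear:
  assumes "good s E l" "card E \<le> mcap + 1" "S \<le> i"
  shows "s i = 0"
proof -
  have E: "simple_edges n E" and r: "repr s (arcs E) (min_level l) {} l" using assms(1) by (auto simp: good_def)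
  have "s 51 \<le> P" using capacity(1)[OF r] card_arcs[OF E] assms(2) by simp
  moreover have "clear_from (s 51) s" using reprD(10)[OF r] by (simp add: trie_def nodes_def)
  ultimately have "clear_from P s" using clear_from_mono by blast
  then show ?thesis using assms(3) by (simp add: clear_from_def cell_def S_def)
qed

end

section \<open>From single operations to sequences of operations\<close>

definition least_bits :: "nat \<Rightarrow> nat" where
  "least_bits n = (LEAST b. 1 \<le> b \<and> n \<le> 2 ^ b)"

lemma least_bits:
  assumes "1 \<le> n"
  shows "1 \<le> least_bits n" "n \<le> 2 ^ least_bits n" "least_bits n = 1 \<or> 2 ^ (least_bits n - 1) < n"
    "2 ^ least_bits n \<le> 2 * n"
proof -
  have "1 \<le> n \<and> n \<le> 2 ^ n" using assms less_exp[of n] by simp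
  from LeastI[of "\<lambda>b. 1 \<le> b \<and> n \<le> 2 ^ b", OF this]
  show 1: "1 \<le> least_bits n" "n \<le> 2 ^ least_bits n" by (auto simp: least_bits_def)
  show 2: "least_bits n = 1 \<or> 2 ^ (least_bits n - 1) < n"
    using not_less_Least[of "least_bits n - 1" "\<lambda>b. 1 \<le> b \<and> n \<le> 2 ^ b"] 1(1)
    unfolding least_bits_def[symmetric] by auto
  then show "2 ^ least_bits n \<le> 2 * n"
  proof
    assume "2 ^ (least_bits n - 1) < n"
    moreover have "(2::nat) ^ least_bits n = 2 * 2 ^ (least_bits n - 1)"
      using 1(1) by (metis One_nat_def Suc_le_eq power_eq_if less_numeral_extra(3))
    ultimately show ?thesis by simp
  qed (use assms in simp)
qed

text \<open>Only \<open>B\<close> enters the programs. All that depends on \<open>n\<close> is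
  computed by preprocessing, so one algorithm serves every \<open>n\<close>.\<close>

definition algorithm_for :: "nat \<Rightarrow> dyn_alg" where
  "algorithm_for B = Dyn_Alg (preprocess_program B) (insert_program B) (delete_program B) (query_program B)"

lemma maintains:
  fixes \<epsilon> :: real and n :: nat
  assumes \<epsilon>: "0 < \<epsilon>" "\<epsilon> < 1 / 2" and n: "1 \<le> n"
  defines "c \<equiv> 10 ^ 11 :: real" and "q \<equiv> 7 :: nat"
  shows "maintains_densest_subgraph_value (algorithm_for (nat \<lceil>1 / \<epsilon>\<rceil>)) n (4 + 140 * \<epsilon>)
    (nat \<lceil>c * log 2 ((real n + 1) / \<epsilon>)\<rceil>) (\<lambda>m. nat \<lfloor>soft_factor c q n \<epsilon> * (real m + real n)\<rfloor>)
    (soft_factor c q n \<epsilon> * real n) (soft_factor c q n \<epsilon>) c"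
proof -
  define B where "B = nat \<lceil>1 / \<epsilon>\<rceil>"
  define b where "b = least_bits n"
  define w where "w = nat \<lceil>c * log 2 ((real n + 1) / \<epsilon>)\<rceil>"
  define W where "W = (2::nat) ^ w"
  define x where "x = (real n + 1) / \<epsilon>"
  define lam where "lam = log 2 (real n + 1) / \<epsilon>"
  define soft where "soft = soft_factor c q n \<epsilon>"
  define space where "space m = nat \<lfloor>soft * (real m + real n)\<rfloor>" for m :: nat
  note bits = least_bits[OF n, folded b_def]
  have e2: "2 < 1 / \<epsilon>" using \<epsilon> by (simp add: field_simps)
  have B_lower: "1 / \<epsilon> \<le> real B" unfolding B_def by linarith
  have B_upper: "real B \<le> 2 / \<epsilon>" unfolding B_def using e2 by linarith
  have B2: "2 \<le> B" using B_lower e2 by linarith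
  interpret p: params n B b
    by unfold_locales (use n B2 bits in auto)
  have x4: "4 \<le> x" "real n \<le> x" "real B \<le> x"
  proof -
    have "2 * 2 \<le> (real n + 1) * (1 / \<epsilon>)" using n e2 by (intro mult_mono) auto
    then show "4 \<le> x" by (simp add: x_def)
    have "real n * 1 \<le> (real n + 1) * (1 / \<epsilon>)" using n e2 by (intro mult_mono) auto
    then show "real n \<le> x" by (simp add: x_def)
    have "2 * (1 / \<epsilon>) \<le> (real n + 1) * (1 / \<epsilon>)" using n \<epsilon> by (intro mult_right_mono) auto
    then show "real B \<le> x" using B_upper by (simp add: x_def)
  qed
  have Wx: "x ^ 17 \<le> real W"
  proof -
    have l: "0 \<le> log 2 x" using x4 by simp
    have "x ^ 17 = 2 powr (17 * log 2 x)" using x4 by (simp add: powr_mult powr_powr[symmetric] mult.commute[of 17])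
    also have "\<dots> \<le> 2 powr (real w)"
    proof -
      have "17 * log 2 x \<le> c * log 2 x" using l by (intro mult_right_mono) (simp add: c_def)
      also have "\<dots> \<le> real w" unfolding w_def x_def by linarith
      finally show ?thesis by simp
    qed
    also have "\<dots> = real W" by (simp add: W_def powr_realpow)
    finally show ?thesis .
  qed
  have log1: "1 \<le> log 2 (real n + 1)" using n by simp
  have lam1: "1 \<le> lam"
  proof -
    have "1 * 1 \<le> log 2 (real n + 1) * (1 / \<epsilon>)" using log1 e2 by (intro mult_mono) auto
    then show ?thesis by (simp add: lam_def)
  qed
  \<comment> \<open>The 6 is the product of the factors in
    \<open>b + 1 \<le> 3 * log 2 (n + 1)\<close> and \<open>B \<le> 2 / \<epsilon>\<close>.\<close>
  have Y_le: "real p.Y \<le> 6 * lam"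
  proof -
    have "2 ^ b \<le> 2 * (real n + 1)" using of_nat_mono[OF bits(4), where ?'a = real] by simp
    then have "log 2 (2 ^ b) \<le> log 2 (2 * (real n + 1))" by (intro log_mono) auto
    also have "\<dots> = 1 + log 2 (real n + 1)" by (subst log_mult) auto
    finally have "real b \<le> 1 + log 2 (real n + 1)" by (simp add: log_nat_power)
    then have "real (b + 1) \<le> 3 * log 2 (real n + 1)" using log1 unfolding of_nat_add of_nat_1 by linarith
    then have "real (b + 1) * real B \<le> (3 * log 2 (real n + 1)) * (2 / \<epsilon>)"
      using B_upper log1 by (intro mult_mono) auto
    then show ?thesis unfolding p.Y_def of_nat_mult by (simp add: lam_def)
  qed
  \<comment> \<open>\<open>c = 10 ^ 11\<close> is chosen to exceed \<open>318000 * 6 ^ 7\<close>,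
    with the first factor from \<open>upd_le\<close> and the 6 from \<open>Y_le\<close>. The other
    demands on \<open>c\<close> are weaker.\<close>
  have Y7: "318000 * real p.Y ^ 7 \<le> soft"
  proof -
    have "real p.Y ^ 7 \<le> (6 * lam) ^ 7" using Y_le by (intro power_mono) auto
    then have "318000 * real p.Y ^ 7 \<le> 318000 * (6 * lam) ^ 7" by simp
    also have "\<dots> = (318000 * 6 ^ 7) * lam ^ 7" by (simp add: power_mult_distrib)
    also have "\<dots> \<le> c * lam ^ 7" using lam1 by (intro mult_right_mono) (auto simp: c_def)
    finally show ?thesis by (simp add: soft_def soft_factor_def q_def lam_def)
  qed
  have Y3: "2400 * real p.Y ^ 3 \<le> soft"
  proof -
    have "1 \<le> real p.Y" using p.Y_ge(1) by simp
    then have "real p.Y ^ 3 \<le> real p.Y ^ 7" by (intro power_increasing) auto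
    moreover have "0 \<le> real p.Y ^ 7" by simp
    ultimately show ?thesis using Y7 by linarith
  qed
  have S_le: "64 + 8 * p.node_cap m \<le> space m" for m
  proof -
    have "real (64 + 8 * p.node_cap m) \<le> real (200 * (p.Y ^ 3 * (m + n)))" by (rule of_nat_mono[OF p.node_cap_le])
    also have "\<dots> = (200 * real p.Y ^ 3) * (real m + real n)" by simp
    also have "\<dots> \<le> soft * (real m + real n)"
    proof (intro mult_right_mono)
      have "0 \<le> real p.Y ^ 3" by simp
      then show "200 * real p.Y ^ 3 \<le> soft" using Y3 by linarith
    qed simp
    finally show ?thesis unfolding space_def by (simp add: le_nat_floor)
  qed
  \<comment> \<open>One instance of the locale for each number of edges.
    \<open>m \<le> n * n\<close> holds for every simple graph and lets the word length depend on
    \<open>n\<close> and \<open>\<epsilon>\<close> alone.\<close>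
  have alg: "algorithm n B b w (p.node_cap m) W p.rows (m + 1)" if m: "m \<le> n * n" for m
  proof -
    note wl = p.word_le[OF x4 m]
    have "real (64 + 8 * p.node_cap m) \<le> real W" using wl(1) Wx by simp
    then have 1: "64 + 8 * p.node_cap m \<le> W" by (simp only: of_nat_le_iff)
    have "real (2 * p.rows * 2 ^ b) \<le> real W" using wl(2) Wx by simp
    then have 2: "2 * p.rows * 2 ^ b \<le> W" by (simp only: of_nat_le_iff)
    have "real (12 * B * B * thr p.M p.T) < real W" using wl(3) Wx by simp
    then have 3: "12 * B * B * thr p.M p.T < W" by (simp only: of_nat_less_iff)
    have "real 1024 \<le> real W" using wl(4) Wx by simp
    then have 4: "1024 \<le> W" by (simp only: of_nat_le_iff)
    show ?thesis
      by unfold_locales (use 1 2 3 4 p.b_ge in \<open>auto simp: W_def p.rows_def p.node_cap_def\<close>)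
  qed
  define good where "good = algorithm.good n B b p.rows"
  define K where "K = 6000 * int (b + 1)"
  define U where "U = 2 * int p.T * int (p.M * B + 4) + 9 * int (p.T + 1) + 6"
  \<comment> \<open>The amortized account: the time spent so far plus \<open>K\<close> steps for
    each unit of potential is at most \<open>K * U\<close> per update. As the potential is
    nonnegative, the time bound can be read off.\<close>
  define inv where "inv E k t s \<longleftrightarrow> (\<exists>l. good s E l \<and> (\<forall>a. s a < W) \<and> int t + K * p.pot E l \<le> int k * (K * U))"
    for E k t s
  have inv_space: "s i = 0" if "inv E k t s" "space (card E) \<le> i" for E k t s i
  proof -
    obtain l where l: "good s E l" using \<open>inv E k t s\<close> by (auto simp: inv_def)
    have "simple_edges n E"
    proof -
      \<comment> \<open>\<open>good\<close> is the same predicate in all instances, so the one for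
        \<open>m = 0\<close> can be used to see that the graph is simple, before the capacity for
        \<open>card E\<close> edges is available.\<close>
      interpret A: algorithm n B b w "p.node_cap 0" W p.rows 1 using alg[of 0] by simp
      show ?thesis using l by (simp add: good_def A.good_def)
    qed
    then have "card E \<le> n * n" by (rule card_simple_edges)
    then interpret A: algorithm n B b w "p.node_cap (card E)" W p.rows "card E + 1" by (rule alg)
    have "A.good s E l" using l by (simp add: good_def)
    then show ?thesis
      by (rule A.good_clear) (use S_le[of "card E"] \<open>space (card E) \<le> i\<close> in \<open>auto simp: A.S_def\<close>)
  qed
  have inv_simple: "simple_edges n E" "card E \<le> n * n" if "inv E k t s" for E k t s
  proof -
    interpret A: algorithm n B b w "p.node_cap 0" W p.rows 1 using alg[of 0] by simp
    show "simple_edges n E" using that by (auto simp: inv_def good_def A.good_def)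
    then show "card E \<le> n * n" by (rule card_simple_edges)
  qed
  have pre: "\<exists>t s. exec w (space 0) (preprocess_program B) (initial_memory n) t s \<and> real t \<le> soft * real n \<and> inv {} 0 0 s"
  proof -
    interpret A: algorithm n B b w "p.node_cap 0" W p.rows 1 using alg[of 0] by simp
    have ok: "A.mem_ok (initial_memory n)"
      using A.word_bounds(7)[of n] A.W_ge by (simp add: A.mem_ok_def initial_memory_def)
    have wpf: "A.wp (preprocess_program B) (\<lambda>t s. good s {} (\<lambda>_. 0) \<and> t \<le> 200 * (p.rows + p.T + b + 3)) (initial_memory n)"
      using bits(3) by (intro A.preprocess_spec) (simp_all add: good_def)
    obtain t s where ts: "exec w (space 0) (preprocess_program B) (initial_memory n) t s" "A.mem_ok s"
        "good s {} (\<lambda>_. 0)" "t \<le> 200 * (p.rows + p.T + b + 3)"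
      by (rule A.wp_exec[OF wpf ok S_le[of 0, folded A.S_def]]) blast
    have "real t \<le> real (2400 * (p.Y ^ 3 * n))" using ts(4) p.prep_le by (intro of_nat_mono) linarith
    also have "\<dots> = (2400 * real p.Y ^ 3) * real n" by simp
    also have "\<dots> \<le> soft * real n" using Y3 by (intro mult_right_mono) auto
    finally have "real t \<le> soft * real n" .
    moreover have "inv {} 0 0 s"
      using ts(2,3) p.pot_empty by (auto simp: inv_def A.mem_ok_def)
    ultimately show ?thesis using ts(1) by blast
  qed
  have operands: "with_operands s u v a < W" if "\<forall>a. s a < W" "u < n" "v < n" for s u v a
  proof -
    interpret A: algorithm n B b w "p.node_cap 0" W p.rows 1 using alg[of 0] by simp
    show ?thesis using that A.word_bounds(7)[of u] A.word_bounds(7)[of v] by (simp add: with_operands_def)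
  qed
  have ins: "\<exists>t' s'. exec w (space (card (E \<union> {{u, v}}))) (insert_program B) (with_operands s u v) t' s' \<and>
      inv (E \<union> {{u, v}}) (k + 1) (t + t') s'"
    if I: "inv E k t s" and can: "can_insert n E u v" for E k t s u v
  proof -
    let ?E = "E \<union> {{u, v}}"
    obtain l where l: "good s E l" "\<forall>a. s a < W" "int t + K * p.pot E l \<le> int k * (K * U)"
      using I by (auto simp: inv_def)
    have uv: "u < n" "v < n" "u \<noteq> v" "{u, v} \<notin> E" using can by (auto simp: can_insert_def)
    have E: "simple_edges n E" using inv_simple[OF I] by simp
    then have "simple_edges n ?E" using uv by (auto simp: simple_edges_def)
    then have "card ?E \<le> n * n" by (rule card_simple_edges)
    then interpret A: algorithm n B b w "p.node_cap (card ?E)" W p.rows "card ?E + 1" by (rule alg)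
    have cE: "card ?E = card E + 1" using uv(4) simple_edges_finite[OF E] by simp
    have ok: "A.mem_ok (with_operands s u v)"
      using operands[OF l(2) uv(1,2)] by (simp add: A.mem_ok_def)
    have g: "A.good s E l" using l(1) by (simp add: good_def)
    have wpf: "A.wp (insert_program B) (\<lambda>t' s'. \<exists>l'. good s' ?E l' \<and> int t' + K * p.pot ?E l' \<le> K * (p.pot E l + U)) (with_operands s u v)"
      by (rule A.insert_spec[OF g can]) (use cE in \<open>auto simp: good_def K_def U_def A.upd_def\<close>)
    obtain t' s' l' where *: "exec w (space (card ?E)) (insert_program B) (with_operands s u v) t' s'" "A.mem_ok s'"
        "good s' ?E l'" "int t' + K * p.pot ?E l' \<le> K * (p.pot E l + U)"
      by (rule A.wp_exec[OF wpf ok S_le[of "card ?E", folded A.S_def]]) blast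
    have "int (t + t') + K * p.pot ?E l' \<le> int (k + 1) * (K * U)"
      using *(4) l(3) by (simp add: algebra_simps)
    then show ?thesis using * by (auto simp: inv_def A.mem_ok_def)
  qed
  have del: "\<exists>t' s'. exec w (space (card (E - {{u, v}}))) (delete_program B) (with_operands s u v) t' s' \<and>
      inv (E - {{u, v}}) (k + 1) (t + t') s'"
    if I: "inv E k t s" and can: "can_delete E u v" for E k t s u v
  proof -
    let ?E = "E - {{u, v}}"
    obtain l where l: "good s E l" "\<forall>a. s a < W" "int t + K * p.pot E l \<le> int k * (K * U)"
      using I by (auto simp: inv_def)
    have E: "simple_edges n E" using inv_simple[OF I] by simp
    have uvE: "{u, v} \<in> E" using can by (simp add: can_delete_def)
    note uv = simple_edgesD[OF E uvE]
    have "card ?E \<le> card E" using simple_edges_finite[OF E] by (intro card_mono) auto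
    then have "card ?E \<le> n * n" using inv_simple(2)[OF I] by linarith
    then interpret A: algorithm n B b w "p.node_cap (card ?E)" W p.rows "card ?E + 1" by (rule alg)
    have cE: "card E = card ?E + 1" using uvE simple_edges_finite[OF E] by (metis Suc_eq_plus1 card_Suc_Diff1)
    have ok: "A.mem_ok (with_operands s u v)"
      using operands[OF l(2) uv(1,2)] by (simp add: A.mem_ok_def)
    have g: "A.good s E l" using l(1) by (simp add: good_def)
    have wpf: "A.wp (delete_program B) (\<lambda>t' s'. \<exists>l'. good s' ?E l' \<and> int t' + K * p.pot ?E l' \<le> K * (p.pot E l + U)) (with_operands s u v)"
      by (rule A.delete_spec[OF g can]) (use cE in \<open>auto simp: good_def K_def U_def A.upd_def\<close>)
    obtain t' s' l' where *: "exec w (space (card ?E)) (delete_program B) (with_operands s u v) t' s'" "A.mem_ok s'"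
        "good s' ?E l'" "int t' + K * p.pot ?E l' \<le> K * (p.pot E l + U)"
      by (rule A.wp_exec[OF wpf ok S_le[of "card ?E", folded A.S_def]]) blast
    have "int (t + t') + K * p.pot ?E l' \<le> int (k + 1) * (K * U)"
      using *(4) l(3) by (simp add: algebra_simps)
    then show ?thesis using * by (auto simp: inv_def A.mem_ok_def)
  qed
  have qry: "\<exists>t' s'. exec w (space (card E)) (query_program B) s t' s' \<and> inv E k t s' \<and> real t' \<le> c \<and>
      s' 1 \<noteq> 0 \<and> approximates (4 + 140 * \<epsilon>) (max_density {..<n} E) (real (s' 0) / real (s' 1))"
    if I: "inv E k t s" for E k t s
  proof -
    obtain l where l: "good s E l" "\<forall>a. s a < W" "int t + K * p.pot E l \<le> int k * (K * U)"
      using I by (auto simp: inv_def)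
    interpret A: algorithm n B b w "p.node_cap (card E)" W p.rows "card E + 1"
      using alg inv_simple(2)[OF I] by blast
    have ok: "A.mem_ok s" using l(2) by (simp add: A.mem_ok_def)
    have g: "A.good s E l" using l(1) by (simp add: good_def)
    have wpf: "A.wp (query_program B) (\<lambda>t' s'. good s' E l \<and> t' \<le> 40 \<and> s' 1 \<noteq> 0 \<and>
        approximates (4 + 140 / B) (max_density {..<n} E) (real (s' 0) / real (s' 1))) s"
      by (rule A.query_spec[OF g]) (simp add: good_def)
    obtain t' s' where *: "exec w (space (card E)) (query_program B) s t' s'" "A.mem_ok s'"
        "good s' E l" "t' \<le> 40" "s' 1 \<noteq> 0"
        "approximates (4 + 140 / B) (max_density {..<n} E) (real (s' 0) / real (s' 1))"
      by (rule A.wp_exec[OF wpf ok S_le[of "card E", folded A.S_def]]) blast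
    have "approximates (4 + 140 * \<epsilon>) (max_density {..<n} E) (real (s' 0) / real (s' 1))"
    proof -
      let ?r = "real (s' 0) / real (s' 1)"
      have "140 / real B \<le> 140 * \<epsilon>" using B_lower \<epsilon> B2 by (simp add: field_simps)
      then have "(4 + 140 / real B) * ?r \<le> (4 + 140 * \<epsilon>) * ?r" by (intro mult_right_mono) auto
      moreover have "max_density {..<n} E \<le> (4 + 140 / real B) * ?r"
        using *(6) B2 unfolding approximates_def by (simp add: pos_divide_le_eq add_pos_nonneg mult.commute)
      ultimately have "max_density {..<n} E \<le> (4 + 140 * \<epsilon>) * ?r" by linarith
      then show ?thesis
        using *(6) \<epsilon>(1) unfolding approximates_def by (simp add: pos_divide_le_eq add_pos_nonneg mult.commute)
    qed
    moreover have "real t' \<le> c" using *(4) by (simp add: c_def)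
    moreover have "inv E k t s'" using *(2,3) l(3) by (auto simp: inv_def A.mem_ok_def)
    ultimately show ?thesis using *(1,5) by blast
  qed
  \<comment> \<open>The specifications provide some run with the invariant, and determinism
    identifies it with the run recorded in \<open>reachable\<close>.\<close>
  have reach: "inv E k t s" if "reachable (algorithm_for B) w space n E k t s" for E k t s
    using that
  proof (induction rule: reachable.induct)
    case (start t s)
    then show ?case using pre exec_deterministic by (fastforce simp: algorithm_for_def)
  next
    case (insertion E k T s u v t s')
    obtain t' s'' where "exec w (space (card (E \<union> {{u, v}}))) (insert_program B) (with_operands s u v) t' s''"
      "inv (E \<union> {{u, v}}) (k + 1) (T + t') s''"
      using ins[OF insertion.IH insertion.hyps(2)] by blast
    moreover from this(1) have "t' = t \<and> s'' = s'"
      using exec_deterministic[OF insertion.hyps(3)] by (simp add: algorithm_for_def)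
    ultimately show ?case by simp
  next
    case (deletion E k T s u v t s')
    obtain t' s'' where "exec w (space (card (E - {{u, v}}))) (delete_program B) (with_operands s u v) t' s''"
      "inv (E - {{u, v}}) (k + 1) (T + t') s''"
      using del[OF deletion.IH deletion.hyps(2)] by blast
    moreover from this(1) have "t' = t \<and> s'' = s'"
      using exec_deterministic[OF deletion.hyps(3)] by (simp add: algorithm_for_def)
    ultimately show ?case by simp
  next
    case (answer E k T s t s')
    obtain t' s'' where "exec w (space (card E)) (query_program B) s t' s''" "inv E k T s''"
      using qry[OF answer.IH] by blast
    moreover from this(1) have "t' = t \<and> s'' = s'"
      using exec_deterministic[OF answer.hyps(2)] by (simp add: algorithm_for_def)
    ultimately show ?case by simp
  qed
  have time: "real t \<le> real k * soft" if I: "inv E k t s" for E k t s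
  proof -
    obtain l where l: "good s E l" "int t + K * p.pot E l \<le> int k * (K * U)"
      using I by (auto simp: inv_def)
    interpret A: algorithm n B b w "p.node_cap (card E)" W p.rows "card E + 1"
      using alg inv_simple(2)[OF I] by blast
    have "A.repr s (arcs E) (min_level l) {} l" using l(1) by (simp add: good_def A.good_def)
    then have "0 \<le> p.pot E l" using p.pot_nonneg[OF inv_simple(1)[OF I]] A.reprD(9) by blast
    then have "0 \<le> K * p.pot E l" by (simp add: K_def)
    then have "int t \<le> int k * (K * U)" using l(2) by linarith
    also have "K * U = int (6000 * (b + 1) * (2 * p.T * (p.M * B + 4) + 9 * (p.T + 1) + 6))"
      by (simp add: K_def U_def)
    also have "int k * \<dots> \<le> int k * int (318000 * p.Y ^ 7)"
      by (intro mult_left_mono of_nat_mono p.upd_le) simp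
    finally have "int t \<le> int (k * (318000 * p.Y ^ 7))" by simp
    then have "t \<le> k * (318000 * p.Y ^ 7)" by (simp only: of_nat_le_iff)
    then have "real t \<le> real (k * (318000 * p.Y ^ 7))" by (rule of_nat_mono)
    also have "\<dots> = real k * (318000 * real p.Y ^ 7)" by simp
    also have "\<dots> \<le> real k * soft" using Y7 by (intro mult_left_mono) auto
    finally show ?thesis .
  qed
  have space_eq: "(\<lambda>m. nat \<lfloor>soft * (real m + real n)\<rfloor>) = space" by (simp add: space_def fun_eq_iff)
  show ?thesis
    unfolding soft_def[symmetric] w_def[symmetric] B_def[symmetric] space_eq maintains_densest_subgraph_value_def
  proof (intro conjI allI impI)
    show "\<exists>t s. exec w (space 0) (preprocess (algorithm_for B)) (initial_memory n) t s \<and> real t \<le> soft * real n"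
      using pre by (auto simp: algorithm_for_def)
    fix E k t s assume "reachable (algorithm_for B) w space n E k t s"
    then have I: "inv E k t s" by (rule reach)
    show "real t \<le> real k * soft" using time[OF I] .
    show "s i = 0" if "space (card E) \<le> i" for i using inv_space[OF I that] .
    show "\<exists>t s'. exec w (space (card (E \<union> {{u, v}}))) (insert_edge (algorithm_for B)) (with_operands s u v) t s'"
      if "can_insert n E u v" for u v using ins[OF I that] by (auto simp: algorithm_for_def)
    show "\<exists>t s'. exec w (space (card (E - {{u, v}}))) (delete_edge (algorithm_for B)) (with_operands s u v) t s'"
      if "can_delete E u v" for u v using del[OF I that] by (auto simp: algorithm_for_def)
    show "\<exists>t s'. exec w (space (card E)) (query (algorithm_for B)) s t s' \<and> real t \<le> c \<and> s' 1 \<noteq> 0 \<and>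
        approximates (4 + 140 * \<epsilon>) (max_density {..<n} E) (real (s' 0) / real (s' 1))"
      using qry[OF I] by (auto simp: algorithm_for_def)
  qed
qed

theorem theorem4p1:
  "\<exists>(\<epsilon>\<^sub>0::real) (C::real) (c::real) (q::nat).
     0 < \<epsilon>\<^sub>0 \<and> \<epsilon>\<^sub>0 \<le> 1 \<and> 0 \<le> C \<and> 1 \<le> c \<and>
     (\<forall>\<epsilon>::real. 0 < \<epsilon> \<and> \<epsilon> < \<epsilon>\<^sub>0 \<longrightarrow>
       (\<exists>A::dyn_alg. \<forall>n::nat. 1 \<le> n \<longrightarrow>
          maintains_densest_subgraph_value A n
            (4 + C * \<epsilon>)
            (nat \<lceil>c * log 2 ((real n + 1) / \<epsilon>)\<rceil>)
            (\<lambda>m. nat \<lfloor>soft_factor c q n \<epsilon> * (real m + real n)\<rfloor>)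
            (soft_factor c q n \<epsilon> * real n)
            (soft_factor c q n \<epsilon>)
            c))"
proof (intro exI conjI allI impI)
  fix \<epsilon> :: real and n :: nat
  assume "0 < \<epsilon> \<and> \<epsilon> < 1 / 2" "1 \<le> n"
  \<comment> \<open>This instance fixes the witnesses: \<open>\<epsilon>\<^sub>0 = 1 / 2\<close>,
    \<open>C = 140\<close>, \<open>c = 10 ^ 11\<close>, \<open>q = 7\<close>, and an algorithm that
    depends on \<open>\<epsilon>\<close> but not on \<open>n\<close>.\<close>
  then show "maintains_densest_subgraph_value (algorithm_for (nat \<lceil>1 / \<epsilon>\<rceil>)) n (4 + 140 * \<epsilon>)
    (nat \<lceil>10 ^ 11 * log 2 ((real n + 1) / \<epsilon>)\<rceil>) (\<lambda>m. nat \<lfloor>soft_factor (10 ^ 11) 7 n \<epsilon> * (real m + real n)\<rfloor>)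
    (soft_factor (10 ^ 11) 7 n \<epsilon> * real n) (soft_factor (10 ^ 11) 7 n \<epsilon>) (10 ^ 11)"
    by (intro maintains) auto
qed auto

end
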